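(* Let $(R,\mathfrak{m})$ be an equicharacteristic complete regular local ring, let $\mathfrak{a}\subset R$ be a proper ideal, let $A=R/\mathfrak{a}$ be the quotient ring, with maximal ideal $\mathfrak{m}_A$, and let $\pi:R\longrightarrow A$ be the canonical surjection. Then for any finite self map $\varphi:A\longrightarrow A$ there exists a finite self map $\psi:R\longrightarrow R$ such that $\pi\circ\psi=\varphi\circ\pi$.
   Context: All rings are commutative with identity. A self map of a ring $S$ is a ring homomorphism $\varphi:S\to S$ (not assumed to be linear over any coefficient field). It is finite if $S$ is a finitely generated module over itself via $\varphi$. A local ring is equicharacteristic if it has the same characteristic as its residue field (equivalently, it contains a field). Complete means complete and separated in the topology of powers of the maximal ideal. Regular local rings are Noetherian by definition. *)

theory Defs
  imports "HOL-Algebra.Algebra" "HOL-Library.Extended_Nat"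
begin

(* The zero ring, which has no prime ideals, gets dimension 0 (the supremum of the empty set)
   instead of -1 or minus infinity; it is not local, so this plays no role below. *)
definition krull_dim :: "('a, 'b) ring_scheme \<Rightarrow> enat" where
  "krull_dim R = Sup {enat n | n (P :: nat \<Rightarrow> 'a set).
     (\<forall>i\<le>n. primeideal (P i) R) \<and> (\<forall>i<n. P i \<subset> P (Suc i))}"

definition ring_char :: "('a, 'b) ring_scheme \<Rightarrow> nat" where
  "ring_char R =
     (if \<exists>n::nat. 0 < n \<and> [n] \<cdot>\<^bsub>R\<^esub> \<one>\<^bsub>R\<^esub> = \<zero>\<^bsub>R\<^esub>
      then LEAST n::nat. 0 < n \<and> [n] \<cdot>\<^bsub>R\<^esub> \<one>\<^bsub>R\<^esub> = \<zero>\<^bsub>R\<^esub> else 0)"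

(* A maximalideal is proper by definition, so a local ring is nonzero. *)
locale local_ring = cring R for R (structure) +
  fixes \<mm> :: "'a set"
  assumes maximal: "maximalideal \<mm> R"
    and unique_maximal: "maximalideal \<nn> R \<Longrightarrow> \<nn> = \<mm>"

(* Regularity: the maximal ideal can be generated by dim R elements. *)
locale regular_local_ring = local_ring R \<mm> + noetherian_ring R
  for R (structure) and \<mm> +
  assumes regular: "\<exists>S \<subseteq> carrier R. finite S \<and> enat (card S) = krull_dim R \<and> \<mm> = Idl S"

locale equicharacteristic_local_ring = local_ring +
  assumes equicharacteristic: "ring_char R = ring_char (R Quot \<mm>)"

(* Powers in ideals_set R are powers of ideals, the zeroth power being carrier R. *)
locale complete_local_ring = local_ring +
  assumes separated: "(\<Inter>n::nat. \<mm> [^]\<^bsub>ideals_set R\<^esub> n) = {\<zero>}"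
    and complete: "\<And>x :: nat \<Rightarrow> 'a.
      \<lbrakk> \<And>i. x i \<in> carrier R;
        \<And>k::nat. \<exists>N. \<forall>i\<ge>N. \<forall>j\<ge>N. x i \<ominus> x j \<in> \<mm> [^]\<^bsub>ideals_set R\<^esub> k \<rbrakk>
      \<Longrightarrow> \<exists>l \<in> carrier R. \<forall>k::nat. \<exists>N. \<forall>i\<ge>N. x i \<ominus> l \<in> \<mm> [^]\<^bsub>ideals_set R\<^esub> k"

(* A scalar s acts on S as multiplication by f s. *)
definition finite_self_map :: "('a, 'b) ring_scheme \<Rightarrow> ('a \<Rightarrow> 'a) \<Rightarrow> bool" where
  "finite_self_map S f \<longleftrightarrow> f \<in> ring_hom S S \<and>
     (\<exists>B \<subseteq> carrier S. finite B \<and>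
        (\<forall>x \<in> carrier S. \<exists>c \<in> B \<rightarrow> carrier S. x = (\<Oplus>\<^bsub>S\<^esub>b\<in>B. f (c b) \<otimes>\<^bsub>S\<^esub> b)))"

end

(* Let R be generated over a coefficient field K by a regular system of parameters xs, so that R is the
   power series ring K[[xs]]. A lift of phi is determined by a lift g of phi restricted to K and by a
   choice of representatives ys of the images of xs. The lift g exists because the preimage S in R of
   the field phi(K) is a local ring with maximal ideal A, the given ideal, and such a ring has a
   coefficient field; it is constructed modulo A, A^2, A^4, ... with Zorn's lemma, extending a subfield
   by one element at a time. The lift is finite as soon as the ys generate an ideal primary to the
   maximal ideal. Since phi is finite, A and the ys together do, and prime avoidance allows the ys to be
   changed within their cosets modulo A so that the ys alone do.

   The dimension theory rests on one substitution: given a nonzero series F in variables z_1, ..., z_n and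
   t, replacing each z_i by t^w_i with suitable weights w_i turns F into a unit times a power of t. Hence
   one parameter less suffices modulo F. This bounds the length of chains of primes by the number of
   parameters, and shows that R is a domain and that power series expansions are unique. *)
theory Submission
  imports Defs
begin

section \<open>Ideals modulo the zero ideal\<close>

text \<open>As phi is not linear over K, phi(K) need not be the image of K in the quotient, so the
  lift needs a second field in R. This is why coefficient fields are constructed for a ring like S
  and not only for R. Extending a subfield by one element modulo the square of an ideal is a Newton
  step, and it meets one obstacle: the minimal relation may be inseparable, with a derivative that
  vanishes. In characteristic p, Zorn's lemma therefore starts from the p-th powers: modulo the
  square they depend only on the residue of the base, so they can be lifted without any choice, and
  every element then has degree at most p. Squaring the ideal at each stage lets a single Newton
  correction suffice each time. Congruence modulo an ideal Z stands for equality throughout, because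
  the quotients and subrings that occur are not types. For the same reason homomorphisms are
  subrings of the product R x R. That the lift is well defined then means that first entry in Z
  forces second entry in Z, and this is where uniqueness of power series expansions enters.\<close>

definition cr_ideal :: "'r::comm_ring_1 set \<Rightarrow> bool" where
  "cr_ideal J \<longleftrightarrow> 0 \<in> J \<and> (\<forall>x\<in>J. \<forall>y\<in>J. x + y \<in> J) \<and> (\<forall>r. \<forall>x\<in>J. r * x \<in> J)"

definition cr_prime :: "'r::comm_ring_1 set \<Rightarrow> bool" where
  "cr_prime P \<longleftrightarrow> cr_ideal P \<and> 1 \<notin> P \<and> (\<forall>a b. a * b \<in> P \<longrightarrow> a \<in> P \<or> b \<in> P)"

definition cr_subring :: "'r::comm_ring_1 set \<Rightarrow> bool" where
  "cr_subring B \<longleftrightarrow> 1 \<in> B \<and> (\<forall>x\<in>B. \<forall>y\<in>B. x - y \<in> B) \<and> (\<forall>x\<in>B. \<forall>y\<in>B. x * y \<in> B)"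

definition adjoin :: "'r::comm_ring_1 set \<Rightarrow> 'r \<Rightarrow> 'r set" where
  "adjoin J z = {j + z * r | j r. j \<in> J}"

primrec adjoins :: "'r::comm_ring_1 set \<Rightarrow> 'r list \<Rightarrow> 'r set" where
  "adjoins J [] = J"
| "adjoins J (z # zs) = adjoins (adjoin J z) zs"

definition ideal_gen :: "'r::comm_ring_1 set \<Rightarrow> 'r set" where
  "ideal_gen S = \<Inter>{J. cr_ideal J \<and> S \<subseteq> J}"

lemma ideal_zero: "cr_ideal J \<Longrightarrow> 0 \<in> J"
  and ideal_add: "cr_ideal J \<Longrightarrow> x \<in> J \<Longrightarrow> y \<in> J \<Longrightarrow> x + y \<in> J"
  and ideal_mult_left: "cr_ideal J \<Longrightarrow> x \<in> J \<Longrightarrow> r * x \<in> J"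
  by (auto simp: cr_ideal_def)

lemma ideal_mult_right: "cr_ideal J \<Longrightarrow> x \<in> J \<Longrightarrow> x * r \<in> J"
  using ideal_mult_left[of J x r] by (simp add: mult.commute)

lemma ideal_uminus: "cr_ideal J \<Longrightarrow> x \<in> J \<Longrightarrow> - x \<in> J"
  using ideal_mult_left[of J x "-1"] by simp

lemma ideal_diff: "cr_ideal J \<Longrightarrow> x \<in> J \<Longrightarrow> y \<in> J \<Longrightarrow> x - y \<in> J"
  using ideal_add[of J x "- y"] ideal_uminus[of J y] by simp

lemmas ideal_intros = ideal_zero ideal_add ideal_mult_left ideal_mult_right ideal_uminus ideal_diff

lemma ideal_sum: "cr_ideal J \<Longrightarrow> (\<And>i. i \<in> I \<Longrightarrow> f i \<in> J) \<Longrightarrow> sum f I \<in> J"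
  by (induction I rule: infinite_finite_induct) (auto intro: ideal_intros)

lemma ideal_mem_cong: "cr_ideal J \<Longrightarrow> x - y \<in> J \<Longrightarrow> x \<in> J \<longleftrightarrow> y \<in> J"
  using ideal_add[of J "x - y" y] ideal_diff[of J x "x - y"] by auto

lemma ideal_diff_commute: "cr_ideal J \<Longrightarrow> x - y \<in> J \<longleftrightarrow> y - x \<in> J"
  using ideal_uminus[of J "x - y"] ideal_uminus[of J "y - x"] by auto

lemma ideal_diff_trans: "cr_ideal J \<Longrightarrow> x - y \<in> J \<Longrightarrow> y - z \<in> J \<Longrightarrow> x - z \<in> J"
  using ideal_add[of J "x - y" "y - z"] by simp

lemma ideal_mult_cong:
  assumes "cr_ideal J" "a - b \<in> J" "c - d \<in> J" shows "a * c - b * d \<in> J"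
proof -
  have "a * c - b * d = a * (c - d) + d * (a - b)" by (simp add: algebra_simps)
  then show ?thesis using assms by (auto intro!: ideal_add ideal_mult_left)
qed

lemma ideal_power_cong:
  assumes "cr_ideal J" "a - b \<in> J" shows "a ^ n - b ^ n \<in> J"
  by (induction n) (auto intro: assms ideal_mult_cong ideal_zero)

lemma ideal_power: "cr_ideal J \<Longrightarrow> x \<in> J \<Longrightarrow> 0 < n \<Longrightarrow> x ^ n \<in> J"
  by (cases n) (auto intro: ideal_mult_right)

lemma ideal_UNIV: "cr_ideal UNIV"
  by (simp add: cr_ideal_def)

lemma ideal_one: "cr_ideal J \<Longrightarrow> 1 \<in> J \<Longrightarrow> x \<in> J"
  using ideal_mult_left[of J 1 x] by simp

lemma ideal_colon: "cr_ideal J \<Longrightarrow> cr_ideal {x. b * x \<in> J}"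
  unfolding cr_ideal_def by (auto simp: distrib_left mult.left_commute)

lemma ideal_gen_ideal: "cr_ideal (ideal_gen S)"
  unfolding ideal_gen_def cr_ideal_def by blast

lemma ideal_gen_superset: "S \<subseteq> ideal_gen S"
  unfolding ideal_gen_def by blast

lemma ideal_gen_least: "cr_ideal J \<Longrightarrow> S \<subseteq> J \<Longrightarrow> ideal_gen S \<subseteq> J"
  unfolding ideal_gen_def by blast

lemma adjoin_ideal:
  assumes "cr_ideal J" shows "cr_ideal (adjoin J z)"
  unfolding cr_ideal_def
proof (intro conjI ballI allI)
  have "0 = 0 + z * 0" by simp
  then show "0 \<in> adjoin J z" using ideal_zero[OF assms] unfolding adjoin_def by blast
next
  fix x y assume "x \<in> adjoin J z" "y \<in> adjoin J z"
  then obtain i r j s where "i \<in> J" "j \<in> J" and e: "x = i + z * r" "y = j + z * s"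
    unfolding adjoin_def by blast
  then have "x + y = (i + j) + z * (r + s)" "i + j \<in> J"
    using assms by (auto simp: algebra_simps intro: ideal_add)
  then show "x + y \<in> adjoin J z" unfolding adjoin_def by blast
next
  fix r x assume "x \<in> adjoin J z"
  then obtain i s where "i \<in> J" "x = i + z * s" unfolding adjoin_def by blast
  then have "r * x = (r * i) + z * (r * s)" "r * i \<in> J"
    using assms by (auto simp: distrib_left mult.left_commute intro: ideal_mult_left)
  then show "r * x \<in> adjoin J z" unfolding adjoin_def by blast
qed

lemma adjoin_superset: "J \<subseteq> adjoin J z"
proof
  fix x assume "x \<in> J"
  moreover have "x = x + z * 0" by simp
  ultimately show "x \<in> adjoin J z" unfolding adjoin_def by blast
qed

lemma adjoin_self: "cr_ideal J \<Longrightarrow> z \<in> adjoin J z"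
proof -
  assume "cr_ideal J"
  then have "0 \<in> J" by (rule ideal_zero)
  moreover have "z = 0 + z * 1" by simp
  ultimately show ?thesis unfolding adjoin_def by blast
qed

lemma adjoin_least: "cr_ideal Q \<Longrightarrow> J \<subseteq> Q \<Longrightarrow> z \<in> Q \<Longrightarrow> adjoin J z \<subseteq> Q"
  unfolding adjoin_def by (auto intro!: ideal_add ideal_mult_right)

lemma adjoins_ideal: "cr_ideal J \<Longrightarrow> cr_ideal (adjoins J zs)"
  by (induction zs arbitrary: J) (auto intro: adjoin_ideal)

lemma adjoins_superset: "J \<subseteq> adjoins J zs"
  by (induction zs arbitrary: J) (auto dest: subsetD[OF adjoin_superset])

lemma adjoins_self: "cr_ideal J \<Longrightarrow> set zs \<subseteq> adjoins J zs"
proof (induction zs arbitrary: J)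
  case (Cons z zs)
  then show ?case
    using adjoins_superset[of "adjoin J z" zs] adjoin_self[of J z] adjoin_ideal[of J z] by auto
qed simp

lemma adjoins_least: "cr_ideal Q \<Longrightarrow> J \<subseteq> Q \<Longrightarrow> set zs \<subseteq> Q \<Longrightarrow> adjoins J zs \<subseteq> Q"
  by (induction zs arbitrary: J) (auto dest: adjoin_least)

lemma subring_one: "cr_subring B \<Longrightarrow> 1 \<in> B"
  and subring_diff: "cr_subring B \<Longrightarrow> x \<in> B \<Longrightarrow> y \<in> B \<Longrightarrow> x - y \<in> B"
  and subring_mult: "cr_subring B \<Longrightarrow> x \<in> B \<Longrightarrow> y \<in> B \<Longrightarrow> x * y \<in> B"
  by (auto simp: cr_subring_def)

lemma subring_zero: "cr_subring B \<Longrightarrow> 0 \<in> B"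
  using subring_diff[of B 1 1] subring_one by auto

lemma subring_uminus: "cr_subring B \<Longrightarrow> x \<in> B \<Longrightarrow> - x \<in> B"
  using subring_diff[of B 0 x] subring_zero by auto

lemma subring_add: "cr_subring B \<Longrightarrow> x \<in> B \<Longrightarrow> y \<in> B \<Longrightarrow> x + y \<in> B"
  using subring_diff[of B x "- y"] subring_uminus by auto

lemmas subring_intros =
  subring_one subring_diff subring_mult subring_zero subring_uminus subring_add

lemma subring_sum: "cr_subring B \<Longrightarrow> (\<And>i. i \<in> I \<Longrightarrow> f i \<in> B) \<Longrightarrow> sum f I \<in> B"
  by (induction I rule: infinite_finite_induct) (auto intro: subring_intros)

lemma subring_power: "cr_subring B \<Longrightarrow> x \<in> B \<Longrightarrow> x ^ n \<in> B"
  by (induction n) (auto intro: subring_intros)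

lemma subring_of_nat: "cr_subring B \<Longrightarrow> of_nat n \<in> B"
  by (induction n) (auto intro: subring_intros)

lemma prime_ideal: "cr_prime P \<Longrightarrow> cr_ideal P"
  and prime_one: "cr_prime P \<Longrightarrow> 1 \<notin> P"
  and prime_mult: "cr_prime P \<Longrightarrow> a * b \<in> P \<Longrightarrow> a \<in> P \<or> b \<in> P"
  by (auto simp: cr_prime_def)

lemma prime_mult_iff: "cr_prime P \<Longrightarrow> a * b \<in> P \<longleftrightarrow> a \<in> P \<or> b \<in> P"
  using prime_mult ideal_mult_left ideal_mult_right prime_ideal by blast

lemma prime_power: "cr_prime P \<Longrightarrow> x ^ n \<in> P \<Longrightarrow> x \<in> P"
  by (induction n) (auto dest: prime_one prime_mult)


text \<open>A local Noetherian ring given as a quotient by an ideal \<open>Z\<close>. The ambient ring, of class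
  \<open>comm_ring_1\<close>, need be neither local nor Noetherian; equality in the quotient is congruence modulo
  \<open>Z\<close>, and ideals of the quotient are ideals that contain \<open>Z\<close>. The last assumption states that the
  quotient is Noetherian.\<close>

locale local_noetherian_mod =
  fixes Z M :: "'r::comm_ring_1 set"
  assumes ideal_Z: "cr_ideal Z" and ideal_M: "cr_ideal M" and Z_subset_M: "Z \<subseteq> M"
    and one_notin_M: "1 \<notin> M"
    and inverse_mod: "x \<notin> M \<Longrightarrow> \<exists>y. x * y - 1 \<in> Z"
    and maximal_ideal_in: "\<lbrakk>\<J> \<noteq> {}; \<J> \<subseteq> {J. cr_ideal J \<and> Z \<subseteq> J}\<rbrakk>
        \<Longrightarrow> \<exists>J\<in>\<J>. \<forall>J'\<in>\<J>. J \<subseteq> J' \<longrightarrow> J' = J"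
begin

lemma prime_M: "cr_prime M"
  unfolding cr_prime_def
proof (intro conjI allI impI ideal_M one_notin_M)
  fix a b assume ab: "a * b \<in> M"
  show "a \<in> M \<or> b \<in> M"
  proof (rule ccontr)
    assume "\<not> (a \<in> M \<or> b \<in> M)"
    then obtain c where "a * c - 1 \<in> Z" using inverse_mod by blast
    then have "b * (a * c - 1) \<in> M" using ideal_M Z_subset_M by (auto intro: ideal_mult_left)
    moreover have "b = a * b * c - b * (a * c - 1)" by (simp add: algebra_simps)
    ultimately have "b \<in> M" using ab ideal_M by (metis ideal_diff ideal_mult_right)
    with \<open>\<not> (a \<in> M \<or> b \<in> M)\<close> show False by blast
  qed
qed

lemma proper_ideal_subset_M:
  assumes "cr_ideal J" "Z \<subseteq> J" "1 \<notin> J" shows "J \<subseteq> M"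
proof
  fix x assume x: "x \<in> J"
  show "x \<in> M"
  proof (rule ccontr)
    assume "x \<notin> M"
    then obtain y where "x * y - 1 \<in> J" using inverse_mod assms(2) by blast
    then have "x * y - (x * y - 1) \<in> J" using assms(1) x by (blast intro: ideal_diff ideal_mult_right)
    with assms(3) show False by simp
  qed
qed

lemma prime_subset_M: "cr_prime P \<Longrightarrow> Z \<subseteq> P \<Longrightarrow> P \<subseteq> M"
  by (simp add: proper_ideal_subset_M prime_ideal prime_one)

text \<open>By \<open>power_of_M_subset\<close> below, this means that \<open>S\<close> and \<open>Z\<close> generate an ideal containing a power
  of \<open>M\<close>.\<close>

definition mprim :: "'r set \<Rightarrow> bool" where
  "mprim S \<longleftrightarrow> (\<forall>P. cr_prime P \<longrightarrow> Z \<subseteq> P \<longrightarrow> S \<subseteq> P \<longrightarrow> M \<subseteq> P)"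

section \<open>Powers of the maximal ideal, Nakayama's lemma, Krull's intersection theorem\<close>

primrec pw :: "nat \<Rightarrow> 'r set" where
  "pw 0 = UNIV"
| "pw (Suc n) = ideal_gen ({a * b | a b. a \<in> pw n \<and> b \<in> M} \<union> Z)"

lemma pw_ideal: "cr_ideal (pw n)"
  by (cases n) (auto simp: ideal_UNIV ideal_gen_ideal)

lemma Z_subset_pw: "Z \<subseteq> pw n"
  by (cases n) (auto intro: subsetD[OF ideal_gen_superset])

lemma pw_Suc_mult: "a \<in> pw n \<Longrightarrow> b \<in> M \<Longrightarrow> a * b \<in> pw (Suc n)"
  unfolding pw.simps by (rule subsetD[OF ideal_gen_superset]) blast

lemma pw_Suc_subset: "pw (Suc n) \<subseteq> pw n"
  unfolding pw.simps(2)
  by (rule ideal_gen_least[OF pw_ideal]) (use Z_subset_pw in \<open>auto intro: ideal_mult_right pw_ideal\<close>)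

lemma pw_antimono: "i \<le> j \<Longrightarrow> pw j \<subseteq> pw i"
  by (induction j rule: dec_induct) (use pw_Suc_subset in auto)

lemma pw_Suc_subset_M: "pw (Suc n) \<subseteq> M"
  unfolding pw.simps(2)
  by (rule ideal_gen_least[OF ideal_M]) (use Z_subset_M in \<open>auto intro: ideal_mult_left ideal_M\<close>)

lemma M_subset_pw_1: "M \<subseteq> pw (Suc 0)"
  using pw_Suc_mult[of 1 0] by auto

lemma power_in_pw: "z \<in> M \<Longrightarrow> z ^ n \<in> pw n"
  by (induction n) (auto simp: mult.commute[of z] simp del: pw.simps(2) intro: pw_Suc_mult)

text \<open>Powers are built one factor of \<open>M\<close> at a time. Replacing \<open>I\<close> by
  the colon ideal of an element of \<open>M\<close> moves such a factor from the product into
  \<open>I\<close>, so that the induction hypothesis applies.\<close>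

lemma pw_add_subset:
  assumes "cr_ideal I" "Z \<subseteq> I" "\<And>a b. a \<in> pw i \<Longrightarrow> b \<in> pw j \<Longrightarrow> a * b \<in> I"
  shows "pw (i + j) \<subseteq> I"
  using assms
proof (induction j arbitrary: I)
  case 0
  then show ?case using "0.prems"(3)[of _ 1] by auto
next
  case (Suc j)
  have "pw (i + j) \<subseteq> {x. b * x \<in> I}" if b: "b \<in> M" for b
  proof (rule Suc.IH)
    show "cr_ideal {x. b * x \<in> I}" by (rule ideal_colon[OF Suc.prems(1)])
    show "Z \<subseteq> {x. b * x \<in> I}" using Suc.prems by (auto intro: ideal_mult_left)
    show "c * d \<in> {x. b * x \<in> I}" if "c \<in> pw i" "d \<in> pw j" for c d
      using Suc.prems(3)[OF that(1) pw_Suc_mult[OF that(2) b]] by (simp add: ac_simps)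
  qed
  then have "{a * b |a b. a \<in> pw (i + j) \<and> b \<in> M} \<union> Z \<subseteq> I"
    using Suc.prems(2) by (fastforce simp: mult.commute)
  then show ?case using ideal_gen_least[OF Suc.prems(1)] by simp
qed

text \<open>An ideal maximal among those that contain \<open>J\<close> but no power of
  \<open>M\<close> is prime, since powers inside \<open>adjoin I a\<close> and
  \<open>adjoin I b\<close> multiply into \<open>I\<close> when \<open>a * b \<in> I\<close>. Then
  \<open>mprim\<close> puts \<open>M\<close> inside it, a contradiction.\<close>

lemma power_of_M_subset:
  assumes J: "cr_ideal J" "Z \<subseteq> J" and m: "mprim J"
  shows "\<exists>N. pw N \<subseteq> J"
proof (rule ccontr)
  assume no: "\<not> (\<exists>N. pw N \<subseteq> J)"
  let ?F = "{I. cr_ideal I \<and> J \<subseteq> I \<and> \<not> (\<exists>N. pw N \<subseteq> I)}"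
  have "?F \<noteq> {}" using J(1) no by blast
  moreover have "?F \<subseteq> {J. cr_ideal J \<and> Z \<subseteq> J}" using J(2) by blast
  ultimately have "\<exists>J\<in>?F. \<forall>J'\<in>?F. J \<subseteq> J' \<longrightarrow> J' = J" by (rule maximal_ideal_in)
  then obtain I where I: "I \<in> ?F" and mx: "\<forall>I'\<in>?F. I \<subseteq> I' \<longrightarrow> I' = I"
    by (rule bexE)
  have Ii: "cr_ideal I" and JI: "J \<subseteq> I" and nI: "\<And>N. \<not> pw N \<subseteq> I" using I by auto
  have big: "\<exists>N. pw N \<subseteq> adjoin I a" if "a \<notin> I" for a
  proof (rule ccontr)
    assume "\<not> ?thesis"
    then have "adjoin I a \<in> ?F" using adjoin_ideal[OF Ii] adjoin_superset[of I a] JI by blast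
    with mx adjoin_superset have "adjoin I a = I" by blast
    with adjoin_self[OF Ii] that show False by blast
  qed
  have "cr_prime I"
    unfolding cr_prime_def
  proof (intro conjI allI impI Ii)
    show "1 \<notin> I" using nI[of 0] ideal_one[OF Ii] by auto
    fix a b assume ab: "a * b \<in> I"
    show "a \<in> I \<or> b \<in> I"
    proof (rule ccontr)
      assume "\<not> (a \<in> I \<or> b \<in> I)"
      then obtain i j where i: "pw i \<subseteq> adjoin I a" and j: "pw j \<subseteq> adjoin I b" using big by meson
      have "x * y \<in> I" if "x \<in> pw i" "y \<in> pw j" for x y
      proof -
        obtain u r v s where "u \<in> I" "v \<in> I" and e: "x = u + a * r" "y = v + b * s"
          using i j \<open>x \<in> pw i\<close> \<open>y \<in> pw j\<close> unfolding adjoin_def by blast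
        have "x * y = u * y + v * (a * r) + (a * b) * (r * s)"
          unfolding e by (simp add: algebra_simps)
        also have "\<dots> \<in> I" using Ii ab \<open>u \<in> I\<close> \<open>v \<in> I\<close> by (blast intro: ideal_add ideal_mult_right)
        finally show ?thesis .
      qed
      then have "pw (i + j) \<subseteq> I" using pw_add_subset Ii JI J(2) by (meson order.trans)
      with nI show False by blast
    qed
  qed
  then have "M \<subseteq> I" using m JI J(2) unfolding mprim_def by blast
  then have "pw (Suc 0) \<subseteq> I" using pw_Suc_subset_M by blast
  with nI show False by blast
qed

text \<open>The ascending chain condition gives an ideal \<open>T\<close> maximal among those over
  \<open>J\<close> and strictly below \<open>I\<close>. Then \<open>I\<close> is generated over
  \<open>T\<close> by one element \<open>v\<close>, and the hypothesis becomes
  \<open>v = t + v * m\<close> with \<open>1 - m\<close> a unit.\<close>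

lemma nakayama:
  assumes J: "cr_ideal J" "Z \<subseteq> J" and I: "cr_ideal I" "J \<subseteq> I"
    and gen: "I \<subseteq> ideal_gen ({a * b | a b. a \<in> M \<and> b \<in> I} \<union> J)"
  shows "I = J"
proof (rule ccontr)
  assume ne: "I \<noteq> J"
  let ?F = "{T. cr_ideal T \<and> J \<subseteq> T \<and> T \<subseteq> I \<and> T \<noteq> I}"
  have "?F \<noteq> {}" using J(1) I ne by blast
  moreover have "?F \<subseteq> {J. cr_ideal J \<and> Z \<subseteq> J}" using J(2) by blast
  ultimately have "\<exists>J\<in>?F. \<forall>J'\<in>?F. J \<subseteq> J' \<longrightarrow> J' = J" by (rule maximal_ideal_in)
  then obtain T where T: "T \<in> ?F" and mx: "\<forall>T'\<in>?F. T \<subseteq> T' \<longrightarrow> T' = T"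
    by (rule bexE)
  have Ti: "cr_ideal T" and JT: "J \<subseteq> T" and TI: "T \<subseteq> I" using T by auto
  obtain v where v: "v \<in> I" "v \<notin> T" using T by blast
  have Iv: "I = adjoin T v"
  proof (rule ccontr)
    assume "I \<noteq> adjoin T v"
    moreover have "adjoin T v \<subseteq> I" using adjoin_least I(1) TI v(1) by blast
    ultimately have "adjoin T v \<in> ?F" using adjoin_ideal[OF Ti] adjoin_superset[of T v] JT by blast
    with mx adjoin_superset have "adjoin T v = T" by blast
    with adjoin_self[OF Ti] v(2) show False by blast
  qed
  let ?Y = "{t + v * m | t m. t \<in> T \<and> m \<in> M}"
  have "cr_ideal ?Y"
    unfolding cr_ideal_def
  proof (intro conjI ballI allI)
    have "0 = 0 + v * 0" by simp
    then show "0 \<in> ?Y" using ideal_zero[OF Ti] ideal_zero[OF ideal_M] by blast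
  next
    fix x y assume "x \<in> ?Y" "y \<in> ?Y"
    then obtain i r j s where "i \<in> T" "j \<in> T" "r \<in> M" "s \<in> M" "x = i + v * r" "y = j + v * s"
      by blast
    then have "x + y = (i + j) + v * (r + s)" "i + j \<in> T" "r + s \<in> M"
      using Ti ideal_M by (auto simp: algebra_simps intro: ideal_add)
    then show "x + y \<in> ?Y" by blast
  next
    fix r x assume "x \<in> ?Y"
    then obtain i s where "i \<in> T" "s \<in> M" "x = i + v * s" by blast
    then have "r * x = (r * i) + v * (r * s)" "r * i \<in> T" "r * s \<in> M"
      using Ti ideal_M by (auto simp: distrib_left mult.left_commute intro: ideal_mult_left)
    then show "r * x \<in> ?Y" by blast
  qed
  moreover have "{a * b | a b. a \<in> M \<and> b \<in> I} \<union> J \<subseteq> ?Y"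
  proof -
    have "a * b \<in> ?Y" if "a \<in> M" "b \<in> I" for a b
    proof -
      obtain t r where "t \<in> T" "b = t + v * r" using \<open>b \<in> I\<close> Iv unfolding adjoin_def by blast
      then have "a * b = a * t + v * (a * r)" "a * t \<in> T" "a * r \<in> M"
        using Ti ideal_M \<open>a \<in> M\<close>
        by (auto simp: algebra_simps intro: ideal_mult_left ideal_mult_right)
      then show ?thesis by blast
    qed
    moreover have "x \<in> ?Y" if "x \<in> J" for x
    proof -
      have "x = x + v * 0" by simp
      then show ?thesis using that JT ideal_zero[OF ideal_M] by blast
    qed
    ultimately show ?thesis by blast
  qed
  ultimately have "v \<in> ?Y" using ideal_gen_least gen v(1) by blast
  then obtain t m where t: "t \<in> T" "m \<in> M" "v = t + v * m" by blast
  have "1 - m \<notin> M" using t(2) one_notin_M ideal_M ideal_add[of M "1 - m" m] by auto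
  then obtain y where y: "(1 - m) * y - 1 \<in> T" using inverse_mod J(2) JT by blast
  have tv: "t = v * (1 - m)" using t(3) by (metis add_diff_cancel_right' mult.right_neutral right_diff_distrib)
  have "v = t * y - v * ((1 - m) * y - 1)"
    unfolding tv by (simp add: algebra_simps)
  then have "v \<in> T" using Ti t(1) y by (metis ideal_diff ideal_mult_left ideal_mult_right)
  with v(2) show False by blast
qed

text \<open>Krull's intersection theorem. The ideal \<open>L\<close>, maximal with \<open>L \<inter> I = M I + J\<close>, contains a power
  of \<open>M\<close>, whence \<open>I = M I + J\<close> and Nakayama's lemma applies.\<close>

theorem ideal_closed:
  assumes J: "cr_ideal J" "Z \<subseteq> J" and x: "\<And>n. \<exists>j\<in>J. x - j \<in> pw n"
  shows "x \<in> J"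
proof -
  define I where "I = {x. \<forall>n. \<exists>j\<in>J. x - j \<in> pw n}"
  define Q where "Q = ideal_gen ({a * b | a b. a \<in> M \<and> b \<in> I} \<union> J)"
  have Ii: "cr_ideal I"
    unfolding cr_ideal_def
  proof (intro conjI ballI allI)
    show "0 \<in> I" unfolding I_def using ideal_zero[OF J(1)] ideal_zero[OF pw_ideal]
      by (auto intro!: bexI[of _ 0])
  next
    fix x y assume xy: "x \<in> I" "y \<in> I"
    have "\<exists>j\<in>J. x + y - j \<in> pw n" for n
    proof -
      obtain i j where "i \<in> J" "j \<in> J" "x - i \<in> pw n" "y - j \<in> pw n"
        using xy unfolding I_def by blast
      then show ?thesis using ideal_add[OF pw_ideal, of "x - i" n "y - j"] J(1)
        by (auto simp: algebra_simps intro!: bexI[of _ "i + j"] ideal_add)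
    qed
    then show "x + y \<in> I" unfolding I_def by blast
  next
    fix r x assume xy: "x \<in> I"
    have "\<exists>j\<in>J. r * x - j \<in> pw n" for n
    proof -
      obtain i where "i \<in> J" "x - i \<in> pw n" using xy unfolding I_def by blast
      then show ?thesis using ideal_mult_left[OF pw_ideal, of "x - i" n r] J(1)
        by (auto simp: algebra_simps intro!: bexI[of _ "r * i"] ideal_mult_left)
    qed
    then show "r * x \<in> I" unfolding I_def by blast
  qed
  have JI: "J \<subseteq> I" unfolding I_def using ideal_zero[OF pw_ideal] by force
  have Qi: "cr_ideal Q" unfolding Q_def by (rule ideal_gen_ideal)
  have JQ: "J \<subseteq> Q" unfolding Q_def using ideal_gen_superset by blast
  have MQ: "a * b \<in> Q" if "a \<in> M" "b \<in> I" for a b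
    unfolding Q_def using that by (intro subsetD[OF ideal_gen_superset]) blast
  let ?F = "{L. cr_ideal L \<and> Q \<subseteq> L \<and> L \<inter> I \<subseteq> Q}"
  have "?F \<noteq> {}" using Qi by blast
  moreover have "?F \<subseteq> {J. cr_ideal J \<and> Z \<subseteq> J}" using JQ J(2) by blast
  ultimately have "\<exists>J\<in>?F. \<forall>J'\<in>?F. J \<subseteq> J' \<longrightarrow> J' = J" by (rule maximal_ideal_in)
  then obtain L where L: "L \<in> ?F" and mx: "\<forall>T'\<in>?F. L \<subseteq> T' \<longrightarrow> T' = L"
    by (rule bexE)
  have Li: "cr_ideal L" and QL: "Q \<subseteq> L" and LI: "L \<inter> I \<subseteq> Q" using L by auto
  have pow: "\<exists>n. x ^ n \<in> L" if x: "x \<in> M" for x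
  proof -
    \<comment> \<open>The colon ideals of the \<open>x ^ n\<close> ascend, so
      \<open>C (Suc n) = C n\<close> for some \<open>n\<close>. Adjoining \<open>x ^ n\<close> to
      \<open>L\<close> then keeps the intersection with \<open>I\<close> inside \<open>Q\<close>,
      and maximality of \<open>L\<close> gives \<open>x ^ n \<in> L\<close>.\<close>
    define C where "C n = {r. x ^ n * r \<in> L}" for n
    have C: "cr_ideal (C n) \<and> Z \<subseteq> C n" for n
      unfolding C_def using ideal_colon[OF Li] J(2) JQ QL ideal_mult_left[OF Li] by blast
    have "\<exists>J\<in>range C. \<forall>J'\<in>range C. J \<subseteq> J' \<longrightarrow> J' = J"
      by (rule maximal_ideal_in) (use C in auto)
    then obtain D where "D \<in> range C" and D: "\<forall>J'\<in>range C. D \<subseteq> J' \<longrightarrow> J' = D" by (rule bexE)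
    then obtain n where "D = C n" by blast
    then have n: "C n \<subseteq> C k \<Longrightarrow> C k = C n" for k using D by simp
    have "C n \<subseteq> C (Suc n)" unfolding C_def using Li by (auto intro: ideal_mult_left simp: mult.assoc)
    then have Cn: "C (Suc n) = C n" using n by blast
    have "adjoin L (x ^ n) \<inter> I \<subseteq> Q"
    proof
      fix u assume u: "u \<in> adjoin L (x ^ n) \<inter> I"
      then obtain l r where l: "l \<in> L" "u = l + x ^ n * r" unfolding adjoin_def by blast
      have "x * u \<in> L" using MQ x u QL by blast
      moreover have "x ^ Suc n * r = x * u - x * l" using l(2) by (simp add: algebra_simps)
      ultimately have "x ^ Suc n * r \<in> L" using Li l(1) by (simp add: ideal_diff ideal_mult_left)
      then have "x ^ n * r \<in> L" using Cn unfolding C_def by blast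
      then have "u \<in> L" using l Li by (auto intro: ideal_add)
      then show "u \<in> Q" using u LI by blast
    qed
    then have "adjoin L (x ^ n) \<in> ?F" using adjoin_ideal[OF Li] adjoin_superset[of L "x ^ n"] QL by blast
    with mx adjoin_superset have "adjoin L (x ^ n) = L" by blast
    with adjoin_self[OF Li] show ?thesis by blast
  qed
  have "mprim L" unfolding mprim_def using pow prime_power by blast
  then obtain N where N: "pw N \<subseteq> L" using power_of_M_subset[OF Li] J(2) JQ QL by blast
  have "I \<subseteq> L"
  proof
    fix y assume "y \<in> I"
    then obtain j where "j \<in> J" "y - j \<in> pw N" unfolding I_def by blast
    then have "y - j \<in> L" "j \<in> L" using N JQ QL by auto
    then show "y \<in> L" using Li ideal_mem_cong by blast
  qed
  then have "I = J" using nakayama[OF J Ii JI] LI unfolding Q_def by blast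
  then show ?thesis using x unfolding I_def by blast
qed

text \<open>A maximal counterexample is neither prime nor the whole ring, so it contains a product
  of two elements outside it; the finite sets for the two enlarged ideals together serve for it. The
  minimal primes over \<open>J\<close> are among the primes found; finiteness prepares for prime
  avoidance.\<close>

lemma finite_primes_below:
  assumes "cr_ideal J" "Z \<subseteq> J"
  shows "\<exists>\<Q>. finite \<Q> \<and> (\<forall>Q\<in>\<Q>. cr_prime Q \<and> J \<subseteq> Q)
    \<and> (\<forall>P. cr_prime P \<longrightarrow> J \<subseteq> P \<longrightarrow> (\<exists>Q\<in>\<Q>. Q \<subseteq> P))"
proof (rule ccontr)
  define good where "good J \<longleftrightarrow> (\<exists>\<Q>. finite \<Q> \<and> (\<forall>Q\<in>\<Q>. cr_prime Q \<and> J \<subseteq> Q)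
    \<and> (\<forall>P. cr_prime P \<longrightarrow> J \<subseteq> P \<longrightarrow> (\<exists>Q\<in>\<Q>. Q \<subseteq> P)))" for J :: "'r set"
  assume "\<not> ?thesis"
  then have ngJ: "\<not> good J" unfolding good_def by blast
  let ?F = "{I. cr_ideal I \<and> Z \<subseteq> I \<and> \<not> good I}"
  have "?F \<noteq> {}" using ngJ assms by blast
  moreover have "?F \<subseteq> {J. cr_ideal J \<and> Z \<subseteq> J}" by blast
  ultimately have "\<exists>J\<in>?F. \<forall>J'\<in>?F. J \<subseteq> J' \<longrightarrow> J' = J" by (rule maximal_ideal_in)
  then obtain I where I: "I \<in> ?F" and mx: "\<forall>I'\<in>?F. I \<subseteq> I' \<longrightarrow> I' = I"
    by (rule bexE)
  have Ii: "cr_ideal I" "Z \<subseteq> I" and bad: "\<not> good I" using I by auto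
  have big: "good (adjoin I a)" if "a \<notin> I" for a
  proof (rule ccontr)
    assume "\<not> ?thesis"
    then have "adjoin I a \<in> ?F" using adjoin_ideal[OF Ii(1)] adjoin_superset[of I a] Ii(2) by blast
    with mx adjoin_superset have "adjoin I a = I" by blast
    with adjoin_self[OF Ii(1)] that show False by blast
  qed
  have "1 \<notin> I"
  proof
    assume "1 \<in> I"
    then have "good I" unfolding good_def using prime_one by (intro exI[of _ "{}"]) blast
    with bad show False by blast
  qed
  moreover have "\<not> cr_prime I"
  proof
    assume "cr_prime I"
    then have "good I" unfolding good_def by (intro exI[of _ "{I}"]) blast
    with bad show False by blast
  qed
  ultimately obtain a b where ab: "a * b \<in> I" "a \<notin> I" "b \<notin> I"
    using Ii(1) unfolding cr_prime_def by blast
  obtain A where A: "finite A" "\<forall>Q\<in>A. cr_prime Q \<and> adjoin I a \<subseteq> Q"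
    "\<forall>P. cr_prime P \<longrightarrow> adjoin I a \<subseteq> P \<longrightarrow> (\<exists>Q\<in>A. Q \<subseteq> P)" using big[OF ab(2)] unfolding good_def by blast
  obtain B where B: "finite B" "\<forall>Q\<in>B. cr_prime Q \<and> adjoin I b \<subseteq> Q"
    "\<forall>P. cr_prime P \<longrightarrow> adjoin I b \<subseteq> P \<longrightarrow> (\<exists>Q\<in>B. Q \<subseteq> P)" using big[OF ab(3)] unfolding good_def by blast
  have "good I"
    unfolding good_def
  proof (intro exI[of _ "A \<union> B"] conjI ballI allI impI)
    show "finite (A \<union> B)" using A B by blast
    show "cr_prime Q" if "Q \<in> A \<union> B" for Q using that A(2) B(2) by blast
    show "I \<subseteq> Q" if "Q \<in> A \<union> B" for Q
      using that A(2) B(2) adjoin_superset by (metis Un_iff order.trans)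
    fix P assume P: "cr_prime P" "I \<subseteq> P"
    then have "a \<in> P \<or> b \<in> P" using ab(1) prime_mult by blast
    then show "\<exists>Q\<in>A \<union> B. Q \<subseteq> P"
    proof
      assume "a \<in> P"
      then have "adjoin I a \<subseteq> P" by (rule adjoin_least[OF prime_ideal[OF P(1)] P(2)])
      then have "\<exists>Q\<in>A. Q \<subseteq> P" using A(3) P(1) by simp
      then show ?thesis by blast
    next
      assume "b \<in> P"
      then have "adjoin I b \<subseteq> P" by (rule adjoin_least[OF prime_ideal[OF P(1)] P(2)])
      then have "\<exists>Q\<in>B. Q \<subseteq> P" using B(3) P(1) by simp
      then show ?thesis by blast
    qed
  qed
  with bad show False by blast
qed

end

section \<open>Power series in one element\<close>

text \<open>Completeness is stated with a rate of convergence that the limit inherits. Partial sums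
  of power series in an element of \<open>M\<close> converge at this rate.\<close>

locale complete_noetherian_mod = local_noetherian_mod Z M for Z M :: "'r::comm_ring_1 set" +
  assumes separated: "(\<And>n. (x :: 'r) \<in> pw n) \<Longrightarrow> x \<in> Z"
    and complete: "\<And>x :: nat \<Rightarrow> 'r. (\<And>n. x (Suc n) - x n \<in> pw n) \<Longrightarrow> \<exists>l. \<forall>n. x n - l \<in> pw n"
begin

text \<open>\<open>is_ser a z s\<close> says that \<open>s\<close> is the sum of the series of the \<open>a n * z ^ n\<close>, up to \<open>Z\<close>: the
  witness \<open>t n\<close> is the tail of the series from index \<open>n\<close> on, divided by \<open>z ^ n\<close>.\<close>

definition is_ser :: "(nat \<Rightarrow> 'r) \<Rightarrow> 'r \<Rightarrow> 'r \<Rightarrow> bool" where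
  "is_ser a z s \<longleftrightarrow> (\<exists>t. t 0 = s \<and> (\<forall>n. t n - (a n + z * t (Suc n)) \<in> Z))"

lemma is_serI: "t 0 = s \<Longrightarrow> (\<And>n. t n - (a n + z * t (Suc n)) \<in> Z) \<Longrightarrow> is_ser a z s"
  unfolding is_ser_def by blast

lemma is_ser_exists:
  assumes z: "z \<in> M" shows "\<exists>s. is_ser a z s"
proof -
  \<comment> \<open>\<open>p n i\<close> is a partial sum of the tail from index \<open>n\<close>
    on, divided by \<open>z ^ n\<close>. All tails are summed at once because \<open>is_ser\<close>
    asks for them as its witness.\<close>
  define p where "p n i = (\<Sum>j<i. a (n + j) * z ^ j)" for n i
  have "p n (Suc i) - p n i \<in> pw i" for n i
    unfolding p_def using power_in_pw[OF z] pw_ideal by (auto intro: ideal_mult_left)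
  then have "\<exists>l. \<forall>i. p n i - l \<in> pw i" for n by (rule complete)
  then obtain t where t: "\<And>n i. p n i - t n \<in> pw i" by metis
  have "t n - (a n + z * t (Suc n)) \<in> Z" for n
  proof (rule separated)
    fix i
    have e: "p n (Suc i) = a n + z * p (Suc n) i"
      unfolding p_def sum.lessThan_Suc_shift by (simp add: sum_distrib_left algebra_simps)
    have "t n - (a n + z * t (Suc n))
        = z * (p (Suc n) i - t (Suc n)) - (p n (Suc i) - t n)"
      unfolding e by (simp add: algebra_simps)
    also have "\<dots> \<in> pw i"
      by (rule ideal_diff[OF pw_ideal ideal_mult_left[OF pw_ideal t] subsetD[OF pw_Suc_subset t]])
    finally show "t n - (a n + z * t (Suc n)) \<in> pw i" .
  qed
  then show ?thesis by (intro exI[of _ "t 0"] is_serI[of t]) auto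
qed

lemma is_ser_add:
  assumes "is_ser a z s" "is_ser b z t" shows "is_ser (\<lambda>n. a n + b n) z (s + t)"
proof -
  obtain u where u: "u 0 = s" "\<And>n. u n - (a n + z * u (Suc n)) \<in> Z" using assms(1) unfolding is_ser_def by blast
  obtain v where v: "v 0 = t" "\<And>n. v n - (b n + z * v (Suc n)) \<in> Z" using assms(2) unfolding is_ser_def by blast
  show ?thesis
  proof (rule is_serI[of "\<lambda>n. u n + v n"])
    fix n show "u n + v n - (a n + b n + z * (u (Suc n) + v (Suc n))) \<in> Z"
      using ideal_add[OF ideal_Z u(2)[of n] v(2)[of n]] by (simp add: algebra_simps)
  qed (use u v in auto)
qed

lemma is_ser_cmult:
  assumes "is_ser a z s" shows "is_ser (\<lambda>n. c * a n) z (c * s)"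
proof -
  obtain u where u: "u 0 = s" "\<And>n. u n - (a n + z * u (Suc n)) \<in> Z" using assms unfolding is_ser_def by blast
  show ?thesis
  proof (rule is_serI[of "\<lambda>n. c * u n"])
    fix n show "c * u n - (c * a n + z * (c * u (Suc n))) \<in> Z"
      using ideal_mult_left[OF ideal_Z u(2)[of n], of c] by (simp add: algebra_simps)
  qed (use u in auto)
qed

lemma is_ser_diff:
  assumes "is_ser a z s" "is_ser b z t" shows "is_ser (\<lambda>n. a n - b n) z (s - t)"
  using is_ser_add[OF assms(1) is_ser_cmult[OF assms(2), of "-1"]] by simp

lemma is_ser_mult:
  assumes "is_ser a z s" "is_ser b z t"
  shows "is_ser (\<lambda>n. \<Sum>i\<le>n. a i * b (n - i)) z (s * t)"
proof -
  obtain u where u: "u 0 = s" "\<And>n. u n - (a n + z * u (Suc n)) \<in> Z" using assms(1) unfolding is_ser_def by blast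
  obtain v where v: "v 0 = t" "\<And>n. v n - (b n + z * v (Suc n)) \<in> Z" using assms(2) unfolding is_ser_def by blast
  \<comment> \<open>\<open>w n\<close> is the product without its terms of degree below
    \<open>n\<close>, divided by \<open>z ^ n\<close>: each \<open>a i\<close> with
    \<open>i < n\<close> meets the tail of the second series from index \<open>n - i\<close> on, and
    the tail \<open>u n\<close> of the first meets the whole second series.\<close>
  define w where "w n = (\<Sum>i<n. a i * v (n - i)) + u n * v 0" for n
  show ?thesis
  proof (rule is_serI[of w])
    show "w 0 = s * t" using u v by (simp add: w_def)
    fix n
    have 1: "(\<Sum>i<n. a i * (v (n - i) - (b (n - i) + z * v (Suc (n - i))))) =
        (\<Sum>i<n. a i * v (n - i)) - (\<Sum>i<n. a i * b (n - i)) - z * (\<Sum>i<n. a i * v (Suc n - i))"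
      by (simp add: algebra_simps sum.distrib sum_subtractf sum_distrib_left Suc_diff_le)
    have 2: "(\<Sum>i\<le>n. a i * b (n - i)) = (\<Sum>i<n. a i * b (n - i)) + a n * b 0"
      by (simp add: lessThan_Suc_atMost[symmetric])
    have "w n - ((\<Sum>i\<le>n. a i * b (n - i)) + z * w (Suc n)) =
        (\<Sum>i<n. a i * (v (n - i) - (b (n - i) + z * v (Suc (n - i)))))
        + (u n - (a n + z * u (Suc n))) * v 0 + a n * (v 0 - (b 0 + z * v (Suc 0)))"
      unfolding 1 2 w_def by (simp add: algebra_simps)
    also have "\<dots> \<in> Z"
      using u v by (intro ideal_add[OF ideal_Z] ideal_sum[OF ideal_Z]
          ideal_mult_left[OF ideal_Z] ideal_mult_right[OF ideal_Z]) auto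
    finally show "w n - ((\<Sum>i\<le>n. a i * b (n - i)) + z * w (Suc n)) \<in> Z" .
  qed
qed

lemma is_ser_const: "is_ser (\<lambda>n. if n = 0 then c else 0) z c"
  by (rule is_serI[of "\<lambda>n. if n = 0 then c else 0"]) (auto simp: ideal_zero[OF ideal_Z])

lemma is_ser_leading:
  assumes "is_ser a z s" and J: "cr_ideal J" "Z \<subseteq> J" and a: "\<And>i. i < e \<Longrightarrow> a i \<in> J"
  shows "\<exists>h. s - z ^ e * (a e + z * h) \<in> J"
proof -
  obtain t where t: "t 0 = s" "\<And>n. t n - (a n + z * t (Suc n)) \<in> Z" using assms(1) unfolding is_ser_def by blast
  have "n \<le> e \<Longrightarrow> s - z ^ n * t n \<in> J" for n
  proof (induction n)
    case (Suc n)
    have "s - z ^ Suc n * t (Suc n)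
        = (s - z ^ n * t n) + z ^ n * (t n - (a n + z * t (Suc n))) + z ^ n * a n"
      by (simp add: algebra_simps)
    also have "\<dots> \<in> J"
      using Suc J a t(2)[of n] by (intro ideal_add[OF J(1)] ideal_mult_left[OF J(1)]) auto
    finally show ?case .
  qed (use t ideal_zero J in auto)
  then have "(s - z ^ e * t e) + z ^ e * (t e - (a e + z * t (Suc e))) \<in> J"
    using J t(2)[of e] by (intro ideal_add[OF J(1)] ideal_mult_left[OF J(1)]) auto
  then have "s - z ^ e * (a e + z * t (Suc e)) \<in> J" by (simp add: algebra_simps)
  then show ?thesis by blast
qed

text \<open>Modulo \<open>J\<close> the sum is divisible by every power of \<open>z\<close>, so it
  lies in \<open>J\<close> by Krull's intersection theorem. Uniqueness of sums, even modulo an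
  ideal, follows.\<close>

lemma is_ser_in_ideal:
  assumes "is_ser a z s" "z \<in> M" and J: "cr_ideal J" "Z \<subseteq> J" and a: "\<And>i. a i \<in> J"
  shows "s \<in> J"
proof (rule ideal_closed[OF J])
  fix n
  obtain h where "s - z ^ n * (a n + z * h) \<in> J"
    using is_ser_leading[OF assms(1) J] a by blast
  then show "\<exists>j\<in>J. s - j \<in> pw n"
    using power_in_pw[OF assms(2)] pw_ideal
    by (intro bexI[of _ "s - z ^ n * (a n + z * h)"]) (auto intro: ideal_mult_right)
qed

lemma is_ser_unique:
  assumes "is_ser a z s" "is_ser b z t" "z \<in> M" and J: "cr_ideal J" "Z \<subseteq> J" and a: "\<And>i. a i - b i \<in> J"
  shows "s - t \<in> J"
  using is_ser_in_ideal[OF is_ser_diff[OF assms(1,2)] assms(3) J] a by blast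

section \<open>Subrings of power series and the modules that they span\<close>

definition PSer :: "'r set \<Rightarrow> 'r \<Rightarrow> 'r set" where
  "PSer B z = {s. \<exists>a. (\<forall>n. a n \<in> B) \<and> is_ser a z s}"

primrec PS :: "'r set \<Rightarrow> 'r list \<Rightarrow> 'r set" where
  "PS B [] = B"
| "PS B (z # zs) = PSer (PS B zs) z"

lemma PSer_subring:
  assumes "cr_subring B" shows "cr_subring (PSer B z)"
  unfolding cr_subring_def
proof (intro conjI ballI)
  show "1 \<in> PSer B z"
    unfolding PSer_def using is_ser_const[of 1 z] subring_one[OF assms] subring_zero[OF assms]
    by (auto intro!: exI[of _ "\<lambda>n. if n = 0 then 1 else 0"])
next
  fix x y assume "x \<in> PSer B z" "y \<in> PSer B z"
  then obtain a b where ab: "\<And>n. a n \<in> B" "is_ser a z x" "\<And>n. b n \<in> B" "is_ser b z y"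
    unfolding PSer_def by blast
  show "x - y \<in> PSer B z"
    unfolding PSer_def using ab(1,3) is_ser_diff[OF ab(2,4)]
    by (auto intro!: exI[of _ "\<lambda>n. a n - b n"] subring_diff[OF assms])
  have "(\<Sum>i\<le>n. a i * b (n - i)) \<in> B" for n
    using ab by (intro subring_sum[OF assms] subring_mult[OF assms]) auto
  then show "x * y \<in> PSer B z"
    unfolding PSer_def using is_ser_mult[OF ab(2,4)]
    by (auto intro!: exI[of _ "\<lambda>n. \<Sum>i\<le>n. a i * b (n - i)"])
qed

lemma PSer_superset:
  assumes "0 \<in> B" shows "B \<subseteq> PSer B z"
proof
  fix x assume "x \<in> B"
  then show "x \<in> PSer B z" unfolding PSer_def using is_ser_const[of x z] assms
    by (auto intro!: exI[of _ "\<lambda>n. if n = 0 then x else 0"])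
qed

lemma PS_subring: "cr_subring B \<Longrightarrow> cr_subring (PS B zs)"
  by (induction zs) (auto intro: PSer_subring)

lemma PS_superset: "cr_subring B \<Longrightarrow> B \<subseteq> PS B zs"
proof (induction zs)
  case (Cons z zs)
  then show ?case
    using PSer_superset[of "PS B zs" z] subring_zero[OF PS_subring[of B zs]] by auto
qed simp

text \<open>The base case \<open>Z\<close> makes the span closed under congruence modulo
  \<open>Z\<close>.\<close>

primrec lspan :: "'r set \<Rightarrow> 'r list \<Rightarrow> 'r set" where
  "lspan B [] = Z"
| "lspan B (u # us) = {b * u + s | b s. b \<in> B \<and> s \<in> lspan B us}"

lemma lspan_add_Z: "x \<in> lspan B us \<Longrightarrow> y - x \<in> Z \<Longrightarrow> y \<in> lspan B us"
proof (induction us arbitrary: x y)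
  case Nil
  then show ?case using ideal_mem_cong[OF ideal_Z, of y x] by simp
next
  case (Cons u us)
  then obtain b s where bs: "b \<in> B" "s \<in> lspan B us" "x = b * u + s" by auto
  then have "(y - b * u) - s \<in> Z" using Cons.prems by (simp add: algebra_simps)
  then have "y - b * u \<in> lspan B us" using Cons.IH bs by blast
  moreover have "y = b * u + (y - b * u)" by simp
  ultimately show ?case using bs(1) unfolding lspan.simps by blast
qed

lemma lspan_is_ser:
  assumes "\<And>n. t n \<in> lspan B us" "is_ser t z s" "z \<in> M"
  shows "s \<in> lspan (PSer B z) us"
  using assms
proof (induction us arbitrary: t s)
  case Nil
  then show ?case using is_ser_in_ideal[OF Nil(2,3) ideal_Z] by auto
next
  case (Cons u us)
  have "\<exists>b. b \<in> B \<and> t n - b * u \<in> lspan B us" for n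
    using Cons.prems(1)[of n] by auto
  then obtain b where b: "\<And>n. b n \<in> B" "\<And>n. t n - b n * u \<in> lspan B us" by metis
  define r where "r n = t n - b n * u" for n
  have br: "\<And>n. b n \<in> B" "\<And>n. r n \<in> lspan B us" "\<And>n. t n = b n * u + r n"
    using b by (auto simp: r_def)
  obtain x where x: "is_ser b z x" using is_ser_exists[OF Cons.prems(3), of b] by blast
  obtain y where y: "is_ser r z y" using is_ser_exists[OF Cons.prems(3), of r] by blast
  have "is_ser (\<lambda>n. u * b n + r n) z (u * x + y)" by (intro is_ser_add is_ser_cmult x y)
  then have "s - (u * x + y) \<in> Z"
    using Cons.prems br(3) ideal_zero[OF ideal_Z]
    by (intro is_ser_unique[OF Cons.prems(2) _ Cons.prems(3) ideal_Z]) (auto simp: mult.commute)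
  moreover have "x * u + y \<in> lspan (PSer B z) (u # us)"
  proof -
    have "x \<in> PSer B z" unfolding PSer_def using br(1) x by blast
    moreover have "y \<in> lspan (PSer B z) us" using Cons.IH[OF br(2) y Cons.prems(3)] .
    ultimately show ?thesis by auto
  qed
  moreover have "u * x = x * u" by (rule mult.commute)
  ultimately show ?case using lspan_add_Z by metis
qed

text \<open>A form of Nakayama's lemma for complete rings: what a combination over \<open>B\<close>
  misses modulo \<open>J\<close> is \<open>z\<close> times some element, which is represented in the
  same way, and so on. The combinations obtained are the coefficients of a series in
  \<open>z\<close>, which completeness sums.\<close>

lemma lspan_PSer_generates:
  assumes J: "cr_ideal J" "Z \<subseteq> J" and z: "z \<in> M"
    and gen: "\<And>r. \<exists>t\<in>lspan B us. r - t \<in> adjoin J z"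
  shows "\<exists>t\<in>lspan (PSer B z) us. r - t \<in> J"
proof -
  have "\<forall>r. \<exists>t j q. t \<in> lspan B us \<and> j \<in> J \<and> r = t + j + z * q"
  proof
    fix r
    obtain t j q where "t \<in> lspan B us" "j \<in> J" "r - t = j + z * q"
      using gen[of r] unfolding adjoin_def by blast
    then have "r = t + j + z * q" by (simp add: algebra_simps)
    then show "\<exists>t j q. t \<in> lspan B us \<and> j \<in> J \<and> r = t + j + z * q"
      using \<open>t \<in> lspan B us\<close> \<open>j \<in> J\<close> by blast
  qed
  then obtain t j q where *: "\<And>r. t r \<in> lspan B us" "\<And>r. j r \<in> J" "\<And>r. r = t r + j r + z * q r"
    by metis
  define f where "f n = (q ^^ n) r" for n
  have f: "is_ser (\<lambda>n. t (f n) + j (f n)) z r"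
  proof (rule is_serI[of f])
    show "f 0 = r" by (simp add: f_def)
    fix n
    have "f n - (t (f n) + j (f n) + z * f (Suc n)) = 0"
      using *(3)[of "f n"] by (simp add: f_def)
    then show "f n - (t (f n) + j (f n) + z * f (Suc n)) \<in> Z" using ideal_zero[OF ideal_Z] by simp
  qed
  obtain s where s: "is_ser (\<lambda>n. t (f n)) z s" using is_ser_exists[OF z] by blast
  have "s \<in> lspan (PSer B z) us" by (rule lspan_is_ser[OF _ s z]) (rule *(1))
  moreover have "r - s \<in> J" by (rule is_ser_unique[OF f s z J]) (use * in auto)
  ultimately show ?thesis by blast
qed

lemma lspan_PS_generates:
  assumes J: "cr_ideal J" "Z \<subseteq> J" and z: "set zs \<subseteq> M"
    and gen: "\<And>r. \<exists>t\<in>lspan B us. r - t \<in> adjoins J zs"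
  shows "\<exists>t\<in>lspan (PS B zs) us. r - t \<in> J"
  using assms
proof (induction zs arbitrary: J r)
  case Nil
  then show ?case by simp
next
  case (Cons z zs)
  have "\<exists>t\<in>lspan (PS B zs) us. r - t \<in> adjoin J z" for r
  proof (rule Cons.IH)
    show "cr_ideal (adjoin J z)" "Z \<subseteq> adjoin J z" "set zs \<subseteq> M"
      using Cons.prems adjoin_ideal adjoin_superset[of J z] by auto
    show "\<exists>t\<in>lspan B us. r - t \<in> adjoins (adjoin J z) zs" for r using Cons.prems(4)[of r] by simp
  qed
  then have "\<exists>t\<in>lspan (PSer (PS B zs) z) us. r - t \<in> J"
    using Cons.prems by (intro lspan_PSer_generates) auto
  then show ?case by simp
qed

definition coeff_field :: "'r set \<Rightarrow> bool" where
  "coeff_field K \<longleftrightarrow> cr_subring K \<and> K \<inter> M \<subseteq> Z"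

text \<open>In the quotient by the \<open>z - t ^ w\<close>, with weights \<open>w\<close> that grow fast enough, \<open>F\<close> becomes a unit
  times a power of \<open>t\<close>: the lexicographically smallest monomial of \<open>F\<close> has the smallest weight.\<close>

lemma PS_lexicographic:
  assumes K: "coeff_field K" and t: "t \<in> M" and P: "cr_ideal P" "Z \<subseteq> P"
    and zs: "set zs \<subseteq> M" and F: "F \<in> PS K (zs @ [t])" "F \<notin> P"
  shows "\<exists>zs' N u. length zs' = length zs \<and> set zs' \<subseteq> M \<and> u \<notin> M \<and>
    (\<forall>Q. cr_ideal Q \<longrightarrow> P \<subseteq> Q \<longrightarrow> set zs' \<subseteq> Q \<longrightarrow> F - u * t ^ N \<in> Q \<and> (t \<in> Q \<longrightarrow> set zs \<subseteq> Q))"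
  using zs F
proof (induction zs arbitrary: F)
  case Nil
  then obtain a where a: "\<And>n. a n \<in> K" "is_ser a t F" unfolding PS.simps append.simps PSer_def by blast
  have "\<exists>n. a n \<notin> P" using is_ser_in_ideal[OF a(2) t P] Nil(3) by blast
  then obtain e where e: "a e \<notin> P" "\<And>i. i < e \<Longrightarrow> a i \<in> P"
    using LeastI_ex[of "\<lambda>n. a n \<notin> P"] not_less_Least[of _ "\<lambda>n. a n \<notin> P"] by blast
  obtain h where h: "F - t ^ e * (a e + t * h) \<in> P" using is_ser_leading[OF a(2) P e(2)] by blast
  have "a e \<notin> M" using K a(1) e(1) P(2) unfolding coeff_field_def by blast
  then have "a e + t * h \<notin> M"
    using ideal_mem_cong[OF ideal_M, of "a e + t * h" "a e"] t ideal_M by (auto intro: ideal_mult_right)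
  then show ?case
    using h by (intro exI[of _ "[]"] exI[of _ e] exI[of _ "a e + t * h"]) (auto simp: mult.commute)
next
  case (Cons z zs)
  have z: "z \<in> M" using Cons by simp
  obtain a where a: "\<And>n. a n \<in> PS K (zs @ [t])" "is_ser a z F"
    using Cons.prems(2) unfolding PS.simps append.simps PSer_def by blast
  have "\<exists>n. a n \<notin> P" using is_ser_in_ideal[OF a(2) z P] Cons.prems(3) by blast
  then obtain e where e: "a e \<notin> P" "\<And>i. i < e \<Longrightarrow> a i \<in> P"
    using LeastI_ex[of "\<lambda>n. a n \<notin> P"] not_less_Least[of _ "\<lambda>n. a n \<notin> P"] by blast
  obtain h where h: "F - z ^ e * (a e + z * h) \<in> P" using is_ser_leading[OF a(2) P e(2)] by blast
  obtain zs' N u where IH: "length zs' = length zs" "set zs' \<subseteq> M" "u \<notin> M"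
    "\<And>Q. \<lbrakk>cr_ideal Q; P \<subseteq> Q; set zs' \<subseteq> Q\<rbrakk> \<Longrightarrow> a e - u * t ^ N \<in> Q \<and> (t \<in> Q \<longrightarrow> set zs \<subseteq> Q)"
    using Cons.IH[OF _ a(1) e(1)] Cons.prems(1) by auto
  \<comment> \<open>The weight of \<open>z\<close> is \<open>Suc N\<close>, one more than the
    exponent in \<open>a e = u * t ^ N\<close>. So \<open>z * h\<close> contributes one more factor
    \<open>t\<close> than \<open>a e\<close>, and \<open>u + t * h\<close> is still a unit.\<close>
  define w where "w = z - t ^ Suc N"
  have wM: "w \<in> M" unfolding w_def using z t ideal_M
    by (auto intro!: ideal_diff[OF ideal_M] ideal_mult_right[OF ideal_M])
  have uM: "u + t * h \<notin> M"
    using ideal_mem_cong[OF ideal_M, of "u + t * h" u] t ideal_M IH(3) by (auto intro: ideal_mult_right)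
  have "F - (u + t * h) * t ^ (Suc N * e + N) \<in> Q \<and> (t \<in> Q \<longrightarrow> set (z # zs) \<subseteq> Q)"
    if Q: "cr_ideal Q" "P \<subseteq> Q" "set (w # zs') \<subseteq> Q" for Q
  proof
    have ae: "a e - u * t ^ N \<in> Q" and tz: "t \<in> Q \<longrightarrow> set zs \<subseteq> Q" using IH(4) Q by auto
    have zw: "z - t ^ Suc N \<in> Q" using Q(3) unfolding w_def by simp
    have 1: "z * h - t ^ Suc N * h \<in> Q"
      using ideal_mult_right[OF Q(1) zw, of h] by (simp add: algebra_simps)
    have "z ^ e * (a e + z * h) - (t ^ Suc N) ^ e * (u * t ^ N + t ^ Suc N * h) \<in> Q"
      using ideal_add[OF Q(1) ae 1]
      by (intro ideal_mult_cong[OF Q(1)] ideal_power_cong[OF Q(1) zw]) (simp add: algebra_simps)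
    then have "F - (t ^ Suc N) ^ e * (u * t ^ N + t ^ Suc N * h) \<in> Q"
      using h Q(1,2) by (blast intro: ideal_diff_trans)
    also have "(t ^ Suc N) ^ e * (u * t ^ N + t ^ Suc N * h) = (u + t * h) * t ^ (Suc N * e + N)"
      unfolding power_mult[symmetric] power_add by (simp add: algebra_simps)
    finally show "F - (u + t * h) * t ^ (Suc N * e + N) \<in> Q" .
    show "t \<in> Q \<longrightarrow> set (z # zs) \<subseteq> Q"
    proof
      assume "t \<in> Q"
      then have "t ^ Suc N \<in> Q" by (intro ideal_power[OF Q(1)]) auto
      then have "z \<in> Q" using ideal_mem_cong[OF Q(1) zw] by blast
      with tz \<open>t \<in> Q\<close> show "set (z # zs) \<subseteq> Q" by simp
    qed
  qed
  then show ?case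
    using IH(1,2) wM uM
    by (intro exI[of _ "w # zs'"] exI[of _ "Suc N * e + N"] exI[of _ "u + t * h"]) auto
qed

end

section \<open>Chains of primes and parameters\<close>

text \<open>Gaussian elimination without fractions, over the domain of residues modulo
  \<open>P\<close>, so that the solution stays in \<open>B\<close>. One equation and the unknown of
  its pivot are removed at a time.\<close>

lemma linear_system_mod_prime:
  fixes b :: "'i \<Rightarrow> 'j \<Rightarrow> 'r::comm_ring_1"
  assumes P: "cr_prime P" and B: "cr_subring B" and "finite J" "finite I" "card J < card I"
    and "\<And>i j. i \<in> I \<Longrightarrow> j \<in> J \<Longrightarrow> b i j \<in> B"
  shows "\<exists>a. (\<forall>i\<in>I. a i \<in> B) \<and> (\<exists>i\<in>I. a i \<notin> P) \<and> (\<forall>j\<in>J. (\<Sum>i\<in>I. a i * b i j) \<in> P)"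
  using assms(3-)
proof (induction J arbitrary: I b rule: finite_induct)
  case empty
  then have "I \<noteq> {}" by auto
  then show ?case using subring_one[OF B] prime_one[OF P] by (intro exI[of _ "\<lambda>_. 1"]) auto
next
  case (insert j J)
  have Pi: "cr_ideal P" using prime_ideal[OF P] .
  show ?case
  proof (cases "\<forall>i\<in>I. b i j \<in> P")
    case True
    obtain a where a: "\<forall>i\<in>I. a i \<in> B" "\<exists>i\<in>I. a i \<notin> P" "\<forall>j\<in>J. (\<Sum>i\<in>I. a i * b i j) \<in> P"
      using insert.IH[of I b] insert.prems insert.hyps by auto
    have "(\<Sum>i\<in>I. a i * b i j) \<in> P"
      using True by (intro ideal_sum[OF Pi] ideal_mult_left[OF Pi]) auto
    with a show ?thesis by (intro exI[of _ a]) auto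
  next
    case False
    then obtain k where k: "k \<in> I" "b k j \<notin> P" by blast
    define I' where "I' = I - {k}"
    define c where "c i l = b k j * b i l - b i j * b k l" for i l
    have I: "I = insert k I'" "k \<notin> I'" "finite I'" using k insert.prems unfolding I'_def by auto
    have "\<exists>a. (\<forall>i\<in>I'. a i \<in> B) \<and> (\<exists>i\<in>I'. a i \<notin> P) \<and> (\<forall>j\<in>J. (\<Sum>i\<in>I'. a i * c i j) \<in> P)"
    proof (rule insert.IH)
      show "finite I'" by (rule I)
      show "card J < card I'" using insert.prems insert.hyps I by simp
      show "c i l \<in> B" if "i \<in> I'" "l \<in> J" for i l
        unfolding c_def using insert.prems(3) that I by (intro subring_diff[OF B] subring_mult[OF B]) auto
    qed
    then obtain a where a: "\<forall>i\<in>I'. a i \<in> B" "\<exists>i\<in>I'. a i \<notin> P" "\<forall>j\<in>J. (\<Sum>i\<in>I'. a i * c i j) \<in> P"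
      by blast
    \<comment> \<open>Back substitution: the other unknowns are multiplied by the pivot
      \<open>b k j\<close>, which spares a division in the value at \<open>k\<close>. The solution
      stays nonzero modulo \<open>P\<close> because the pivot is outside the prime
      \<open>P\<close>.\<close>
    define a' where "a' i = (if i = k then - (\<Sum>i\<in>I'. a i * b i j) else b k j * a i)" for i
    have s: "(\<Sum>i\<in>I. a' i * b i l) = (\<Sum>i\<in>I'. a i * c i l)" for l
    proof -
      have "(\<Sum>i\<in>I'. a' i * b i l) = (\<Sum>i\<in>I'. b k j * a i * b i l)"
        using I(2) by (intro sum.cong) (auto simp: a'_def)
      then have "(\<Sum>i\<in>I. a' i * b i l)
          = - (\<Sum>i\<in>I'. a i * b i j) * b k l + (\<Sum>i\<in>I'. b k j * a i * b i l)"
        using I by (simp add: a'_def)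
      also have "\<dots> = (\<Sum>i\<in>I'. a i * c i l)"
        unfolding c_def by (simp add: algebra_simps sum_distrib_left sum_subtractf)
      finally show ?thesis .
    qed
    show ?thesis
    proof (intro exI[of _ a'] conjI ballI)
      show "a' i \<in> B" if "i \<in> I" for i
        using that a(1) insert.prems(3) k I unfolding a'_def
        by (auto intro!: subring_uminus[OF B] subring_sum[OF B] subring_mult[OF B])
      obtain i where "i \<in> I'" "a i \<notin> P" using a(2) by blast
      then have "a' i \<notin> P" using k(2) I(2) prime_mult_iff[OF P] by (auto simp: a'_def)
      then show "\<exists>i\<in>I. a' i \<notin> P" using I \<open>i \<in> I'\<close> by blast
      show "(\<Sum>i\<in>I. a' i * b i l) \<in> P" if "l \<in> insert j J" for l
      proof (cases "l = j")
        case True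
        have "(\<Sum>i\<in>I'. a i * c i j) = 0" by (simp add: c_def mult.commute)
        then show ?thesis using True s ideal_zero[OF Pi] by simp
      qed (use that s a(3) in auto)
    qed
  qed
qed

lemma constant_term_of_relation:
  fixes f :: "'r::comm_ring_1"
  assumes P: "cr_prime P" and f: "f \<notin> P"
    and "(\<Sum>i\<le>n. a i * f ^ i) \<in> P" "\<exists>i\<le>n. a i \<notin> P"
  shows "\<exists>i\<le>n. a i \<notin> P \<and> (\<exists>h. a i + f * h \<in> P)"
  using assms(3,4)
proof (induction n arbitrary: a)
  case 0
  then show ?case by (auto simp: mult.commute)
next
  case (Suc n)
  have s: "(\<Sum>i\<le>Suc n. a i * f ^ i) = a 0 + f * (\<Sum>i\<le>n. a (Suc i) * f ^ i)"
    unfolding sum.atMost_Suc_shift by (simp add: sum_distrib_left algebra_simps)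
  show ?case
  proof (cases "a 0 \<in> P")
    case True
    then have "f * (\<Sum>i\<le>n. a (Suc i) * f ^ i) \<in> P"
      using Suc.prems(1) s ideal_mem_cong[OF prime_ideal[OF P], of "\<Sum>i\<le>Suc n. a i * f ^ i"] by simp
    then have 1: "(\<Sum>i\<le>n. a (Suc i) * f ^ i) \<in> P" using f prime_mult[OF P] by blast
    obtain i where "i \<le> Suc n" "a i \<notin> P" using Suc.prems(2) by blast
    then have "\<exists>i\<le>n. a (Suc i) \<notin> P" using True by (cases i) auto
    then show ?thesis using Suc.IH[OF 1] Suc_le_mono by blast
  qed (use Suc.prems(1) s in auto)
qed

text \<open>If \<open>y + b\<close> falls into the new prime \<open>Q\<close>, it is moved by
  \<open>c * d\<close>, where \<open>d \<in> A\<close> is outside \<open>Q\<close>, and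
  \<open>c\<close> is outside \<open>Q\<close> but in all the other primes, for which nothing
  changes. Incomparability of the primes provides \<open>c\<close>.\<close>

lemma coset_prime_avoidance:
  fixes y :: "'r::comm_ring_1"
  assumes "finite \<Q>" and "\<And>Q. Q \<in> \<Q> \<Longrightarrow> cr_prime Q" and A: "cr_ideal A"
    and "\<And>Q Q'. Q \<in> \<Q> \<Longrightarrow> Q' \<in> \<Q> \<Longrightarrow> Q \<subseteq> Q' \<Longrightarrow> Q = Q'"
    and "\<And>Q. Q \<in> \<Q> \<Longrightarrow> y \<in> Q \<Longrightarrow> \<not> A \<subseteq> Q"
  shows "\<exists>b\<in>A. \<forall>Q\<in>\<Q>. y + b \<notin> Q"
  using assms(1,2,4,5)
proof (induction \<Q> rule: finite_induct)
  case empty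
  then show ?case using ideal_zero[OF A] by auto
next
  case (insert Q \<Q>)
  have "\<exists>b\<in>A. \<forall>Q\<in>\<Q>. y + b \<notin> Q"
    by (rule insert.IH) (use insert.prems in auto)
  then obtain b where b: "b \<in> A" "\<forall>Q\<in>\<Q>. y + b \<notin> Q" by blast
  show ?case
  proof (cases "y + b \<in> Q")
    case True
    have Q: "cr_prime Q" using insert.prems(1) by simp
    have "\<exists>c. c \<notin> Q \<and> (\<forall>Q'\<in>\<Q>'. c \<in> Q')" if "finite \<Q>'" "\<Q>' \<subseteq> \<Q>" for \<Q>'
      using that
    proof (induction \<Q>' rule: finite_induct)
      case empty
      then show ?case using prime_one[OF Q] by auto
    next
      case (insert Q' \<Q>')
      then obtain c where c: "c \<notin> Q" "\<forall>Q'\<in>\<Q>'. c \<in> Q'" by auto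
      have "Q' \<in> \<Q>" using insert.prems by simp
      then have "\<not> Q' \<subseteq> Q" using \<open>Q \<notin> \<Q>\<close> \<open>\<And>Q Q'. Q \<in> insert _ \<Q> \<Longrightarrow> Q' \<in> insert _ \<Q> \<Longrightarrow> Q \<subseteq> Q' \<Longrightarrow> Q = Q'\<close> by blast
      then obtain d where d: "d \<in> Q'" "d \<notin> Q" by blast
      have "d * c \<notin> Q" using c(1) d(2) prime_mult[OF Q] by blast
      moreover have "d * c \<in> Q''" if "Q'' \<in> insert Q' \<Q>'" for Q''
      proof -
        have "cr_ideal Q''"
          using that insert.prems \<open>\<And>Q'. Q' \<in> insert Q \<Q> \<Longrightarrow> cr_prime Q'\<close> prime_ideal by blast
        then show ?thesis using that c(2) d(1) ideal_mult_left ideal_mult_right by blast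
      qed
      ultimately show ?case by blast
    qed
    from this[OF insert.hyps(1)] obtain c where c: "c \<notin> Q" "\<forall>Q'\<in>\<Q>. c \<in> Q'" by blast
    have "\<not> A \<subseteq> Q"
    proof
      assume "A \<subseteq> Q"
      then have "b \<in> Q" using b(1) by blast
      then have "y \<in> Q" using ideal_diff[OF prime_ideal[OF Q] True, of b] by simp
      with insert.prems(3)[of Q] \<open>A \<subseteq> Q\<close> show False by simp
    qed
    then obtain d where d: "d \<in> A" "d \<notin> Q" by blast
    have "c * d \<in> A" using A d(1) by (rule ideal_mult_left)
    have "y + (b + c * d) \<notin> Q'" if Q': "Q' \<in> insert Q \<Q>" for Q'
    proof (cases "Q' = Q")
      case eq: True
      show ?thesis
      proof
        assume "y + (b + c * d) \<in> Q'"
        then have "y + (b + c * d) - (y + b) \<in> Q" using eq True prime_ideal[OF Q] by (blast intro: ideal_diff)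
        then have "c * d \<in> Q" by simp
        with c(1) d(2) prime_mult[OF Q] show False by blast
      qed
    next
      case False
      then have "Q' \<in> \<Q>" using Q' by simp
      have "cr_ideal Q'" using insert.prems(1)[OF Q'] by (rule prime_ideal)
      then have "y + (b + c * d) - (y + b) \<in> Q'" using c(2) \<open>Q' \<in> \<Q>\<close> by (simp add: ideal_mult_right)
      then show ?thesis using b(2) \<open>Q' \<in> \<Q>\<close> ideal_mem_cong[OF \<open>cr_ideal Q'\<close>] by blast
    qed
    moreover have "b + c * d \<in> A" using A b(1) \<open>c * d \<in> A\<close> by (rule ideal_add)
    ultimately show ?thesis by blast
  qed (use b in auto)
qed

section \<open>Dimension: chains of primes against numbers of parameters\<close>

primrec pchain :: "nat \<Rightarrow> 'r::comm_ring_1 set \<Rightarrow> bool" where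
  "pchain 0 P \<longleftrightarrow> cr_prime P"
| "pchain (Suc n) P \<longleftrightarrow> cr_prime P \<and> (\<exists>P'. P \<subset> P' \<and> pchain n P')"

lemma pchain_prime: "pchain n P \<Longrightarrow> cr_prime P"
  by (cases n) auto

context complete_noetherian_mod
begin

lemma mprim_mono: "mprim S \<Longrightarrow> S \<subseteq> T \<Longrightarrow> mprim T"
  unfolding mprim_def by (meson order.trans)

lemma lspan_sum: "t \<in> lspan B us \<Longrightarrow> \<exists>c. (\<forall>j<length us. c j \<in> B) \<and> t - (\<Sum>j<length us. c j * us ! j) \<in> Z"
proof (induction us arbitrary: t)
  case (Cons u us)
  then obtain b s where bs: "b \<in> B" "s \<in> lspan B us" "t = b * u + s" by auto
  obtain c where c: "\<forall>j<length us. c j \<in> B" "s - (\<Sum>j<length us. c j * us ! j) \<in> Z"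
    using Cons.IH[OF bs(2)] by blast
  define d where "d j = (case j of 0 \<Rightarrow> b | Suc j \<Rightarrow> c j)" for j
  have "t - (\<Sum>j<length (u # us). d j * (u # us) ! j) = s - (\<Sum>j<length us. c j * us ! j)"
    unfolding list.size add_0_right add_Suc_right sum.lessThan_Suc_shift by (simp add: d_def bs(3))
  moreover have "\<forall>j<length (u # us). d j \<in> B"
    using c(1) bs(1) by (auto simp: d_def split: nat.split)
  ultimately show ?case using c(2) by metis
qed auto

lemma lspan_append: "s \<in> lspan B us \<Longrightarrow> t \<in> lspan B vs \<Longrightarrow> s + t \<in> lspan B (us @ vs)"
proof (induction us arbitrary: s)
  case Nil
  then show ?case using lspan_add_Z[of t B vs "s + t"] by simp
next
  case (Cons u us)
  then obtain b r where "b \<in> B" "r \<in> lspan B us" "s = b * u + r" by auto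
  then show ?case using Cons.IH[of r] Cons.prems(2) by (auto simp: add.assoc)
qed

lemma lspan_cmult: "t \<in> lspan B us \<Longrightarrow> x * t \<in> lspan B (map ((*) x) us)"
proof (induction us arbitrary: t)
  case Nil
  then show ?case using ideal_mult_left[OF ideal_Z] by simp
next
  case (Cons u us)
  then obtain b r where br: "b \<in> B" "r \<in> lspan B us" "t = b * u + r" by auto
  then have "x * t = b * (x * u) + x * r" by (simp add: algebra_simps)
  then show ?case using Cons.IH[of r] br by auto
qed

text \<open>Modulo \<open>P\<close> the \<open>n + 1\<close> powers \<open>f ^ 0, ..., f ^ n\<close>
  are combinations of \<open>n\<close> generators, so they satisfy a nontrivial relation over
  \<open>B\<close>. After division by powers of \<open>f\<close> it yields an element of
  \<open>B\<close> that is outside \<open>P\<close> but in every ideal containing \<open>P\<close>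
  and \<open>f\<close>.\<close>

lemma integral_relation:
  assumes B: "cr_subring B" and P: "cr_prime P" "Z \<subseteq> P" and f: "f \<notin> P"
    and gen: "\<And>r. \<exists>t\<in>lspan B us. r - t \<in> P"
  shows "\<exists>a\<in>B. a \<notin> P \<and> (\<exists>h. a + f * h \<in> P)"
proof -
  note Pi = prime_ideal[OF P(1)]
  define n where "n = length us"
  have "\<exists>c. (\<forall>j<n. c j \<in> B) \<and> f ^ i - (\<Sum>j<n. c j * us ! j) \<in> P" for i
  proof -
    obtain t where t: "t \<in> lspan B us" "f ^ i - t \<in> P" using gen by blast
    obtain c where c: "\<forall>j<n. c j \<in> B" "t - (\<Sum>j<n. c j * us ! j) \<in> Z"
      using lspan_sum[OF t(1)] unfolding n_def by blast
    then show ?thesis using ideal_diff_trans[OF Pi t(2)] P(2) by blast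
  qed
  then obtain c where c: "\<And>i j. j < n \<Longrightarrow> c i j \<in> B" "\<And>i. f ^ i - (\<Sum>j<n. c i j * us ! j) \<in> P"
    by metis
  obtain a where a: "\<forall>i\<in>{..n}. a i \<in> B" "\<exists>i\<in>{..n}. a i \<notin> P"
      "\<forall>j\<in>{..<n}. (\<Sum>i\<in>{..n}. a i * c i j) \<in> P"
    using linear_system_mod_prime[OF P(1) B, of "{..<n}" "{..n}" c] c(1) by auto
  have s1: "(\<Sum>i\<le>n. a i * (f ^ i - (\<Sum>j<n. c i j * us ! j))) \<in> P"
    by (rule ideal_sum[OF Pi]) (rule ideal_mult_left[OF Pi c(2)])
  have s2: "(\<Sum>j<n. us ! j * (\<Sum>i\<le>n. a i * c i j)) \<in> P"
    by (rule ideal_sum[OF Pi], rule ideal_mult_left[OF Pi]) (use a(3) in blast)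
  have "(\<Sum>i\<le>n. a i * f ^ i) = (\<Sum>i\<le>n. a i * (f ^ i - (\<Sum>j<n. c i j * us ! j)))
      + (\<Sum>i\<le>n. \<Sum>j<n. us ! j * (a i * c i j))"
    by (simp add: algebra_simps sum_subtractf sum_distrib_left)
  also have "(\<Sum>i\<le>n. \<Sum>j<n. us ! j * (a i * c i j)) = (\<Sum>j<n. us ! j * (\<Sum>i\<le>n. a i * c i j))"
    by (subst sum.swap) (simp add: sum_distrib_left)
  finally have "(\<Sum>i\<le>n. a i * f ^ i) \<in> P"
    using ideal_add[OF Pi s1 s2] by simp
  then obtain i where "i \<le> n" "a i \<notin> P" "\<exists>h. a i + f * h \<in> P"
    using constant_term_of_relation[OF P(1) f, of a n] a(2) by auto
  then show ?thesis using a(1) by auto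
qed

end

locale coefficient_field_mod = complete_noetherian_mod Z M for Z M :: "'r::comm_ring_1 set" +
  fixes K :: "'r set" and xs :: "'r list"
  assumes subring_K: "cr_subring K" and Z_subset_K: "Z \<subseteq> K" and K_Int_M: "K \<inter> M \<subseteq> Z"
    and residue: "\<And>r. \<exists>c\<in>K. r - c \<in> M"
    and xs_M: "set xs \<subseteq> M" and M_gen: "M \<subseteq> adjoins Z xs"
begin

lemma coeff_field_K: "coeff_field K"
  unfolding coeff_field_def using subring_K K_Int_M by blast

lemma prime_superset_M: "cr_ideal P \<Longrightarrow> Z \<subseteq> P \<Longrightarrow> set xs \<subseteq> P \<Longrightarrow> M \<subseteq> P"
  using adjoins_least[of P Z xs] M_gen by blast

text \<open>The coefficient of each \<open>z\<close> in \<open>r\<close> matters only modulo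
  \<open>pw n\<close>, because the error is multiplied by \<open>z \<in> M\<close>. Products of the
  \<open>zs\<close> with the old generators therefore suffice for the next power.\<close>

lemma finite_mod_pw_step:
  assumes "cr_ideal J" "set zs \<subseteq> M" "r \<in> adjoins J zs" "\<And>r. \<exists>t\<in>lspan B us. r - t \<in> pw n"
  shows "\<exists>t\<in>lspan B (concat (map (\<lambda>z. map ((*) z) us) zs)). \<exists>j\<in>J. r - (t + j) \<in> pw (Suc n)"
  using assms(1-3)
proof (induction zs arbitrary: J r)
  case Nil
  then show ?case
    using ideal_zero[OF ideal_Z] ideal_zero[OF pw_ideal[of "Suc n"]]
    by (intro bexI[of _ 0] bexI[of _ r]) (auto simp del: pw.simps)
next
  case (Cons z zs)
  let ?vs = "concat (map (\<lambda>z. map ((*) z) us) zs)"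
  obtain t j where t: "t \<in> lspan B ?vs" and j: "j \<in> adjoin J z" and r: "r - (t + j) \<in> pw (Suc n)"
    using Cons.IH[of "adjoin J z" r] Cons.prems adjoin_ideal by auto
  obtain i q where i: "i \<in> J" and jq: "j = i + z * q" using j unfolding adjoin_def by blast
  obtain s where s: "s \<in> lspan B us" "q - s \<in> pw n" using assms(4) by blast
  have "z * s + t \<in> lspan B (concat (map (\<lambda>z. map ((*) z) us) (z # zs)))"
    using lspan_append[OF lspan_cmult[OF s(1)] t] by simp
  moreover have "(q - s) * z \<in> pw (Suc n)" using pw_Suc_mult[OF s(2)] Cons.prems(2) by simp
  then have "r - (t + j) + (q - s) * z \<in> pw (Suc n)" using r pw_ideal by (blast intro: ideal_add)
  then have "r - ((z * s + t) + i) \<in> pw (Suc n)" unfolding jq by (simp add: algebra_simps del: pw.simps)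
  ultimately show ?case using i by blast
qed

lemma finite_mod_pw:
  assumes "\<And>r. \<exists>t\<in>lspan B us. r - t \<in> M"
  shows "\<exists>vs. \<forall>r. \<exists>t\<in>lspan B vs. r - t \<in> pw n"
proof (induction n)
  case 0
  then show ?case using ideal_zero[OF ideal_Z] by (intro exI[of _ "[]"]) auto
next
  case (Suc n)
  then obtain vs where vs: "\<And>r. \<exists>t\<in>lspan B vs. r - t \<in> pw n" by blast
  let ?ws = "concat (map (\<lambda>x. map ((*) x) vs) xs)"
  have "\<exists>t\<in>lspan B (us @ ?ws). r - t \<in> pw (Suc n)" for r
  proof -
    obtain t where t: "t \<in> lspan B us" "r - t \<in> M" using assms by blast
    then have "r - t \<in> adjoins Z xs" using M_gen by blast
    then obtain s j where s: "s \<in> lspan B ?ws" "j \<in> Z" "r - t - (s + j) \<in> pw (Suc n)"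
      using finite_mod_pw_step[OF ideal_Z xs_M _ vs] by blast
    have "r - t - (s + j) + j \<in> pw (Suc n)"
      using s(2,3) Z_subset_pw[of "Suc n"] by (intro ideal_add[OF pw_ideal]) auto
    then have "r - (t + s) \<in> pw (Suc n)" by (simp add: algebra_simps del: pw.simps)
    then show ?thesis using lspan_append[OF t(1) s(1)] by blast
  qed
  then show ?case by blast
qed

lemma residue_lspan: "\<exists>t\<in>lspan K [1]. r - t \<in> M"
proof -
  obtain c where "c \<in> K" "r - c \<in> M" using residue by blast
  moreover have "c \<in> lspan K [1]"
    using \<open>c \<in> K\<close> ideal_zero[OF ideal_Z] unfolding lspan.simps
    by (intro CollectI exI[of _ c] exI[of _ 0]) simp
  ultimately show ?thesis by blast
qed

text \<open>The counterpart of Noether normalization. The ideal generated by \<open>P\<close> and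
  \<open>zs\<close> contains a power of \<open>M\<close>, modulo which finitely many elements span
  over \<open>B\<close>; completeness turns them into generators modulo \<open>P\<close> over the
  series in \<open>zs\<close>. With \<open>B = K\<close> this serves dimension theory, and later it
  proves that the lift is finite.\<close>

lemma lspan_PS_generates_mprim:
  assumes P: "cr_ideal P" "Z \<subseteq> P" and zs: "set zs \<subseteq> M" "mprim (P \<union> set zs)"
    and gen: "\<And>r. \<exists>t\<in>lspan B us. r - t \<in> M"
  shows "\<exists>vs. \<forall>r. \<exists>t\<in>lspan (PS B zs) vs. r - t \<in> P"
proof -
  have J: "cr_ideal (adjoins P zs)" "P \<subseteq> adjoins P zs" using adjoins_ideal[OF P(1)] adjoins_superset[of P zs] by auto
  have "mprim (adjoins P zs)"
    by (rule mprim_mono[OF zs(2)]) (use adjoins_superset[of P zs] adjoins_self[OF P(1), of zs] in auto)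
  then obtain N where N: "pw N \<subseteq> adjoins P zs" using power_of_M_subset[of "adjoins P zs"] J P(2) by blast
  obtain vs where vs: "\<And>r. \<exists>t\<in>lspan B vs. r - t \<in> pw N" using finite_mod_pw[OF gen] by blast
  have "\<exists>t\<in>lspan (PS B zs) vs. r - t \<in> P" for r
    by (rule lspan_PS_generates[OF P zs(1)]) (use vs N in blast)
  then show ?thesis by blast
qed

text \<open>The last variable \<open>t\<close> is distinguished. Modulo \<open>zs'\<close>,
  \<open>F\<close> is a unit times a power of \<open>t\<close>, so a prime over \<open>P\<close>,
  \<open>F\<close> and \<open>zs'\<close> contains \<open>t\<close>, and
  \<open>PS_lexicographic\<close> then forces the remaining variables into it.\<close>

lemma eliminate_variable:
  assumes P: "cr_ideal P" "Z \<subseteq> P" and zs: "set zs \<subseteq> M"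
    and F: "F \<in> PS K zs" "F \<in> M" "F \<notin> P"
  shows "\<exists>zs'. set zs' \<subseteq> M \<and> Suc (length zs') = length zs \<and>
    (\<forall>Q. cr_prime Q \<longrightarrow> P \<union> insert F (set zs') \<subseteq> Q \<longrightarrow> set zs \<subseteq> Q)"
proof (cases zs rule: rev_cases)
  case Nil
  then show ?thesis using F K_Int_M P(2) by auto
next
  case (snoc ws t)
  then have t: "t \<in> M" and ws: "set ws \<subseteq> M" using zs by auto
  obtain zs' N u where L: "length zs' = length ws" "set zs' \<subseteq> M" "u \<notin> M"
    "\<And>Q. \<lbrakk>cr_ideal Q; P \<subseteq> Q; set zs' \<subseteq> Q\<rbrakk> \<Longrightarrow> F - u * t ^ N \<in> Q \<and> (t \<in> Q \<longrightarrow> set ws \<subseteq> Q)"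
    using PS_lexicographic[OF coeff_field_K t P ws, of F] F(1,3) snoc by auto
  have "set zs \<subseteq> Q" if Q: "cr_prime Q" "P \<union> insert F (set zs') \<subseteq> Q" for Q
  proof -
    note Qi = prime_ideal[OF Q(1)]
    have ZQ: "Z \<subseteq> Q" using P(2) Q(2) by blast
    have *: "F - u * t ^ N \<in> Q" "t \<in> Q \<longrightarrow> set ws \<subseteq> Q" using L(4)[OF Qi] Q(2) by auto
    then have "u * t ^ N \<in> Q" using ideal_mem_cong[OF Qi *(1)] Q(2) by blast
    moreover have "u \<notin> Q" using L(3) prime_subset_M[OF Q(1) ZQ] by blast
    ultimately have "t \<in> Q" using prime_mult[OF Q(1)] prime_power[OF Q(1)] by blast
    then show ?thesis using *(2) snoc by auto
  qed
  then show ?thesis using L(1,2) snoc by (intro exI[of _ zs']) simp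
qed

text \<open>The substitute for Krull's principal ideal theorem: modulo \<open>P\<close>, an algebraic relation of \<open>f\<close> over
  the series in \<open>zs\<close>, divided by a power of \<open>f\<close>, has a nonzero constant term \<open>F\<close>, which is a multiple
  of \<open>f\<close>.\<close>

lemma fewer_parameters:
  assumes P: "cr_prime P" "Z \<subseteq> P" and zs: "set zs \<subseteq> M" "mprim (P \<union> set zs)"
    and f: "f \<in> M" "f \<notin> P"
  shows "\<exists>zs'. set zs' \<subseteq> M \<and> Suc (length zs') = length zs \<and> mprim (insert f P \<union> set zs')"
proof -
  note Pi = prime_ideal[OF P(1)]
  obtain us where "\<forall>r. \<exists>t\<in>lspan (PS K zs) us. r - t \<in> P"
    using lspan_PS_generates_mprim[OF Pi P(2) zs] residue_lspan by blast
  then obtain F h where F: "F \<in> PS K zs" "F \<notin> P" "F + f * h \<in> P"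
    using integral_relation[OF PS_subring[OF subring_K] P f(2)] by blast
  have FM: "F \<in> Q" if "cr_ideal Q" "P \<subseteq> Q" "f \<in> Q" for Q
    using ideal_diff[OF that(1), of "F + f * h" "f * h"] F(3) that by (auto intro: ideal_mult_right)
  have "F \<in> M" using FM[OF ideal_M prime_subset_M[OF P] f(1)] .
  then obtain zs' where zs': "set zs' \<subseteq> M" "Suc (length zs') = length zs"
    "\<And>Q. \<lbrakk>cr_prime Q; P \<union> insert F (set zs') \<subseteq> Q\<rbrakk> \<Longrightarrow> set zs \<subseteq> Q"
    using eliminate_variable[OF Pi P(2) zs(1) F(1) _ F(2)] by blast
  have "M \<subseteq> Q" if Q: "cr_prime Q" "Z \<subseteq> Q" "insert f P \<union> set zs' \<subseteq> Q" for Q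
  proof -
    have "F \<in> Q" using FM[OF prime_ideal[OF Q(1)]] Q(3) by simp
    then have "P \<union> set zs \<subseteq> Q" using zs'(3)[OF Q(1)] Q(3) by auto
    then show ?thesis using zs(2) Q(1,2) unfolding mprim_def by blast
  qed
  then have "mprim (insert f P \<union> set zs')" unfolding mprim_def by blast
  then show ?thesis using zs'(1,2) by blast
qed

text \<open>Each inclusion of the chain supplies an element outside the smaller prime, and by
  \<open>fewer_parameters\<close> adding it saves one parameter.\<close>

lemma pchain_bound:
  assumes "pchain n P" "Z \<subseteq> P" "set zs \<subseteq> M" "mprim (P \<union> set zs)"
  shows "n \<le> length zs"
  using assms
proof (induction n arbitrary: P zs)
  case (Suc n)
  then obtain P' where P': "P \<subset> P'" "pchain n P'" and P: "cr_prime P" by auto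
  then obtain f where f: "f \<in> P'" "f \<notin> P" by blast
  have ZP': "Z \<subseteq> P'" using P' Suc.prems(2) by blast
  have "f \<in> M" using f(1) prime_subset_M[OF pchain_prime[OF P'(2)] ZP'] by blast
  then obtain zs' where zs': "set zs' \<subseteq> M" "Suc (length zs') = length zs" "mprim (insert f P \<union> set zs')"
    using fewer_parameters[OF P Suc.prems(2-4) _ f(2)] by blast
  have "mprim (P' \<union> set zs')" by (rule mprim_mono[OF zs'(3)]) (use P' f in auto)
  from Suc.IH[OF P'(2) ZP' zs'(1) this] zs'(2) show ?case by simp
qed simp

lemma pchain_bound_xs:
  assumes "pchain n P" "Z \<subseteq> P" shows "n \<le> length xs"
proof -
  have "mprim (P \<union> set xs)" unfolding mprim_def using prime_superset_M prime_ideal by blast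
  then show ?thesis by (rule pchain_bound[OF assms xs_M])
qed

text \<open>The coset of each \<open>y\<close> in turn is chosen to avoid the primes of maximal dimension over the
  elements chosen so far. Such a prime contains no coset of \<open>A\<close> entirely, since it would otherwise be
  \<open>M\<close>-primary after adding the remaining \<open>y\<close>, which are too few.\<close>

lemma parameters_in_cosets:
  assumes A: "cr_ideal A" and ys: "set ys \<subseteq> M" and m: "mprim (J \<union> A \<union> set ys)"
    and chain: "\<And>n P. \<lbrakk>pchain n P; Z \<subseteq> P; J \<subseteq> P\<rbrakk> \<Longrightarrow> n \<le> length ys"
  shows "\<exists>ys'. list_all2 (\<lambda>y y'. y' - y \<in> A) ys ys'
    \<and> (\<forall>n P. pchain n P \<longrightarrow> Z \<subseteq> P \<longrightarrow> J \<union> set ys' \<subseteq> P \<longrightarrow> n = 0)"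
  using ys m chain
proof (induction ys arbitrary: J)
  case Nil
  then show ?case by auto
next
  case (Cons y ys)
  define l where "l = length ys"
  let ?J = "ideal_gen (Z \<union> J)"
  have J: "cr_ideal ?J" "Z \<subseteq> ?J" "J \<subseteq> ?J"
    using ideal_gen_ideal ideal_gen_superset[of "Z \<union> J"] by auto
  obtain \<Q>0 where \<Q>0: "finite \<Q>0" "\<And>Q. Q \<in> \<Q>0 \<Longrightarrow> cr_prime Q \<and> ?J \<subseteq> Q"
    "\<And>P. cr_prime P \<Longrightarrow> ?J \<subseteq> P \<Longrightarrow> \<exists>Q\<in>\<Q>0. Q \<subseteq> P"
    using finite_primes_below[OF J(1,2)] by auto
  \<comment> \<open>Only primes that start a chain of the full length \<open>Suc l\<close> have to
    be avoided. A chain of that length over \<open>J\<close> starts at one of them, for a smaller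
    prime over \<open>J\<close> would lengthen it beyond \<open>bound\<close>; for the same reason
    they are incomparable.\<close>
  define \<Q> where "\<Q> = {Q \<in> \<Q>0. pchain (Suc l) Q}"
  have bound: "n \<le> Suc l" if "pchain n P" "Z \<subseteq> P" "J \<subseteq> P" for n P
    using Cons.prems(3)[OF that] by (simp add: l_def)
  have \<Q>: "cr_prime Q" "Z \<subseteq> Q" "J \<subseteq> Q" if "Q \<in> \<Q>0" for Q using \<Q>0(2)[OF that] J by auto
  have "\<exists>b\<in>A. \<forall>Q\<in>\<Q>. y + b \<notin> Q"
  proof (rule coset_prime_avoidance[OF _ _ A])
    show "finite \<Q>" "\<And>Q. Q \<in> \<Q> \<Longrightarrow> cr_prime Q" using \<Q>0 unfolding \<Q>_def by auto
  next
    fix Q Q' assume Q: "Q \<in> \<Q>" "Q' \<in> \<Q>" "Q \<subseteq> Q'"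
    show "Q = Q'"
    proof (rule ccontr)
      assume "Q \<noteq> Q'"
      then have "pchain (Suc (Suc l)) Q" using Q \<Q> unfolding \<Q>_def pchain.simps(2)[of "Suc l"] by blast
      then show False using bound[of "Suc (Suc l)" Q] Q \<Q> unfolding \<Q>_def by auto
    qed
  next
    fix Q assume Q: "Q \<in> \<Q>" "y \<in> Q"
    show "\<not> A \<subseteq> Q"
    proof
      assume "A \<subseteq> Q"
      then have "mprim (Q \<union> set ys)"
        using Q \<Q>(3)[of Q] unfolding \<Q>_def by (intro mprim_mono[OF Cons.prems(2)]) auto
      then have "Suc l \<le> length ys"
        using Q \<Q> Cons.prems(1) unfolding \<Q>_def by (intro pchain_bound[of "Suc l" Q]) auto
      then show False by (simp add: l_def)
    qed
  qed
  then obtain b where b: "b \<in> A" "\<And>Q. Q \<in> \<Q> \<Longrightarrow> y + b \<notin> Q" by blast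
  have "\<exists>ys'. list_all2 (\<lambda>y y'. y' - y \<in> A) ys ys'
    \<and> (\<forall>n P. pchain n P \<longrightarrow> Z \<subseteq> P \<longrightarrow> insert (y + b) J \<union> set ys' \<subseteq> P \<longrightarrow> n = 0)"
  proof (rule Cons.IH)
    show "set ys \<subseteq> M" using Cons.prems(1) by simp
    have "M \<subseteq> P" if P: "cr_prime P" "Z \<subseteq> P" "insert (y + b) J \<union> A \<union> set ys \<subseteq> P" for P
    proof -
      have "(y + b) - b \<in> P" using P b(1) by (intro ideal_diff prime_ideal) auto
      then have "J \<union> A \<union> set (y # ys) \<subseteq> P" using P by auto
      then show ?thesis using Cons.prems(2) P unfolding mprim_def by blast
    qed
    then show "mprim (insert (y + b) J \<union> A \<union> set ys)" unfolding mprim_def by blast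
  next
    fix n P assume P: "pchain n P" "Z \<subseteq> P" "insert (y + b) J \<subseteq> P"
    have n: "n \<le> Suc l" using bound P by auto
    show "n \<le> length ys"
    proof (rule ccontr)
      assume "\<not> ?thesis"
      then have nl: "n = Suc l" using n by (simp add: l_def)
      have "?J \<subseteq> P" using P prime_ideal[OF pchain_prime[OF P(1)]] by (intro ideal_gen_least) auto
      then obtain Q where Q: "Q \<in> \<Q>0" "Q \<subseteq> P" using \<Q>0(3) pchain_prime[OF P(1)] by blast
      show False
      proof (cases "Q = P")
        case True
        then have "Q \<in> \<Q>" using Q P nl unfolding \<Q>_def by simp
        then show False using b(2) True P(3) by blast
      next
        case False
        then have "Q \<subset> P" using Q(2) by blast
        then have "pchain (Suc n) Q" unfolding pchain.simps(2) using \<Q>(1)[OF Q(1)] P(1) by blast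
        then show False using bound[of "Suc n" Q] \<Q>(2,3)[OF Q(1)] nl by auto
      qed
    qed
  qed
  then obtain ys' where ys': "list_all2 (\<lambda>y y'. y' - y \<in> A) ys ys'"
    "\<And>n P. \<lbrakk>pchain n P; Z \<subseteq> P; insert (y + b) J \<union> set ys' \<subseteq> P\<rbrakk> \<Longrightarrow> n = 0" by blast
  show ?case
    using ys' b(1) by (intro exI[of _ "(y + b) # ys'"]) auto
qed

text \<open>No chain of primes is longer than the list \<open>ys\<close>, so the cosets can be
  chosen until no strict inclusion is left above the chosen elements. A prime over them is then
  \<open>M\<close> itself.\<close>

lemma mprim_in_cosets:
  assumes A: "cr_ideal A" and ys: "set ys \<subseteq> M" "length ys = length xs" and m: "mprim (A \<union> set ys)"
  shows "\<exists>ys'. list_all2 (\<lambda>y y'. y' - y \<in> A) ys ys' \<and> mprim (set ys')"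
proof -
  obtain ys' where ys': "list_all2 (\<lambda>y y'. y' - y \<in> A) ys ys'"
    "\<And>n P. \<lbrakk>pchain n P; Z \<subseteq> P; set ys' \<subseteq> P\<rbrakk> \<Longrightarrow> n = 0"
    using parameters_in_cosets[OF A ys(1), of "{}"] m pchain_bound_xs ys(2) by auto
  have "M \<subseteq> P" if P: "cr_prime P" "Z \<subseteq> P" "set ys' \<subseteq> P" for P
  proof (rule ccontr)
    assume "\<not> M \<subseteq> P"
    then have "P \<subset> M" using prime_subset_M P by blast
    then have "pchain (Suc 0) P" using P prime_M by auto
    then show False using ys'(2) P by blast
  qed
  then show ?thesis using ys'(1) unfolding mprim_def by blast
qed

end

section \<open>Regular rings: integrality and unique power series expansions\<close>

locale regular_mod = coefficient_field_mod +
  assumes dim: "\<exists>P. pchain (length xs) P \<and> Z \<subseteq> P"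
begin

lemma length_parameters:
  assumes "set zs \<subseteq> M" "mprim (set zs)" shows "length xs \<le> length zs"
proof -
  obtain P where P: "pchain (length xs) P" "Z \<subseteq> P" using dim by blast
  have "mprim (P \<union> set zs)" by (rule mprim_mono[OF assms(2)]) auto
  then show ?thesis by (rule pchain_bound[OF P assms(1)])
qed

lemma PS_eq_UNIV: "PS K xs = UNIV"
proof -
  have "r \<in> PS K xs" for r
  proof -
    have "\<exists>t\<in>lspan K [1]. r - t \<in> adjoins Z xs" for r using residue_lspan M_gen by blast
    then obtain t where t: "t \<in> lspan (PS K xs) [1]" "r - t \<in> Z"
      using lspan_PS_generates[OF ideal_Z _ xs_M, of K "[1]"] by blast
    then obtain b z where bz: "b \<in> PS K xs" "z \<in> Z" "t = b + z" by auto
    have "Z \<subseteq> PS K xs" using Z_subset_K PS_superset[OF subring_K] by blast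
    then have "(r - t) + t \<in> PS K xs"
      using t(2) bz by (metis subring_add[OF PS_subring[OF subring_K]] subset_iff)
    then show ?thesis by simp
  qed
  then show ?thesis by blast
qed

text \<open>The lowest prime \<open>P\<close> of a chain of full length is \<open>Z\<close>: an
  element of \<open>P\<close> outside \<open>Z\<close> is a power series in \<open>xs\<close>, hence
  eliminates a variable, and the parameters left modulo \<open>P\<close> are too few for the
  chain.\<close>

lemma prime_Z: "cr_prime Z"
proof -
  obtain P where P: "pchain (length xs) P" "Z \<subseteq> P" using dim by blast
  have "P \<subseteq> Z"
  proof
    fix F assume F: "F \<in> P"
    show "F \<in> Z"
    proof (rule ccontr)
      assume nF: "F \<notin> Z"
      have "F \<in> M" using F prime_subset_M[OF pchain_prime[OF P(1)] P(2)] by blast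
      then obtain zs' where zs': "set zs' \<subseteq> M" "Suc (length zs') = length xs"
        "\<And>Q. \<lbrakk>cr_prime Q; Z \<union> insert F (set zs') \<subseteq> Q\<rbrakk> \<Longrightarrow> set xs \<subseteq> Q"
        using eliminate_variable[OF ideal_Z subset_refl xs_M _ _ nF] PS_eq_UNIV by auto
      have "M \<subseteq> Q" if Q: "cr_prime Q" "Z \<subseteq> Q" "P \<union> set zs' \<subseteq> Q" for Q
        using prime_superset_M[OF prime_ideal[OF Q(1)] Q(2)] zs'(3)[OF Q(1)] Q(2,3) F by auto
      then have "mprim (P \<union> set zs')" unfolding mprim_def by blast
      then have "length xs \<le> length zs'" by (rule pchain_bound[OF P zs'(1)])
      then show False using zs'(2) by simp
    qed
  qed
  then have "P = Z" using P(2) by blast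
  then show ?thesis using pchain_prime[OF P(1)] by simp
qed

text \<open>The first coefficient \<open>a e\<close> outside \<open>Z\<close> is a multiple of
  \<open>x\<close> modulo \<open>Z\<close>, because \<open>Z\<close> is prime and does not contain
  \<open>x\<close>. As a series in \<open>zs\<close> it eliminates one of these variables, so
  \<open>pre\<close>, \<open>x\<close> and \<open>zs'\<close> are parameters, one fewer than the
  dimension.\<close>

lemma unique_expansion:
  assumes xs: "xs = pre @ x # zs" and a: "\<And>n. a n \<in> PS K zs" "is_ser a x s" and s: "s \<in> Z"
  shows "a n \<in> Z"
proof (rule ccontr)
  assume "a n \<notin> Z"
  then obtain e where e: "a e \<notin> Z" "\<And>i. i < e \<Longrightarrow> a i \<in> Z"
    using LeastI_ex[of "\<lambda>n. a n \<notin> Z"] not_less_Least[of _ "\<lambda>n. a n \<notin> Z"] by blast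
  obtain h where "s - x ^ e * (a e + x * h) \<in> Z" using is_ser_leading[OF a(2) ideal_Z _ e(2)] by blast
  then have "x ^ e * (a e + x * h) \<in> Z" using ideal_mem_cong[OF ideal_Z] s by blast
  then have "x ^ e \<in> Z \<or> a e + x * h \<in> Z" using prime_mult[OF prime_Z] by blast
  moreover have "x \<notin> Z"
  proof
    assume x: "x \<in> Z"
    have "M \<subseteq> Q" if Q: "cr_prime Q" "Z \<subseteq> Q" "set (pre @ zs) \<subseteq> Q" for Q
      using prime_superset_M[OF prime_ideal[OF Q(1)] Q(2)] Q(2,3) x xs by auto
    then have "mprim (set (pre @ zs))" unfolding mprim_def by blast
    then have "length xs \<le> length (pre @ zs)" using xs_M xs by (intro length_parameters) auto
    then show False using xs by simp
  qed
  then have "x ^ e \<notin> Z" using prime_power[OF prime_Z] by blast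
  ultimately have ae: "a e + x * h \<in> Z" by blast
  have in_Q: "a e \<in> Q" if "cr_ideal Q" "Z \<subseteq> Q" "x \<in> Q" for Q
    using ideal_diff[OF that(1), of "a e + x * h" "x * h"] ae that by (auto intro: ideal_mult_right)
  have x: "x \<in> M" and zs: "set zs \<subseteq> M" using xs_M xs by auto
  obtain zs' where zs': "set zs' \<subseteq> M" "Suc (length zs') = length zs"
    "\<And>Q. \<lbrakk>cr_prime Q; Z \<union> insert (a e) (set zs') \<subseteq> Q\<rbrakk> \<Longrightarrow> set zs \<subseteq> Q"
    using eliminate_variable[OF ideal_Z subset_refl zs a(1) in_Q[OF ideal_M Z_subset_M x] e(1)] by blast
  have "M \<subseteq> Q" if Q: "cr_prime Q" "Z \<subseteq> Q" "set (pre @ x # zs') \<subseteq> Q" for Q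
  proof -
    have "a e \<in> Q" using in_Q[OF prime_ideal[OF Q(1)] Q(2)] Q(3) by simp
    then have "set xs \<subseteq> Q" using zs'(3)[OF Q(1)] Q(2,3) xs by auto
    then show ?thesis using prime_superset_M[OF prime_ideal[OF Q(1)] Q(2)] by blast
  qed
  then have "mprim (set (pre @ x # zs'))" unfolding mprim_def by blast
  then have "length xs \<le> length (pre @ x # zs')" using x xs_M xs zs'(1) by (intro length_parameters) auto
  then show False using xs zs'(2) by simp
qed

end

section \<open>Coefficient fields\<close>

lemma add_power_prime_cong:
  fixes x y :: "'r::comm_ring_1"
  assumes I: "cr_ideal I" and p: "Factorial_Ring.prime p" "of_nat p \<in> I"
  shows "(x + y) ^ p - (x ^ p + y ^ p) \<in> I"
proof -
  let ?f = "\<lambda>k. of_nat (p choose k) * x ^ k * y ^ (p - k)"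
  have p0: "0 < p" using prime_gt_0_nat[OF p(1)] .
  have "{..p} = insert 0 (insert p {0<..<p})" using p0 by auto
  then have "(x + y) ^ p = (\<Sum>k\<in>insert 0 (insert p {0<..<p}). ?f k)" by (simp add: binomial_ring)
  also have "\<dots> = x ^ p + y ^ p + (\<Sum>k\<in>{0<..<p}. ?f k)" using p0 by (simp add: ac_simps)
  finally have "(x + y) ^ p - (x ^ p + y ^ p) = (\<Sum>k\<in>{0<..<p}. ?f k)" by simp
  also have "\<dots> \<in> I"
  proof (rule ideal_sum[OF I])
    fix k assume "k \<in> {0<..<p}"
    then have "p dvd (p choose k)" by (intro dvd_choose_prime) (use p in auto)
    then obtain q where "p choose k = p * q" ..
    then show "?f k \<in> I"
      using ideal_mult_right[OF I p(2), of "of_nat q * x ^ k * y ^ (p - k)"] by (simp add: ac_simps)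
  qed
  finally show ?thesis .
qed

context complete_noetherian_mod
begin

definition ideal_sq :: "'r set \<Rightarrow> 'r set" where
  "ideal_sq J = ideal_gen ({a * b | a b. a \<in> J \<and> b \<in> J} \<union> Z)"

lemma ideal_sq_ideal: "cr_ideal (ideal_sq J)"
  unfolding ideal_sq_def by (rule ideal_gen_ideal)

lemma Z_subset_ideal_sq: "Z \<subseteq> ideal_sq J"
  unfolding ideal_sq_def using ideal_gen_superset by blast

lemma mult_in_ideal_sq: "a \<in> J \<Longrightarrow> b \<in> J \<Longrightarrow> a * b \<in> ideal_sq J"
  unfolding ideal_sq_def by (rule subsetD[OF ideal_gen_superset]) blast

lemma ideal_sq_subset: "cr_ideal J \<Longrightarrow> Z \<subseteq> J \<Longrightarrow> ideal_sq J \<subseteq> J"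
  unfolding ideal_sq_def by (rule ideal_gen_least) (auto intro: ideal_mult_left)

text \<open>\<open>S\<close> is the preimage of a subfield of the quotient by \<open>J\<close>.
  Inverses are required modulo \<open>Z\<close> and not only modulo \<open>J\<close>, so
  \<open>S\<close> is local with maximal ideal \<open>J\<close>.\<close>

definition field_ext :: "'r set \<Rightarrow> 'r set \<Rightarrow> bool" where
  "field_ext S J \<longleftrightarrow> cr_subring S \<and> cr_ideal J \<and> Z \<subseteq> J \<and> J \<subseteq> S \<and> J \<subseteq> M
    \<and> (\<forall>s\<in>S. s \<notin> J \<longrightarrow> (\<exists>s'\<in>S. s * s' - 1 \<in> Z))"

end

text \<open>\<open>S / J\<close> is a field; the aim is a subring \<open>L\<close> of \<open>S\<close> such that \<open>L / ideal_sq J\<close> is a field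
  isomorphic to \<open>S / J\<close>. The number \<open>p\<close> is the characteristic of that field, or any non-prime such as
  \<open>0\<close> in characteristic zero.\<close>

locale square_lifting = complete_noetherian_mod Z M for Z M :: "'r::comm_ring_1 set" +
  fixes S J :: "'r set" and p :: nat
  assumes SJ: "field_ext S J"
    and residue_char: "\<And>n. 0 < n \<Longrightarrow> of_nat n \<in> M \<Longrightarrow> Factorial_Ring.prime p \<and> p \<le> n"
    and equal_char: "Factorial_Ring.prime p \<Longrightarrow> of_nat p \<in> Z"
begin

definition J2 :: "'r set" where "J2 = ideal_sq J"

lemma subring_S: "cr_subring S" and ideal_J: "cr_ideal J" and Z_J: "Z \<subseteq> J" and J_S: "J \<subseteq> S"
  and J_M: "J \<subseteq> M" and inverse_S: "\<And>s. s \<in> S \<Longrightarrow> s \<notin> J \<Longrightarrow> \<exists>s'\<in>S. s * s' - 1 \<in> Z"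
  using SJ unfolding field_ext_def by auto

lemma ideal_J2: "cr_ideal J2" and Z_J2: "Z \<subseteq> J2" and J2_J: "J2 \<subseteq> J" and J2_S: "J2 \<subseteq> S"
  unfolding J2_def using ideal_sq_ideal Z_subset_ideal_sq ideal_sq_subset[OF ideal_J Z_J] J_S by auto

lemma one_notin_J: "1 \<notin> J"
  using one_notin_M J_M by blast

lemma cancel_unit:
  assumes I: "cr_ideal I" "Z \<subseteq> I" and s: "s \<in> S" "s \<notin> J" "s * r \<in> I" shows "r \<in> I"
proof -
  obtain s' where s': "s * s' - 1 \<in> Z" using inverse_S[OF s(1,2)] by blast
  have "s' * (s * r) - r * (s * s' - 1) \<in> I"
    using s' s(3) I by (blast intro: ideal_diff[OF I(1)] ideal_mult_left[OF I(1)])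
  then show ?thesis by (simp add: algebra_simps)
qed

lemma prime_J: "s \<in> S \<Longrightarrow> s * r \<in> J \<Longrightarrow> s \<in> J \<or> r \<in> J"
  using cancel_unit[OF ideal_J Z_J] by blast

lemma power_J: "s \<in> S \<Longrightarrow> s ^ n \<in> J \<Longrightarrow> s \<in> J"
  by (induction n) (use prime_J one_notin_J in auto)

text \<open>In other words, \<open>L / J2\<close> is a subring of \<open>S / J2\<close> that embeds
  into the field \<open>S / J\<close>.\<close>

definition admissible :: "'r set \<Rightarrow> bool" where
  "admissible L \<longleftrightarrow> cr_subring L \<and> J2 \<subseteq> L \<and> L \<subseteq> S \<and> L \<inter> J \<subseteq> J2"

text \<open>Modulo \<open>J2\<close> the \<open>p\<close>-th power of \<open>s\<close> depends only
  on \<open>s\<close> modulo \<open>J\<close>, so these powers form a copy of the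
  \<open>p\<close>-th powers of the field \<open>S / J\<close>. Every element of \<open>S\<close>
  has degree at most \<open>p\<close> over it, which deals with inseparable relations. In
  characteristic zero the integers are enough.\<close>

definition L0 :: "'r set" where
  "L0 = (if Factorial_Ring.prime p then {y. \<exists>s\<in>S. y - s ^ p \<in> J2} else {y. \<exists>k::int. y - of_int k \<in> J2})"

lemma of_int_in_subring: "cr_subring B \<Longrightarrow> of_int k \<in> B"
  by (cases k) (auto intro: subring_of_nat subring_uminus subring_diff subring_one)

text \<open>Differences return to \<open>B\<close> only up to \<open>J2\<close> because the identity
  for the \<open>p\<close>-th power of a sum is a congruence.\<close>

lemma admissible_up_to_J2:
  assumes one: "1 \<in> B" and diff: "\<And>b c. b \<in> B \<Longrightarrow> c \<in> B \<Longrightarrow> \<exists>d\<in>B. (b - c) - d \<in> J2"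
    and mult: "\<And>b c. b \<in> B \<Longrightarrow> c \<in> B \<Longrightarrow> b * c \<in> B"
    and S: "B \<subseteq> S" and J: "B \<inter> J \<subseteq> J2"
  shows "admissible {y. \<exists>b\<in>B. y - b \<in> J2}" (is "admissible ?L")
proof -
  have "cr_subring ?L"
    unfolding cr_subring_def
  proof (intro conjI ballI)
    show "1 \<in> ?L" using one ideal_zero[OF ideal_J2] by (auto intro!: bexI[of _ 1])
  next
    fix x y assume "x \<in> ?L" "y \<in> ?L"
    then obtain b c where bc: "b \<in> B" "x - b \<in> J2" "c \<in> B" "y - c \<in> J2" by blast
    obtain d where d: "d \<in> B" "(b - c) - d \<in> J2" using diff[OF bc(1,3)] by blast
    have "(x - y) - d \<in> J2"
      using ideal_add[OF ideal_J2 ideal_diff[OF ideal_J2 bc(2,4)] d(2)] by (simp add: algebra_simps)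
    then show "x - y \<in> ?L" using d(1) by blast
    show "x * y \<in> ?L" using ideal_mult_cong[OF ideal_J2 bc(2,4)] mult[OF bc(1,3)] by blast
  qed
  moreover have "J2 \<subseteq> ?L"
  proof
    fix y assume "y \<in> J2"
    moreover obtain z where "z \<in> B" "(1 - 1) - z \<in> J2" using diff[OF one one] by blast
    ultimately show "y \<in> ?L" using ideal_add[OF ideal_J2, of y "(1 - 1) - z"] by auto
  qed
  moreover have "?L \<subseteq> S"
  proof
    fix y assume "y \<in> ?L"
    then obtain b where "b \<in> B" "y - b \<in> J2" by blast
    then show "y \<in> S" using subring_add[OF subring_S, of "y - b" b] S J2_S by auto
  qed
  moreover have "?L \<inter> J \<subseteq> J2"
  proof
    fix y assume y: "y \<in> ?L \<inter> J"
    then obtain b where b: "b \<in> B" "y - b \<in> J2" by blast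
    then have "b \<in> J" using y J2_J ideal_mem_cong[OF ideal_J, of y b] by blast
    then show "y \<in> J2" using b J ideal_mem_cong[OF ideal_J2 b(2)] by blast
  qed
  ultimately show ?thesis unfolding admissible_def by blast
qed

lemma admissible_L0: "admissible L0"
proof (cases "Factorial_Ring.prime p")
  case True
  let ?B = "(\<lambda>s. s ^ p) ` S"
  have pZ: "of_nat p \<in> J2" using equal_char[OF True] Z_J2 by blast
  have "admissible {y. \<exists>b\<in>?B. y - b \<in> J2}"
  proof (rule admissible_up_to_J2)
    show "1 \<in> ?B" using subring_one[OF subring_S] by (intro image_eqI[of _ _ 1]) auto
    show "?B \<subseteq> S" using subring_power[OF subring_S] by blast
  next
    fix b c assume "b \<in> ?B" "c \<in> ?B"
    then obtain s t where st: "s \<in> S" "t \<in> S" "b = s ^ p" "c = t ^ p" by blast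
    have "(b - c) - (s - t) ^ p \<in> J2"
      using add_power_prime_cong[OF ideal_J2 True pZ, of "s - t" t] unfolding st by (simp add: algebra_simps)
    then show "\<exists>d\<in>?B. (b - c) - d \<in> J2" using subring_diff[OF subring_S st(1,2)] by blast
    have "b * c = (s * t) ^ p" unfolding st by (simp add: power_mult_distrib)
    then show "b * c \<in> ?B" using subring_mult[OF subring_S st(1,2)] by blast
  next
    show "?B \<inter> J \<subseteq> J2"
    proof
      fix y assume "y \<in> ?B \<inter> J"
      then obtain s where s: "s \<in> S" "y = s ^ p" "s ^ p \<in> J" by blast
      then have sJ: "s \<in> J" using power_J by blast
      have "p = Suc (Suc (p - 2))" using prime_ge_2_nat[OF True] by simp
      then have "s ^ p = s * s * s ^ (p - 2)" by (metis power_Suc mult.assoc)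
      moreover have "s * s * s ^ (p - 2) \<in> J2"
        using mult_in_ideal_sq[OF sJ sJ] ideal_J2 unfolding J2_def by (blast intro: ideal_mult_right)
      ultimately show "y \<in> J2" using s(2) by simp
    qed
  qed
  then show ?thesis unfolding L0_def using True by simp
next
  case False
  have "admissible {y. \<exists>b\<in>range of_int. y - b \<in> J2}"
  proof (rule admissible_up_to_J2)
    show "1 \<in> range of_int" using of_int_1 by (metis rangeI)
    show "range of_int \<subseteq> S" using of_int_in_subring[OF subring_S] by blast
  next
    fix b c :: 'r assume "b \<in> range of_int" "c \<in> range of_int"
    then obtain k l :: int where "b = of_int k" "c = of_int l" by blast
    then have "(b - c) - of_int (k - l) = 0" "b * c = of_int (k * l)" by auto
    then show "\<exists>d\<in>range of_int. (b - c) - d \<in> J2" "b * c \<in> range of_int"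
      using ideal_zero[OF ideal_J2] by (metis rangeI)+
  next
    show "range of_int \<inter> J \<subseteq> J2"
    proof
      fix y assume "y \<in> range of_int \<inter> J"
      then obtain k :: int where k: "y = of_int k" "of_int k \<in> J" by blast
      then have "of_nat (nat \<bar>k\<bar>) \<in> J" using ideal_uminus[OF ideal_J k(2)] by (cases "0 \<le> k") auto
      then have "k = 0" using residue_char[of "nat \<bar>k\<bar>"] False J_M by auto
      then show "y \<in> J2" using k ideal_zero[OF ideal_J2] by simp
    qed
  qed
  then show ?thesis unfolding L0_def using False by simp
qed

text \<open>The denominators are units of \<open>S\<close>, so \<open>v * r \<in> J2\<close> forces
  \<open>r \<in> J2\<close>, and adding fractions keeps the embedding into \<open>S / J\<close>.
  Hence a maximal admissible subring is a field modulo \<open>J2\<close>.\<close>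

lemma admissible_localization:
  assumes B: "admissible B" shows "admissible {r \<in> S. \<exists>v\<in>B. v \<notin> J \<and> v * r \<in> B}" (is "admissible ?B'")
proof -
  have Bs: "cr_subring B" and BS: "B \<subseteq> S" and BJ: "B \<inter> J \<subseteq> J2" and JB: "J2 \<subseteq> B"
    using B unfolding admissible_def by auto
  have "B \<subseteq> ?B'" using subring_one[OF Bs] one_notin_J BS by (auto intro!: bexI[of _ 1])
  moreover have "cr_subring ?B'"
    unfolding cr_subring_def
  proof (intro conjI ballI)
    show "1 \<in> ?B'" using \<open>B \<subseteq> ?B'\<close> subring_one[OF Bs] by blast
  next
    fix x y assume "x \<in> ?B'" "y \<in> ?B'"
    then obtain u v where uv: "x \<in> S" "y \<in> S" "u \<in> B" "v \<in> B" "u \<notin> J" "v \<notin> J" "u * x \<in> B" "v * y \<in> B"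
      by blast
    have "u * v \<in> B" "u * v \<notin> J" using uv prime_J BS subring_mult[OF Bs] by blast+
    moreover have "v * (u * x) - u * (v * y) \<in> B"
      by (rule subring_diff[OF Bs subring_mult[OF Bs uv(4,7)] subring_mult[OF Bs uv(3,8)]])
    then have "u * v * (x - y) \<in> B" by (simp add: algebra_simps)
    moreover have "(u * x) * (v * y) \<in> B" by (rule subring_mult[OF Bs uv(7,8)])
    then have "u * v * (x * y) \<in> B" by (simp add: algebra_simps)
    moreover have "x - y \<in> S" "x * y \<in> S" using uv by (auto intro: subring_diff[OF subring_S] subring_mult[OF subring_S])
    ultimately show "x - y \<in> ?B'" "x * y \<in> ?B'" by blast+
  qed
  moreover have "?B' \<inter> J \<subseteq> J2"
  proof
    fix r assume r: "r \<in> ?B' \<inter> J"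
    then obtain v where v: "v \<in> B" "v \<notin> J" "v * r \<in> B" by blast
    then have "v * r \<in> J2" using BJ ideal_mult_left[OF ideal_J] r by blast
    then show "r \<in> J2" using cancel_unit[OF ideal_J2 Z_J2] v BS by blast
  qed
  ultimately show ?thesis using JB unfolding admissible_def by blast
qed

lemma maximal_admissible: "\<exists>L. admissible L \<and> L0 \<subseteq> L \<and> (\<forall>L'. admissible L' \<longrightarrow> L \<subseteq> L' \<longrightarrow> L' = L)"
proof -
  let ?A = "{L. admissible L \<and> L0 \<subseteq> L}"
  have "\<exists>L\<in>?A. \<forall>L'\<in>?A. L \<subseteq> L' \<longrightarrow> L' = L"
  proof (rule subset_Zorn_nonempty)
    show "?A \<noteq> {}" using admissible_L0 by blast
  next
    fix \<C> assume C: "\<C> \<noteq> {}" "subset.chain ?A \<C>"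
    have admissible: "cr_subring L" "J2 \<subseteq> L" "L \<subseteq> S" "L \<inter> J \<subseteq> J2" "L0 \<subseteq> L" if "L \<in> \<C>" for L
      using C(2) that unfolding subset.chain_def admissible_def by auto
    have two: "\<exists>L\<in>\<C>. x \<in> L \<and> y \<in> L" if xy: "x \<in> \<Union>\<C>" "y \<in> \<Union>\<C>" for x y
    proof -
      obtain L L' where L: "L \<in> \<C>" "x \<in> L" "L' \<in> \<C>" "y \<in> L'" using xy by blast
      then have "L \<subseteq> L' \<or> L' \<subseteq> L" using C(2) unfolding subset_chain_def by blast
      then show ?thesis using L by blast
    qed
    have "cr_subring (\<Union>\<C>)"
      unfolding cr_subring_def
    proof (intro conjI ballI)
      show "1 \<in> \<Union>\<C>" using C(1) admissible(1) subring_one by blast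
      fix x y assume xy: "x \<in> \<Union>\<C>" "y \<in> \<Union>\<C>"
      obtain L where L: "L \<in> \<C>" "x \<in> L" "y \<in> L" using two[OF xy] by blast
      show "x - y \<in> \<Union>\<C>" using subring_diff[OF admissible(1)[OF L(1)] L(2,3)] L(1) by blast
      show "x * y \<in> \<Union>\<C>" using subring_mult[OF admissible(1)[OF L(1)] L(2,3)] L(1) by blast
    qed
    moreover obtain L where "L \<in> \<C>" using C(1) by blast
    then have "J2 \<subseteq> \<Union>\<C>" "L0 \<subseteq> \<Union>\<C>" using admissible(2,5)[of L] by auto
    moreover have "\<Union>\<C> \<subseteq> S" "\<Union>\<C> \<inter> J \<subseteq> J2" using admissible(3,4) by blast+
    ultimately show "\<Union>\<C> \<in> ?A" unfolding admissible_def by simp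
  qed
  then obtain L where L: "L \<in> ?A" "\<forall>L'\<in>?A. L \<subseteq> L' \<longrightarrow> L' = L" by (rule bexE)
  then have "\<forall>L'. admissible L' \<longrightarrow> L \<subseteq> L' \<longrightarrow> L' = L" by (metis (mono_tags, lifting) mem_Collect_eq order.trans)
  then show ?thesis using L(1) by blast
qed

end

section \<open>A maximal admissible subring represents every residue\<close>

locale square_lifting_maximal = square_lifting +
  fixes L :: "'a set"
  assumes admissible_L: "admissible L" and L0_L: "L0 \<subseteq> L" and maximal_L: "\<And>L'. admissible L' \<Longrightarrow> L \<subseteq> L' \<Longrightarrow> L' = L"
begin

lemma subring_L: "cr_subring L" and J2_L: "J2 \<subseteq> L" and L_S: "L \<subseteq> S" and L_J: "L \<inter> J \<subseteq> J2"
  using admissible_L unfolding admissible_def by auto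

lemma inverse_L:
  assumes l: "l \<in> L" "l \<notin> J" shows "\<exists>l'\<in>L. l * l' - 1 \<in> Z"
proof -
  obtain s where s: "s \<in> S" "l * s - 1 \<in> Z" using inverse_S l L_S by blast
  have "L \<subseteq> {r \<in> S. \<exists>v\<in>L. v \<notin> J \<and> v * r \<in> L}"
    using subring_one[OF subring_L] one_notin_J L_S by (auto intro!: bexI[of _ 1])
  then have L: "{r \<in> S. \<exists>v\<in>L. v \<notin> J \<and> v * r \<in> L} = L"
    by (intro maximal_L admissible_localization admissible_L)
  have "(l * s - 1) + 1 \<in> L" using s(2) Z_J2 J2_L by (intro subring_add[OF subring_L] subring_one[OF subring_L]) auto
  then have "s \<in> L" using l s(1) L by auto
  then show ?thesis using s(2) by blast
qed

definition polys :: "nat \<Rightarrow> 'a \<Rightarrow> 'a set" where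
  "polys n x = {y. \<exists>c. (\<forall>i. c i \<in> L) \<and> y - (\<Sum>i<n. c i * x ^ i) \<in> J2}"

lemma polys_I: "(\<And>i. c i \<in> L) \<Longrightarrow> y - (\<Sum>i<n. c i * x ^ i) \<in> J2 \<Longrightarrow> y \<in> polys n x"
  unfolding polys_def by blast

lemma polys_E:
  assumes "y \<in> polys n x" obtains c where "\<forall>i. c i \<in> L" "y - (\<Sum>i<n. c i * x ^ i) \<in> J2"
  using assms unfolding polys_def by blast

lemma polys_diff:
  assumes "y \<in> polys n x" "z \<in> polys n x" shows "y - z \<in> polys n x"
proof -
  obtain c d where c: "\<forall>i. c i \<in> L" "y - (\<Sum>i<n. c i * x ^ i) \<in> J2"
    and d: "\<forall>i. d i \<in> L" "z - (\<Sum>i<n. d i * x ^ i) \<in> J2"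
    using assms unfolding polys_def by blast
  show ?thesis
  proof (rule polys_I[of "\<lambda>i. c i - d i"])
    show "c i - d i \<in> L" for i using c d subring_diff[OF subring_L] by blast
    show "y - z - (\<Sum>i<n. (c i - d i) * x ^ i) \<in> J2"
      using ideal_diff[OF ideal_J2 c(2) d(2)] by (simp add: algebra_simps sum_subtractf)
  qed
qed

lemma polys_cmult:
  assumes "l \<in> L" "y \<in> polys n x" shows "l * y \<in> polys n x"
proof -
  obtain c where c: "\<forall>i. c i \<in> L" "y - (\<Sum>i<n. c i * x ^ i) \<in> J2" using assms(2) by (rule polys_E)
  show ?thesis
  proof (rule polys_I[of "\<lambda>i. l * c i"])
    show "l * c i \<in> L" for i using c assms(1) subring_mult[OF subring_L] by blast
    show "l * y - (\<Sum>i<n. l * c i * x ^ i) \<in> J2"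
      using ideal_mult_left[OF ideal_J2 c(2), of l] by (simp add: algebra_simps sum_distrib_left)
  qed
qed

lemma J2_polys: "J2 \<subseteq> polys n x"
  using subring_zero[OF subring_L] by (auto intro!: polys_I[of "\<lambda>_. 0"])

lemma polys_add: "y \<in> polys n x \<Longrightarrow> z \<in> polys n x \<Longrightarrow> y + z \<in> polys n x"
  using polys_diff[of y n x "0 - z"] polys_diff[of 0 n x z] J2_polys ideal_zero[OF ideal_J2] by auto

lemma polys_sum: "(\<And>i. i \<in> I \<Longrightarrow> f i \<in> polys n x) \<Longrightarrow> sum f I \<in> polys n x"
  using J2_polys[of n x] ideal_zero[OF ideal_J2]
  by (induction I rule: infinite_finite_induct) (auto intro: polys_add)

lemma polys_cong:
  assumes "y - z \<in> J2" "z \<in> polys n x" shows "y \<in> polys n x"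
  using polys_add[of "y - z" n x z] J2_polys assms by auto

lemma polys_monom: "i < n \<Longrightarrow> x ^ i \<in> polys n x"
  using subring_zero[OF subring_L] subring_one[OF subring_L] ideal_zero[OF ideal_J2]
  by (intro polys_I[of "\<lambda>j. if j = i then 1 else 0"]) (auto simp: if_distrib[of "\<lambda>a. a * _"] cong: if_cong)

lemma polys_subsetI:
  assumes "\<And>i. i < m \<Longrightarrow> x ^ i \<in> polys n x" shows "polys m x \<subseteq> polys n x"
proof
  fix y assume "y \<in> polys m x"
  then obtain c where c: "\<forall>i. c i \<in> L" "y - (\<Sum>i<m. c i * x ^ i) \<in> J2" by (rule polys_E)
  have "(\<Sum>i<m. c i * x ^ i) \<in> polys n x" using assms c(1) by (intro polys_sum polys_cmult) auto
  then show "y \<in> polys n x" using polys_cong c(2) by blast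
qed

lemma polys_mono: "m \<le> n \<Longrightarrow> polys m x \<subseteq> polys n x"
  by (intro polys_subsetI polys_monom) auto

lemma L_polys: "0 < n \<Longrightarrow> L \<subseteq> polys n x"
  using polys_cmult[OF _ polys_monom[of 0 n x]] by auto

lemma polys_mult_x:
  assumes "y \<in> polys n x" shows "x * y \<in> polys (Suc n) x"
proof -
  obtain c where c: "\<forall>i. c i \<in> L" "y - (\<Sum>i<n. c i * x ^ i) \<in> J2" using assms by (rule polys_E)
  have "(\<Sum>i<n. c i * x ^ Suc i) \<in> polys (Suc n) x"
    using c(1) by (intro polys_sum polys_cmult polys_monom) auto
  moreover have "x * y - (\<Sum>i<n. c i * x ^ Suc i) \<in> J2"
    using ideal_mult_left[OF ideal_J2 c(2), of x] by (simp add: algebra_simps sum_distrib_left)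
  ultimately show ?thesis using polys_cong by blast
qed

definition all_polys :: "'a \<Rightarrow> 'a set" where "all_polys x = (\<Union>n. polys n x)"

lemma polys_mult_power: "y \<in> polys n x \<Longrightarrow> x ^ i * y \<in> polys (i + n) x"
  by (induction i) (auto simp: mult.assoc dest: polys_mult_x)

lemma subring_all_polys: "cr_subring (all_polys x)"
  unfolding cr_subring_def
proof (intro conjI ballI)
  show "1 \<in> all_polys x" unfolding all_polys_def using L_polys[of 1 x] subring_one[OF subring_L] by auto
next
  fix y z assume yz: "y \<in> all_polys x" "z \<in> all_polys x"
  then obtain n m where n: "y \<in> polys n x" "z \<in> polys m x" unfolding all_polys_def by blast
  then have "y \<in> polys (max n m) x" "z \<in> polys (max n m) x" using polys_mono by (meson max.cobounded1 max.cobounded2 subsetD)+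
  then show "y - z \<in> all_polys x" unfolding all_polys_def using polys_diff by blast
  obtain c where c: "\<forall>i. c i \<in> L" "y - (\<Sum>i<n. c i * x ^ i) \<in> J2" using n(1) by (rule polys_E)
  have "c i * (x ^ i * z) \<in> polys (n + m) x" if "i < n" for i
    using c(1) that by (intro polys_cmult subsetD[OF polys_mono polys_mult_power[OF n(2), of i]]) auto
  then have "(\<Sum>i<n. c i * (x ^ i * z)) \<in> polys (n + m) x" by (intro polys_sum) auto
  moreover have "y * z - (\<Sum>i<n. c i * (x ^ i * z)) \<in> J2"
    using ideal_mult_right[OF ideal_J2 c(2), of z] by (simp add: left_diff_distrib sum_distrib_right mult.assoc)
  ultimately have "y * z \<in> polys (n + m) x" using polys_cong by blast
  then show "y * z \<in> all_polys x" unfolding all_polys_def by blast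
qed

lemma polys_subset_S: "x \<in> S \<Longrightarrow> polys n x \<subseteq> S"
proof
  fix y assume x: "x \<in> S" and "y \<in> polys n x"
  then obtain c where c: "\<forall>i. c i \<in> L" "y - (\<Sum>i<n. c i * x ^ i) \<in> J2" by (auto elim: polys_E)
  have "(\<Sum>i<n. c i * x ^ i) \<in> S"
    using c(1) x L_S by (intro subring_sum[OF subring_S] subring_mult[OF subring_S] subring_power[OF subring_S]) auto
  then have "(y - (\<Sum>i<n. c i * x ^ i)) + (\<Sum>i<n. c i * x ^ i) \<in> S"
    using c(2) J2_S by (intro subring_add[OF subring_S]) auto
  then show "y \<in> S" by simp
qed

lemma admissible_all_polys: "x \<in> S \<Longrightarrow> (\<And>n. polys n x \<inter> J \<subseteq> J2) \<Longrightarrow> admissible (all_polys x)"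
  unfolding admissible_def using subring_all_polys J2_polys[of 0 x] polys_subset_S unfolding all_polys_def by blast

lemma in_L_if_polys_Int_J:
  assumes x: "x \<in> S" and polys: "\<And>n. polys n x \<inter> J \<subseteq> J2" shows "x \<in> L"
proof -
  have "L \<subseteq> all_polys x" unfolding all_polys_def using L_polys[of 1 x] by auto
  then have "all_polys x = L" by (intro maximal_L admissible_all_polys assms)
  moreover have "x \<in> all_polys x" unfolding all_polys_def using polys_monom[of 1 2 x] by auto
  ultimately show ?thesis by blast
qed

definition monic_rel :: "nat \<Rightarrow> 'a \<Rightarrow> bool" where
  "monic_rel n x \<longleftrightarrow> (\<exists>c. (\<forall>i. c i \<in> L) \<and> x ^ n + (\<Sum>i<n. c i * x ^ i) \<in> J)"

lemma monic_rel_cong: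
  assumes "x - y \<in> J" "monic_rel n x" shows "monic_rel n y"
proof -
  obtain c where c: "\<forall>i. c i \<in> L" "x ^ n + (\<Sum>i<n. c i * x ^ i) \<in> J" using assms(2) unfolding monic_rel_def by blast
  have xy: "y - x \<in> J" using assms(1) ideal_diff_commute[OF ideal_J] by blast
  have "(y ^ n - x ^ n) + (\<Sum>i<n. c i * (y ^ i - x ^ i)) \<in> J"
    by (intro ideal_add[OF ideal_J] ideal_sum[OF ideal_J] ideal_mult_left[OF ideal_J] ideal_power_cong[OF ideal_J xy])
  then have "(y ^ n - x ^ n) + (\<Sum>i<n. c i * (y ^ i - x ^ i)) + (x ^ n + (\<Sum>i<n. c i * x ^ i)) \<in> J"
    using c(2) by (rule ideal_add[OF ideal_J])
  then have "y ^ n + (\<Sum>i<n. c i * y ^ i) \<in> J" by (simp add: right_diff_distrib sum_subtractf)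
  then show ?thesis unfolding monic_rel_def using c(1) by blast
qed

lemma monic_rel_of_unit_leading_coeff:
  assumes l: "l \<in> L" "l \<notin> J" and c: "\<And>i. c i \<in> L" and J: "l * x ^ n + (\<Sum>i<n. c i * x ^ i) \<in> J"
  shows "monic_rel n x"
proof -
  obtain l' where l': "l' \<in> L" "l * l' - 1 \<in> Z" using inverse_L[OF l] by blast
  have "l' * (l * x ^ n + (\<Sum>i<n. c i * x ^ i)) - (l * l' - 1) * x ^ n \<in> J"
    using l'(2) Z_J
    by (intro ideal_diff[OF ideal_J ideal_mult_left[OF ideal_J J] ideal_mult_right[OF ideal_J]]) auto
  then have "x ^ n + (\<Sum>i<n. l' * c i * x ^ i) \<in> J"
    by (simp add: algebra_simps sum_distrib_left)
  then show ?thesis unfolding monic_rel_def using c l'(1) subring_mult[OF subring_L] by (intro exI[of _ "\<lambda>i. l' * c i"]) auto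
qed

text \<open>In a polynomial value that lies in \<open>J\<close>, a leading coefficient outside
  \<open>J\<close> would be invertible in \<open>L\<close> and give a monic relation. So it is in
  \<open>L \<inter> J\<close>, hence in \<open>J2\<close>, and the degree drops.\<close>

lemma polys_Int_J_if_no_monic_rel:
  assumes "\<And>k. k < n \<Longrightarrow> \<not> monic_rel k x" shows "polys n x \<inter> J \<subseteq> J2"
  using assms
proof (induction n)
  case 0
  then show ?case unfolding polys_def by auto
next
  case (Suc n)
  show ?case
  proof
    fix y assume y: "y \<in> polys (Suc n) x \<inter> J"
    then obtain c where c: "\<forall>i. c i \<in> L" "y - (\<Sum>i<Suc n. c i * x ^ i) \<in> J2" by (auto elim: polys_E)
    have yJ: "(\<Sum>i<Suc n. c i * x ^ i) \<in> J"
      using c(2) J2_J y ideal_mem_cong[OF ideal_J, of y "\<Sum>i<Suc n. c i * x ^ i"] by blast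
    have "c n \<in> J"
      using monic_rel_of_unit_leading_coeff[of "c n" c x n] c(1) yJ Suc.prems[of n] by (auto simp: add.commute)
    then have cn: "c n * x ^ n \<in> J2" using c(1) L_J by (intro ideal_mult_right[OF ideal_J2]) auto
    have "y - c n * x ^ n \<in> J" using y cn J2_J by (intro ideal_diff[OF ideal_J]) auto
    moreover have "y - c n * x ^ n \<in> polys n x"
      using c by (intro polys_I[of c]) (auto simp: algebra_simps)
    ultimately have "y - c n * x ^ n \<in> J2" using Suc by auto
    then show "y \<in> J2" using cn ideal_mem_cong[OF ideal_J2] by blast
  qed
qed

text \<open>The relation holds modulo \<open>J2\<close> and not merely modulo \<open>J\<close>, so
  all polynomials in \<open>x\<close> reduce to degree below \<open>n\<close>, where the elements of
  \<open>J\<close> are in \<open>J2\<close>. Adjoining \<open>x\<close> is thus admissible, and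
  \<open>L\<close> is maximal.\<close>

lemma in_L_if_minimal_monic_rel:
  assumes x: "x \<in> S" and no: "\<And>k. k < n \<Longrightarrow> \<not> monic_rel k x" and xn: "x ^ n \<in> polys n x"
  shows "x \<in> L"
proof (rule in_L_if_polys_Int_J[OF x])
  fix m
  have mult: "x * y \<in> polys n x" if y: "y \<in> polys n x" for y
  proof -
    have "polys (Suc n) x \<subseteq> polys n x"
    proof (rule polys_subsetI)
      fix i assume "i < Suc n"
      then show "x ^ i \<in> polys n x" using xn polys_monom by (cases "i = n") auto
    qed
    then show ?thesis using polys_mult_x[OF y] by blast
  qed
  have "x ^ i \<in> polys n x" for i
  proof (induction i)
    case 0
    then show ?case using polys_monom[of 0 n x] xn by (cases n) auto
  next
    case (Suc i)
    then show ?case using mult by simp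
  qed
  then have "polys m x \<subseteq> polys n x" by (intro polys_subsetI)
  then show "polys m x \<inter> J \<subseteq> J2" using polys_Int_J_if_no_monic_rel[OF no] by blast
qed

lemma taylor_monomial:
  assumes d: "d \<in> J" shows "(x + d) ^ i - x ^ i - d * (of_nat i * x ^ (i - 1)) \<in> J2"
proof (induction i)
  case 0
  then show ?case using ideal_zero[OF ideal_J2] by simp
next
  case (Suc i)
  have dd: "d * d \<in> J2" unfolding J2_def by (rule mult_in_ideal_sq[OF d d])
  have 1: "of_nat i * x ^ (i - 1) * x = of_nat i * x ^ i" for i by (cases i) auto
  have "(x + d) ^ Suc i - x ^ Suc i - d * (of_nat (Suc i) * x ^ (Suc i - 1))
      = (x + d) * ((x + d) ^ i - x ^ i - d * (of_nat i * x ^ (i - 1)))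
        + (d * d) * (of_nat i * x ^ (i - 1)) + d * (of_nat i * x ^ (i - 1) * x - of_nat i * x ^ i)"
    by (simp add: algebra_simps)
  also have "\<dots> \<in> J2"
    unfolding 1
    using ideal_add[OF ideal_J2 ideal_mult_left[OF ideal_J2 Suc] ideal_mult_right[OF ideal_J2 dd]] by simp
  finally show ?case .
qed

text \<open>The derivative \<open>D\<close> of the minimal relation \<open>q\<close> has leading
  coefficient \<open>of_nat n\<close>, a unit, so \<open>D \<in> J\<close> would be a relation of
  degree \<open>n - 1\<close>. Since \<open>d * d \<in> J2\<close>, the single correction
  \<open>d = - q x / D\<close> makes \<open>q\<close> vanish modulo \<open>J2\<close>.\<close>

lemma newton_step:
  assumes x: "x \<in> S" and monic_rel: "monic_rel n x" and no: "\<And>k. k < n \<Longrightarrow> \<not> monic_rel k x" and n: "of_nat n \<notin> J"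
  shows "\<exists>x'. x - x' \<in> J \<and> x' \<in> S \<and> x' ^ n \<in> polys n x'"
proof -
  obtain c where c: "\<forall>i. c i \<in> L" "x ^ n + (\<Sum>i<n. c i * x ^ i) \<in> J" using monic_rel unfolding monic_rel_def by blast
  define q where "q y = y ^ n + (\<Sum>i<n. c i * y ^ i)" for y
  define D where "D = of_nat n * x ^ (n - 1) + (\<Sum>i<n. c i * (of_nat i * x ^ (i - 1)))"
  have n0: "n \<noteq> 0" using n ideal_zero[OF ideal_J] by (intro notI) simp
  have D_eq: "D = of_nat n * x ^ (n - 1) + (\<Sum>i<n - 1. (c (Suc i) * of_nat (Suc i)) * x ^ i)"
  proof -
    have "(\<Sum>i<n. c i * (of_nat i * x ^ (i - 1))) = (\<Sum>i<Suc (n - 1). c i * (of_nat i * x ^ (i - 1)))"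
      using n0 by simp
    also have "\<dots> = (\<Sum>i<n - 1. c (Suc i) * (of_nat (Suc i) * x ^ i))"
      unfolding sum.lessThan_Suc_shift by simp
    finally show ?thesis unfolding D_def by (simp add: mult.assoc)
  qed
  have D: "D \<notin> J"
  proof
    assume "D \<in> J"
    then have "monic_rel (n - 1) x"
      unfolding D_eq using c(1) n subring_of_nat[OF subring_L] subring_mult[OF subring_L]
      by (intro monic_rel_of_unit_leading_coeff[of "of_nat n" "\<lambda>i. c (Suc i) * of_nat (Suc i)"])
        (auto simp del: of_nat_Suc)
    then show False using no n0 by simp
  qed
  have "D \<in> S"
    unfolding D_def using c(1) x L_S
    by (intro subring_add[OF subring_S] subring_sum[OF subring_S] subring_mult[OF subring_S]
        subring_power[OF subring_S] subring_of_nat[OF subring_S]) auto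
  then obtain e where e: "D * e - 1 \<in> Z" using inverse_S D by blast
  define d where "d = - (q x * e)"
  have qJ: "q x \<in> J" using c(2) unfolding q_def .
  have dJ: "d \<in> J" unfolding d_def by (intro ideal_uminus[OF ideal_J] ideal_mult_right[OF ideal_J] qJ)
  have "q (x + d) - q x - d * D = ((x + d) ^ n - x ^ n - d * (of_nat n * x ^ (n - 1)))
      + (\<Sum>i<n. c i * ((x + d) ^ i - x ^ i - d * (of_nat i * x ^ (i - 1))))"
    unfolding q_def D_def by (simp add: right_diff_distrib distrib_left sum_subtractf sum_distrib_left mult.left_commute)
  also have "\<dots> \<in> J2"
    by (intro ideal_add[OF ideal_J2] ideal_sum[OF ideal_J2] ideal_mult_left[OF ideal_J2] taylor_monomial dJ)
  finally have "q (x + d) - q x - d * D \<in> J2" .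
  moreover have "q x * (D * e - 1) \<in> J2" using e Z_J2 by (intro ideal_mult_left[OF ideal_J2]) auto
  ultimately have "(q (x + d) - q x - d * D) - q x * (D * e - 1) \<in> J2" by (rule ideal_diff[OF ideal_J2])
  then have q0: "q (x + d) \<in> J2" unfolding d_def by (simp add: algebra_simps)
  have "(\<Sum>i<n. - c i * (x + d) ^ i) \<in> polys n (x + d)"
    using c(1) by (intro polys_sum polys_cmult polys_monom subring_uminus[OF subring_L]) auto
  moreover have "(x + d) ^ n - (\<Sum>i<n. - c i * (x + d) ^ i) \<in> J2"
    using q0 unfolding q_def by (simp add: sum_negf)
  ultimately have "(x + d) ^ n \<in> polys n (x + d)" using polys_cong by blast
  moreover have "x - (x + d) \<in> J" using ideal_uminus[OF ideal_J dJ] by simp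
  moreover have "x + d \<in> S" using x dJ J_S by (intro subring_add[OF subring_S]) auto
  ultimately show ?thesis by blast
qed

text \<open>Take the least degree \<open>n\<close> of a monic relation of \<open>x\<close> over \<open>L\<close> modulo \<open>J\<close>. If \<open>n\<close> is invertible, a
  Newton step turns it into a relation modulo \<open>J2\<close>. Otherwise \<open>n = p\<close>, and \<open>x ^ p \<in> L0\<close> is a relation
  that holds exactly.\<close>

lemma L_generates:
  assumes x: "x \<in> S" shows "\<exists>l\<in>L. x - l \<in> J"
proof (cases "\<exists>n. monic_rel n x")
  case False
  \<comment> \<open>Without any relation modulo \<open>J\<close>, adjoining \<open>x\<close> keeps
    \<open>L\<close> admissible, so maximality puts \<open>x\<close> into \<open>L\<close>.\<close>
  then have "x \<in> L" by (intro in_L_if_polys_Int_J[OF x] polys_Int_J_if_no_monic_rel) blast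
  then show ?thesis using ideal_zero[OF ideal_J] by (intro bexI[of _ x]) auto
next
  case True
  define n where "n = (LEAST n. monic_rel n x)"
  have n: "monic_rel n x" and no: "\<And>k. k < n \<Longrightarrow> \<not> monic_rel k x"
    unfolding n_def using LeastI_ex[OF True] not_less_Least by auto
  have n0: "0 < n"
  proof (rule ccontr)
    assume "\<not> 0 < n"
    then have "1 \<in> J" using n unfolding monic_rel_def by simp
    then show False using one_notin_J by blast
  qed
  have "\<exists>x'. x - x' \<in> J \<and> x' \<in> S \<and> x' ^ n \<in> polys n x'"
  proof (cases "of_nat n \<in> J")
    case True
    then have p: "Factorial_Ring.prime p" "p \<le> n" using residue_char[OF n0] J_M by auto
    have "x ^ p \<in> L0" unfolding L0_def using p(1) x ideal_zero[OF ideal_J2] by (auto intro!: bexI[of _ x])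
    then have xp: "x ^ p \<in> L" using L0_L by blast
    have "monic_rel p x" unfolding monic_rel_def
    proof (intro exI[of _ "\<lambda>i. if i = 0 then - (x ^ p) else 0"] conjI allI)
      show "(if i = 0 then - (x ^ p) else 0) \<in> L" for i :: nat
        using subring_uminus[OF subring_L xp] subring_zero[OF subring_L] by simp
      have "(\<Sum>i<p. (if i = 0 then - (x ^ p) else 0) * x ^ i) = - (x ^ p)"
        using prime_gt_0_nat[OF p(1)] by (simp add: if_distrib[of "\<lambda>a. a * _"] cong: if_cong)
      then show "x ^ p + (\<Sum>i<p. (if i = 0 then - (x ^ p) else 0) * x ^ i) \<in> J"
        using ideal_zero[OF ideal_J] by simp
    qed
    then have "n = p" using no[of p] p(2) by (cases "p < n") auto
    then have "x ^ n \<in> polys n x" using xp L_polys[OF n0] by blast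
    then show ?thesis using x ideal_zero[OF ideal_J] by (intro exI[of _ x]) auto
  next
    case False
    show ?thesis by (rule newton_step[OF x n no False])
  qed
  then obtain x' where x': "x - x' \<in> J" "x' \<in> S" "x' ^ n \<in> polys n x'" by blast
  have "\<not> monic_rel k x'" if "k < n" for k
    using no[OF that] monic_rel_cong[of x' x k] ideal_diff_commute[OF ideal_J] x'(1) by blast
  then have "x' \<in> L" by (rule in_L_if_minimal_monic_rel[OF x'(2) _ x'(3)])
  then show ?thesis using x'(1) by blast
qed

end

context square_lifting
begin

lemma square_lift: "\<exists>L. field_ext L (ideal_sq J) \<and> L \<subseteq> S \<and> L \<inter> J \<subseteq> ideal_sq J \<and> (\<forall>s\<in>S. \<exists>l\<in>L. s - l \<in> J)"
proof -
  obtain L where L: "admissible L" "L0 \<subseteq> L" "\<forall>L'. admissible L' \<longrightarrow> L \<subseteq> L' \<longrightarrow> L' = L" using maximal_admissible by blast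
  interpret square_lifting_maximal Z M S J p L
    by unfold_locales (use L in auto)
  have "field_ext L J2"
    unfolding field_ext_def
    using subring_L ideal_J2 Z_J2 J2_L J2_J J_M inverse_L L_J by blast
  then show ?thesis using L_S L_J L_generates unfolding J2_def by blast
qed

end

context complete_noetherian_mod
begin

text \<open>Each \<open>T n / I n\<close> is a copy of the field \<open>S / A\<close>. The
  intersection of the \<open>T n\<close> meets \<open>A\<close> only in the intersection of the
  \<open>I n\<close>, which is \<open>Z\<close>; and since \<open>T n\<close> contains
  \<open>I n\<close>, a limit of successive representatives lies in every
  \<open>T n\<close>.\<close>

theorem coefficient_field_exists:
  assumes SA: "field_ext S A"
    and residue_char: "\<And>n. 0 < n \<Longrightarrow> of_nat n \<in> M \<Longrightarrow> Factorial_Ring.prime p \<and> p \<le> n"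
    and equal_char: "Factorial_Ring.prime p \<Longrightarrow> of_nat p \<in> Z"
  shows "\<exists>F. cr_subring F \<and> Z \<subseteq> F \<and> F \<subseteq> S \<and> F \<inter> A \<subseteq> Z \<and> (\<forall>s\<in>S. \<exists>f\<in>F. s - f \<in> A)"
proof -
  define I where "I n = (ideal_sq ^^ n) A" for n
  have I_Suc: "I (Suc n) = ideal_sq (I n)" and I_0: "I 0 = A" for n by (auto simp: I_def)
  \<comment> \<open>The conjunct for \<open>n = 0\<close> records the starting point: dependent
    choice fixes the members of the sequence only through the predicate that they satisfy.\<close>
  have "\<exists>T. \<forall>n. (field_ext (T n) (I n) \<and> (n = 0 \<longrightarrow> T n = S)) \<and>
    (T (Suc n) \<subseteq> T n \<and> T (Suc n) \<inter> I n \<subseteq> I (Suc n) \<and> (\<forall>s\<in>T n. \<exists>l\<in>T (Suc n). s - l \<in> I n))"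
  proof (rule dependent_nat_choice)
    show "\<exists>T. field_ext T (I 0) \<and> (0 = 0 \<longrightarrow> T = S)" using SA I_0 by auto
  next
    fix T n assume T: "field_ext T (I n) \<and> (n = 0 \<longrightarrow> T = S)"
    interpret square_lifting Z M T "I n" p
      by unfold_locales (use T residue_char equal_char in auto)
    show "\<exists>T'. (field_ext T' (I (Suc n)) \<and> (Suc n = 0 \<longrightarrow> T' = S)) \<and>
      (T' \<subseteq> T \<and> T' \<inter> I n \<subseteq> I (Suc n) \<and> (\<forall>s\<in>T. \<exists>l\<in>T'. s - l \<in> I n))"
      using square_lift unfolding I_Suc by simp
  qed
  then obtain T where T_all: "\<forall>n. (field_ext (T n) (I n) \<and> (n = 0 \<longrightarrow> T n = S)) \<and>
    (T (Suc n) \<subseteq> T n \<and> T (Suc n) \<inter> I n \<subseteq> I (Suc n) \<and> (\<forall>s\<in>T n. \<exists>l\<in>T (Suc n). s - l \<in> I n))" ..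
  then have T: "field_ext (T n) (I n)" "T 0 = S" "T (Suc n) \<subseteq> T n" "T (Suc n) \<inter> I n \<subseteq> I (Suc n)"
    "s \<in> T n \<Longrightarrow> \<exists>l\<in>T (Suc n). s - l \<in> I n" for n s by auto
  have Ii: "cr_ideal (I n)" and ZI: "Z \<subseteq> I n" and IM: "I n \<subseteq> M" and Ts: "cr_subring (T n)" and IT: "I n \<subseteq> T n" for n
    using T(1)[of n] unfolding field_ext_def by auto
  have I_dec: "I (Suc n) \<subseteq> I n" for n unfolding I_Suc by (rule ideal_sq_subset[OF Ii ZI])
  have I_anti: "m \<le> n \<Longrightarrow> I n \<subseteq> I m" for m n by (rule lift_Suc_antimono_le[of I, OF I_dec])
  have I_pw: "I n \<subseteq> pw (Suc n)" for n
  proof (induction n)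
    case 0
    then show ?case using IM[of 0] M_subset_pw_1 by blast
  next
    case (Suc n)
    show ?case
      unfolding I_Suc ideal_sq_def
    proof (rule ideal_gen_least[OF pw_ideal])
      show "{a * b |a b. a \<in> I n \<and> b \<in> I n} \<union> Z \<subseteq> pw (Suc (Suc n))"
        using Suc IM[of n] pw_Suc_mult[of _ "Suc n"] Z_subset_pw by blast
    qed
  qed
  define F where "F = (\<Inter>n. T n)"
  have "cr_subring F"
    unfolding cr_subring_def F_def
    by (auto intro: subring_one[OF Ts] subring_diff[OF Ts] subring_mult[OF Ts])
  moreover have "Z \<subseteq> F" unfolding F_def using ZI IT by blast
  moreover have "F \<subseteq> S" unfolding F_def using T(2) by blast
  moreover have "F \<inter> A \<subseteq> Z"
  proof
    fix x assume x: "x \<in> F \<inter> A"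
    have "x \<in> I n" for n
    proof (induction n)
      case (Suc n)
      then show ?case using x T(4)[of n] unfolding F_def by blast
    qed (use x I_0 in auto)
    then have "x \<in> pw n" for n using I_pw[of n] pw_Suc_subset[of n] by blast
    then show "x \<in> Z" by (rule separated)
  qed
  moreover have "\<exists>f\<in>F. s - f \<in> A" if s: "s \<in> S" for s
  proof -
    have "\<exists>t. \<forall>n. (t n \<in> T n \<and> (n = 0 \<longrightarrow> t n = s)) \<and> t n - t (Suc n) \<in> I n"
      by (rule dependent_nat_choice) (use s T(2,5) in auto)
    then obtain t where t: "\<And>n. t n \<in> T n" "t 0 = s" "\<And>n. t n - t (Suc n) \<in> I n" by auto
    have "t (Suc n) - t n \<in> pw n" for n
      using t(3)[of n] I_pw[of n] pw_Suc_subset[of n] ideal_diff_commute[OF pw_ideal] by blast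
    then obtain l where l: "\<And>n. t n - l \<in> pw n" using complete[of t] by blast
    have tele: "t n - t (n + k) \<in> I n" for n k
    proof (induction k)
      case (Suc k)
      have "t (n + k) - t (n + Suc k) \<in> I n" using t(3)[of "n + k"] I_anti[of n "n + k"] by auto
      then show ?case using Suc ideal_diff_trans[OF Ii] by blast
    qed (use ideal_zero[OF Ii] in auto)
    \<comment> \<open>\<open>I n\<close> is closed by Krull's intersection theorem, so congruence
      modulo \<open>I n\<close> passes from the terms to the limit.\<close>
    have lt: "t n - l \<in> I n" for n
    proof (rule ideal_closed[OF Ii ZI])
      fix k
      have "t (n + k) - l \<in> pw k" using l[of "n + k"] pw_antimono[of k "n + k"] by auto
      then show "\<exists>j\<in>I n. t n - l - j \<in> pw k"
        using tele[of n k] by (intro bexI[of _ "t n - t (n + k)"]) (auto simp: algebra_simps)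
    qed
    have "l \<in> T n" for n
    proof -
      have "t n - (t n - l) \<in> T n" by (rule subring_diff[OF Ts t(1) subsetD[OF IT lt]])
      then show ?thesis by simp
    qed
    then have "l \<in> F" unfolding F_def by blast
    then show ?thesis using lt[of 0] t(2) I_0 by auto
  qed
  ultimately show ?thesis by blast
qed

end

section \<open>Lifting modulo the zero ideal\<close>

text \<open>A homomorphism in graph form, as a subring of the product, which leaves the choice of
  representatives open.\<close>

definition pair_subring :: "('r::comm_ring_1 \<times> 'r) set \<Rightarrow> bool" where
  "pair_subring H \<longleftrightarrow> (1, 1) \<in> H \<and>
    (\<forall>a b c d. (a, b) \<in> H \<longrightarrow> (c, d) \<in> H \<longrightarrow> (a - c, b - d) \<in> H \<and> (a * c, b * d) \<in> H)"

lemma pair_one: "pair_subring H \<Longrightarrow> (1, 1) \<in> H"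
  and pair_diff: "pair_subring H \<Longrightarrow> (a, b) \<in> H \<Longrightarrow> (c, d) \<in> H \<Longrightarrow> (a - c, b - d) \<in> H"
  and pair_mult: "pair_subring H \<Longrightarrow> (a, b) \<in> H \<Longrightarrow> (c, d) \<in> H \<Longrightarrow> (a * c, b * d) \<in> H"
  unfolding pair_subring_def by blast+

lemma pair_zero: "pair_subring H \<Longrightarrow> (0, 0) \<in> H"
  using pair_diff[of H 1 1 1 1] pair_one by auto

lemma pair_add:
  assumes "pair_subring H" "(a, b) \<in> H" "(c, d) \<in> H" shows "(a + c, b + d) \<in> H"
  using pair_diff[OF assms(1,2) pair_diff[OF assms(1) pair_zero[OF assms(1)] assms(3)]] by simp

lemma pair_sum:
  assumes "pair_subring H" "\<And>i. i \<in> I \<Longrightarrow> (f i, g i) \<in> H" shows "(sum f I, sum g I) \<in> H"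
  using assms(2)
  by (induction I rule: infinite_finite_induct) (auto intro: pair_zero[OF assms(1)] pair_add[OF assms(1)])

lemma subring_snd_image:
  assumes "pair_subring H" shows "cr_subring (snd ` H)"
  unfolding cr_subring_def
proof (intro conjI ballI)
  show "1 \<in> snd ` H" using pair_one[OF assms] by force
next
  fix x y assume "x \<in> snd ` H" "y \<in> snd ` H"
  then obtain a b where "(a, x) \<in> H" "(b, y) \<in> H" by force
  then show "x - y \<in> snd ` H" "x * y \<in> snd ` H"
    using pair_diff[OF assms] pair_mult[OF assms] by (metis image_eqI snd_conv)+
qed

context complete_noetherian_mod
begin

lemma lspan_add:
  assumes B: "cr_subring B" shows "s \<in> lspan B us \<Longrightarrow> t \<in> lspan B us \<Longrightarrow> s + t \<in> lspan B us"
proof (induction us arbitrary: s t)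
  case Nil
  then show ?case using ideal_add[OF ideal_Z] by simp
next
  case (Cons u us)
  then obtain b r c q where *: "b \<in> B" "r \<in> lspan B us" "s = b * u + r" "c \<in> B" "q \<in> lspan B us" "t = c * u + q"
    by auto
  then have "s + t = (b + c) * u + (r + q)" by (simp add: algebra_simps)
  then show ?case using * Cons.IH subring_add[OF B] unfolding lspan.simps by blast
qed

lemma lspan_scale:
  assumes B: "cr_subring B" and d: "d \<in> B" shows "s \<in> lspan B us \<Longrightarrow> d * s \<in> lspan B us"
proof (induction us arbitrary: s)
  case Nil
  then show ?case using ideal_mult_left[OF ideal_Z] by simp
next
  case (Cons u us)
  then obtain b r where *: "b \<in> B" "r \<in> lspan B us" "s = b * u + r" by auto
  then have "d * s = (d * b) * u + d * r" by (simp add: algebra_simps)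
  then show ?case using * Cons.IH subring_mult[OF B d] unfolding lspan.simps by blast
qed

lemma lspan_cong:
  assumes Q: "cr_ideal Q" "Z \<subseteq> Q" and B: "\<And>b. b \<in> B \<Longrightarrow> \<exists>c\<in>C. b - c \<in> Q"
  shows "t \<in> lspan B us \<Longrightarrow> \<exists>s\<in>lspan C us. t - s \<in> Q"
proof (induction us arbitrary: t)
  case Nil
  then show ?case using ideal_zero[OF Q(1)] by (auto intro!: bexI[of _ t])
next
  case (Cons u us)
  then obtain b r where br: "b \<in> B" "r \<in> lspan B us" "t = b * u + r" by auto
  obtain s where s: "s \<in> lspan C us" "r - s \<in> Q" using Cons.IH[OF br(2)] by blast
  obtain c where c: "c \<in> C" "b - c \<in> Q" using B[OF br(1)] by blast
  have "t - (c * u + s) \<in> Q"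
    using ideal_add[OF Q(1) ideal_mult_right[OF Q(1) c(2), of u] s(2)] br(3) by (simp add: algebra_simps)
  then show ?case using c(1) s(1) unfolding lspan.simps by blast
qed

end

text \<open>\<open>\<Phi>\<close> is the graph of a finite endomorphism of the quotient by \<open>A\<close>, as a relation between
  representatives. Its lift is again constructed as a relation, single-valued modulo \<open>Z\<close>.\<close>

locale lifting_problem = regular_mod Z M K xs
  for Z M K :: "'r::comm_ring_1 set" and xs :: "'r list" +
  fixes A :: "'r set" and \<Phi> :: "('r \<times> 'r) set" and p :: nat
  assumes residue_char: "\<And>n. 0 < n \<Longrightarrow> of_nat n \<in> M \<Longrightarrow> Factorial_Ring.prime p \<and> p \<le> n"
    and equal_char: "Factorial_Ring.prime p \<Longrightarrow> of_nat p \<in> Z"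
    and ideal_A: "cr_ideal A" and Z_A: "Z \<subseteq> A" and A_M: "A \<subseteq> M"
    and pair_\<Phi>: "pair_subring \<Phi>"
    and total_\<Phi>: "\<And>s. \<exists>t. (s, t) \<in> \<Phi>"
    and A_\<Phi>: "\<And>s t. s \<in> A \<Longrightarrow> (s, t) \<in> \<Phi> \<longleftrightarrow> t \<in> A"
    and finite_\<Phi>: "\<exists>us. \<forall>r. \<exists>t\<in>lspan (snd ` \<Phi>) us. r - t \<in> A"
begin

lemma \<Phi>_cong: "(s, t) \<in> \<Phi> \<Longrightarrow> s - s' \<in> A \<Longrightarrow> t - t' \<in> A \<Longrightarrow> (s', t') \<in> \<Phi>"
  using pair_diff[OF pair_\<Phi>, of s t "s - s'" "t - t'"] A_\<Phi>[of "s - s'"] by simp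

lemma \<Phi>_unique: "(s, t) \<in> \<Phi> \<Longrightarrow> (s', t') \<in> \<Phi> \<Longrightarrow> s - s' \<in> A \<Longrightarrow> t - t' \<in> A"
  using pair_diff[OF pair_\<Phi>, of s t s' t'] A_\<Phi>[of "s - s'"] by simp

lemma one_notin_A: "1 \<notin> A"
  using one_notin_M A_M by blast

text \<open>If some \<open>s\<close> in \<open>M\<close> were sent to a unit, then every module generator could be eliminated.\<close>

lemma \<Phi>_local:
  assumes "(s, t) \<in> \<Phi>" "s \<in> M" shows "t \<in> M"
proof (rule ccontr)
  assume "t \<notin> M"
  then obtain t' where t': "t * t' - 1 \<in> Z" using inverse_mod by blast
  note im = subring_snd_image[OF pair_\<Phi>]
  have no: "\<not> (\<forall>r. \<exists>w\<in>lspan (snd ` \<Phi>) us. r - w \<in> A)" for us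
  proof (induction us)
    case Nil
    show ?case
    proof
      assume "\<forall>r. \<exists>w\<in>lspan (snd ` \<Phi>) []. r - w \<in> A"
      then obtain w where "w \<in> Z" "1 - w \<in> A" by auto
      then have "1 \<in> A" using ideal_mem_cong[OF ideal_A] Z_A by blast
      then show False using one_notin_A by blast
    qed
  next
    case (Cons u us)
    show ?case
    proof
      assume gen: "\<forall>r. \<exists>w\<in>lspan (snd ` \<Phi>) (u # us). r - w \<in> A"
      then obtain b w where bw: "b \<in> snd ` \<Phi>" "w \<in> lspan (snd ` \<Phi>) us" "u * t' - (b * u + w) \<in> A"
        by (fastforce dest: spec[of _ "u * t'"])
      obtain a where ab: "(a, b) \<in> \<Phi>" using bw(1) by force
      \<comment> \<open>Multiplied by \<open>t\<close>, the last part of \<open>bw\<close> reads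
        \<open>(1 - t * b) * u = t * w\<close> modulo \<open>A\<close>. Here
        \<open>1 - t * b\<close> is invertible modulo \<open>A\<close>, being an image of the unit
        \<open>1 - s * a\<close>.\<close>
      have "s * a \<in> M" using assms(2) by (rule ideal_mult_right[OF ideal_M])
      then have "1 - s * a \<notin> M" using one_notin_M ideal_add[OF ideal_M, of "1 - s * a" "s * a"] by auto
      then obtain v where v: "(1 - s * a) * v - 1 \<in> Z" using inverse_mod by blast
      obtain v' where v': "(v, v') \<in> \<Phi>" using total_\<Phi> by blast
      have "((1 - s * a) * v, (1 - t * b) * v') \<in> \<Phi>"
        by (intro pair_mult[OF pair_\<Phi>] pair_diff[OF pair_\<Phi>] pair_one[OF pair_\<Phi>] assms(1) ab v')
      then have vv: "(1 - t * b) * v' - 1 \<in> A" using \<Phi>_unique[OF _ pair_one[OF pair_\<Phi>]] v Z_A by blast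
      have tA: "t * t' - 1 \<in> A" using t' Z_A by blast
      have "v' * t * (u * t' - (b * u + w)) - u * ((1 - t * b) * v' - 1) - u * v' * (t * t' - 1) \<in> A"
        using bw(3) vv tA
        by (intro ideal_diff[OF ideal_A ideal_diff[OF ideal_A]] ideal_mult_left[OF ideal_A])
      then have uw: "u - v' * t * w \<in> A" by (simp add: algebra_simps)
      have vt: "v' * t \<in> snd ` \<Phi>" using pair_mult[OF pair_\<Phi> v' assms(1)] by force
      have "\<exists>w'\<in>lspan (snd ` \<Phi>) us. r - w' \<in> A" for r
      proof -
        obtain c q where cq: "c \<in> snd ` \<Phi>" "q \<in> lspan (snd ` \<Phi>) us" "r - (c * u + q) \<in> A"
          using spec[OF gen, of r] unfolding lspan.simps by blast
        have "r - (c * u + q) + c * (u - v' * t * w) \<in> A"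
          by (rule ideal_add[OF ideal_A cq(3) ideal_mult_left[OF ideal_A uw]])
        then have "r - (c * (v' * t * w) + q) \<in> A" by (simp add: algebra_simps)
        moreover have "c * (v' * t * w) + q \<in> lspan (snd ` \<Phi>) us"
          by (intro lspan_add[OF im] lspan_scale[OF im] cq vt bw)
        ultimately show ?thesis by blast
      qed
      then show False using Cons.IH by blast
    qed
  qed
  then show False using finite_\<Phi> by blast
qed

lemma inverse_K:
  assumes c: "c \<in> K" "c \<notin> M" shows "\<exists>k\<in>K. c * k - 1 \<in> Z"
proof -
  obtain d where d: "c * d - 1 \<in> Z" using inverse_mod c(2) by blast
  obtain k where k: "k \<in> K" "d - k \<in> M" using residue by blast
  have "(c * d - 1) - c * (d - k) \<in> M" using d k(2) Z_subset_M ideal_M by (blast intro: ideal_diff ideal_mult_left)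
  then have "c * k - 1 \<in> M" by (simp add: algebra_simps)
  moreover have "c * k - 1 \<in> K" using c(1) k(1) by (intro subring_diff[OF subring_K] subring_mult[OF subring_K] subring_one[OF subring_K])
  ultimately show ?thesis using K_Int_M k(1) by blast
qed

definition S :: "'r set" where "S = {t. \<exists>c\<in>K. (c, t) \<in> \<Phi>}"

lemma field_ext_S: "field_ext S A"
  unfolding field_ext_def
proof (intro conjI ideal_A Z_A A_M ballI impI)
  show "cr_subring S"
    unfolding cr_subring_def S_def
    by (auto intro: subring_one[OF subring_K] pair_one[OF pair_\<Phi>])
      (metis subring_diff[OF subring_K] pair_diff[OF pair_\<Phi>] subring_mult[OF subring_K] pair_mult[OF pair_\<Phi>])+
  show "A \<subseteq> S"
    unfolding S_def using A_\<Phi>[OF ideal_zero[OF ideal_A]] subring_zero[OF subring_K] by blast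
  fix t assume t: "t \<in> S" "t \<notin> A"
  then obtain c where c: "c \<in> K" "(c, t) \<in> \<Phi>" unfolding S_def by blast
  then have "c \<notin> A" using t(2) A_\<Phi> by blast
  then have "c \<notin> M" using K_Int_M Z_A c(1) by blast
  then obtain k where k: "k \<in> K" "c * k - 1 \<in> Z" using inverse_K c(1) by blast
  obtain t' where t': "(k, t') \<in> \<Phi>" using total_\<Phi> by blast
  have tt': "t * t' - 1 \<in> A"
    using \<Phi>_unique[OF pair_mult[OF pair_\<Phi> c(2) t'] pair_one[OF pair_\<Phi>]] k(2) Z_A by blast
  have "t \<notin> M"
  proof
    assume "t \<in> M"
    then have "t * t' \<in> M" by (rule ideal_mult_right[OF ideal_M])
    then have "t * t' - (t * t' - 1) \<in> M" using tt' A_M by (blast intro: ideal_diff[OF ideal_M])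
    then show False using one_notin_M by simp
  qed
  \<comment> \<open>The image \<open>t'\<close> of the inverse of \<open>c\<close> inverts
    \<open>t\<close> only modulo \<open>A\<close>. An inverse \<open>s\<close> modulo
    \<open>Z\<close> agrees with \<open>t'\<close> modulo \<open>A\<close>, so it corresponds to the
    same \<open>k\<close> under \<open>\<Phi>\<close> and lies in \<open>S\<close>.\<close>
  then obtain s where s: "t * s - 1 \<in> Z" using inverse_mod by blast
  have "s * (t * t' - 1) - t' * (t * s - 1) \<in> A"
    using tt' s Z_A by (blast intro: ideal_diff[OF ideal_A] ideal_mult_left[OF ideal_A])
  then have "t' - s \<in> A" by (simp add: algebra_simps)
  then have "(k, s) \<in> \<Phi>" using \<Phi>_cong[OF t'] ideal_zero[OF ideal_A] by simp
  then show "\<exists>s'\<in>S. t * s' - 1 \<in> Z" using s k(1) unfolding S_def by blast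
qed

section \<open>Lifts as relations between power series\<close>

definition lift :: "('r \<times> 'r) set \<Rightarrow> bool" where
  "lift H \<longleftrightarrow> pair_subring H \<and> H \<subseteq> \<Phi> \<and> (\<forall>s t. (s, t) \<in> H \<longrightarrow> s \<in> Z \<longrightarrow> t \<in> Z)"

text \<open>Substitution of \<open>y\<close> for \<open>x\<close> in series whose coefficients
  correspond under \<open>H\<close>. It is only a relation at first; \<open>unique_expansion\<close>
  makes it single-valued modulo \<open>Z\<close>.\<close>

definition extend :: "('r \<times> 'r) set \<Rightarrow> 'r \<Rightarrow> 'r \<Rightarrow> ('r \<times> 'r) set" where
  "extend H x y = {(s, t). \<exists>a b. (\<forall>n. (a n, b n) \<in> H) \<and> is_ser a x s \<and> is_ser b y t}"

lemma fst_extend: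
  assumes "y \<in> M" shows "fst ` extend H x y = PSer (fst ` H) x"
proof
  show "fst ` extend H x y \<subseteq> PSer (fst ` H) x" unfolding extend_def PSer_def by force
  show "PSer (fst ` H) x \<subseteq> fst ` extend H x y"
  proof
    fix s assume "s \<in> PSer (fst ` H) x"
    then obtain a where a: "\<forall>n. a n \<in> fst ` H" "is_ser a x s" unfolding PSer_def by blast
    then have "\<forall>n. \<exists>b. (a n, b) \<in> H" by force
    then obtain b where b: "\<forall>n. (a n, b n) \<in> H" by metis
    obtain t where "is_ser b y t" using is_ser_exists[OF assms, of b] by blast
    then have "(s, t) \<in> extend H x y" unfolding extend_def using a b by blast
    then show "s \<in> fst ` extend H x y" by force
  qed
qed

lemma snd_extend:
  assumes "x \<in> M" shows "snd ` extend H x y = PSer (snd ` H) y"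
proof -
  have "extend H x y = (extend (H\<inverse>) y x)\<inverse>" unfolding extend_def by auto
  then show ?thesis using fst_extend[OF assms, of "H\<inverse>" y] by (simp add: Range_snd[symmetric] Domain_fst[symmetric])
qed

lemma pair_subring_extend:
  assumes H: "pair_subring H" shows "pair_subring (extend H x y)"
  unfolding pair_subring_def
proof (intro conjI allI impI)
  have "\<forall>n::nat. (if n = 0 then 1 else 0, if n = 0 then 1 else 0) \<in> H"
    using pair_one[OF H] pair_zero[OF H] by simp
  then show "(1, 1) \<in> extend H x y"
    unfolding extend_def using is_ser_const[of 1 x] is_ser_const[of 1 y]
    by (intro CollectI case_prodI exI conjI)
next
  fix s t s' t' assume "(s, t) \<in> extend H x y" "(s', t') \<in> extend H x y"
  then obtain a b a' b' where
    1: "\<forall>n. (a n, b n) \<in> H" "is_ser a x s" "is_ser b y t" and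
    2: "\<forall>n. (a' n, b' n) \<in> H" "is_ser a' x s'" "is_ser b' y t'"
    unfolding extend_def by blast
  have "\<forall>n. (a n - a' n, b n - b' n) \<in> H" using 1 2 pair_diff[OF H] by blast
  then show "(s - s', t - t') \<in> extend H x y"
    unfolding extend_def using is_ser_diff[OF 1(2) 2(2)] is_ser_diff[OF 1(3) 2(3)]
    by (intro CollectI case_prodI exI conjI)
  have "\<forall>n. (\<Sum>i\<le>n. a i * a' (n - i), \<Sum>i\<le>n. b i * b' (n - i)) \<in> H"
    using 1 2 by (intro allI pair_sum[OF H] pair_mult[OF H]) auto
  then show "(s * s', t * t') \<in> extend H x y"
    unfolding extend_def using is_ser_mult[OF 1(2) 2(2)] is_ser_mult[OF 1(3) 2(3)]
    by (intro CollectI case_prodI exI conjI)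
qed

text \<open>Tails of the two series correspond under \<open>\<Phi>\<close>, up to a series with coefficients in \<open>A\<close>.\<close>

lemma extend_subset:
  assumes H: "H \<subseteq> \<Phi>" and xy: "(x, y) \<in> \<Phi>" "y \<in> M" shows "extend H x y \<subseteq> \<Phi>"
proof (clarify)
  fix s t assume "(s, t) \<in> extend H x y"
  then obtain a b where ab: "\<And>n. (a n, b n) \<in> \<Phi>" "is_ser a x s" "is_ser b y t"
    unfolding extend_def using H by blast
  obtain u where u: "u 0 = s" "\<And>n. u n - (a n + x * u (Suc n)) \<in> Z"
    using ab(2) unfolding is_ser_def by blast
  have "\<exists>r. \<forall>n. (u n, r n) \<in> \<Phi>" by (rule choice) (use total_\<Phi> in blast)
  then obtain r where r: "\<And>n. (u n, r n) \<in> \<Phi>" by blast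
  have "is_ser (\<lambda>n. r n - y * r (Suc n)) y (r 0)"
    by (rule is_serI[of r]) (auto simp: ideal_zero[OF ideal_Z])
  then have "r 0 - t \<in> A"
  proof (rule is_ser_unique[OF _ ab(3) xy(2) ideal_A Z_A])
    fix n
    have "(a n + x * u (Suc n), b n + y * r (Suc n)) \<in> \<Phi>"
      by (intro pair_add[OF pair_\<Phi>] pair_mult[OF pair_\<Phi>] ab xy r)
    then have "r n - (b n + y * r (Suc n)) \<in> A" using \<Phi>_unique[OF r] u(2)[of n] Z_A by blast
    then show "r n - y * r (Suc n) - b n \<in> A" by (simp add: algebra_simps)
  qed
  then show "(s, t) \<in> \<Phi>" using \<Phi>_cong[OF r[of 0]] u(1) ideal_zero[OF ideal_A] by simp
qed

text \<open>Variables are added from the last to the first, following the nesting in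
  \<open>PS\<close>. The list \<open>zs\<close> has to be a tail of \<open>xs\<close> because
  \<open>unique_expansion\<close> concerns coefficients that are series in the variables after
  \<open>x\<close>.\<close>

lemma lift_exists:
  assumes H0: "lift H0" "fst ` H0 = K" "snd ` H0 = F"
    and zs: "xs = pre @ zs" and ys: "list_all2 (\<lambda>x y. (x, y) \<in> \<Phi> \<and> y \<in> M) zs ys"
  shows "\<exists>H. lift H \<and> fst ` H = PS K zs \<and> snd ` H = PS F ys"
  using zs ys
proof (induction zs arbitrary: pre ys)
  case Nil
  then show ?case using H0 by auto
next
  case (Cons x zs)
  then obtain y ys' where ys: "ys = y # ys'" "(x, y) \<in> \<Phi>" "y \<in> M" "list_all2 (\<lambda>x y. (x, y) \<in> \<Phi> \<and> y \<in> M) zs ys'"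
    by (auto simp: list_all2_Cons1)
  obtain H where H: "lift H" "fst ` H = PS K zs" "snd ` H = PS F ys'"
    using Cons.IH[of "pre @ [x]" ys'] Cons.prems ys by auto
  have x: "x \<in> M" using Cons.prems xs_M by auto
  have "lift (extend H x y)"
    unfolding lift_def
  proof (intro conjI allI impI)
    show "pair_subring (extend H x y)" using H(1) pair_subring_extend unfolding lift_def by blast
    show "extend H x y \<subseteq> \<Phi>" using H(1) ys extend_subset unfolding lift_def by blast
    fix s t assume st: "(s, t) \<in> extend H x y" "s \<in> Z"
    then obtain a b where ab: "\<And>n. (a n, b n) \<in> H" "is_ser a x s" "is_ser b y t"
      unfolding extend_def by blast
    have "a n \<in> PS K zs" for n unfolding H(2)[symmetric] using ab(1)[of n] by force
    then have "a n \<in> Z" for n using unique_expansion[OF Cons.prems(1) _ ab(2) st(2)] by blast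
    then have "b n \<in> Z" for n using H(1) ab(1) unfolding lift_def by blast
    then show "t \<in> Z" using is_ser_in_ideal[OF ab(3) ys(3) ideal_Z] by blast
  qed
  moreover have "fst ` extend H x y = PS K (x # zs)" using fst_extend[OF ys(3)] H(2) by simp
  moreover have "snd ` extend H x y = PS F ys" using snd_extend[OF x] H(3) ys(1) by simp
  ultimately show ?case by blast
qed

theorem finite_lift_exists:
  "\<exists>H vs. lift H \<and> fst ` H = UNIV \<and> (\<forall>r. \<exists>t\<in>lspan (snd ` H) vs. r - t \<in> Z)"
proof -
  obtain F where F: "cr_subring F" "Z \<subseteq> F" "F \<subseteq> S" "F \<inter> A \<subseteq> Z" "\<And>s. s \<in> S \<Longrightarrow> \<exists>f\<in>F. s - f \<in> A"
    using coefficient_field_exists[OF field_ext_S residue_char equal_char] by auto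
  have F_M: "F \<inter> M \<subseteq> Z"
  proof
    fix f assume f: "f \<in> F \<inter> M"
    show "f \<in> Z"
    proof (rule ccontr)
      assume "f \<notin> Z"
      then have "f \<in> S" "f \<notin> A" using f F by auto
      then obtain g where "f * g - 1 \<in> Z" using field_ext_S unfolding field_ext_def by blast
      then have "f * g - 1 \<in> M" using Z_subset_M by blast
      moreover have "f * g \<in> M" using f ideal_mult_right[OF ideal_M] by blast
      ultimately have "f * g - (f * g - 1) \<in> M" by (blast intro: ideal_diff[OF ideal_M])
      then show False using one_notin_M by simp
    qed
  qed
  have K_F: "\<exists>f\<in>F. (c, f) \<in> \<Phi>" if "c \<in> K" for c
  proof -
    obtain t where t: "(c, t) \<in> \<Phi>" using total_\<Phi> by blast
    then have "t \<in> S" using that unfolding S_def by blast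
    then obtain f where "f \<in> F" "t - f \<in> A" using F(5) by blast
    then show ?thesis using \<Phi>_cong[OF t, of c f] ideal_zero[OF ideal_A] by auto
  qed
  \<comment> \<open>\<open>F\<close> is a copy of the field phi(K) inside the ring, so
    \<open>H0\<close> is the lift of phi on \<open>K\<close>; it is single-valued because
    \<open>F \<inter> A \<subseteq> Z\<close>.\<close>
  define H0 where "H0 = {(c, f). c \<in> K \<and> f \<in> F \<and> (c, f) \<in> \<Phi>}"
  have "lift H0"
    unfolding lift_def pair_subring_def H0_def
    using subring_one[OF subring_K] subring_one[OF F(1)] pair_one[OF pair_\<Phi>] F(4) Z_A A_\<Phi>
    by (auto intro: subring_diff[OF subring_K] subring_diff[OF F(1)] pair_diff[OF pair_\<Phi>]
        subring_mult[OF subring_K] subring_mult[OF F(1)] pair_mult[OF pair_\<Phi>])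
  moreover have "fst ` H0 = K" unfolding H0_def using K_F by force
  moreover have "snd ` H0 = F" unfolding H0_def using F(3) unfolding S_def by force
  ultimately have H0: "lift H0" "fst ` H0 = K" "snd ` H0 = F" by auto

  obtain y where y: "\<And>x. (x, y x) \<in> \<Phi>" using total_\<Phi> by metis
  define ys where "ys = map y xs"
  have ys_M: "set ys \<subseteq> M" unfolding ys_def using \<Phi>_local[OF y] xs_M by auto
  obtain us where us: "\<And>r. \<exists>t\<in>lspan (snd ` \<Phi>) us. r - t \<in> A" using finite_\<Phi> by blast
  \<comment> \<open>The preimage \<open>P\<close> of \<open>Q\<close> under phi contains
    \<open>xs\<close>, hence \<open>M\<close>. Modulo \<open>Q\<close> the image of phi therefore
    reduces to that of \<open>K\<close>, which \<open>F\<close> represents, and generators over the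
    image of phi serve over \<open>F\<close>. This is applied to primes over \<open>A\<close> and
    \<open>ys\<close>, and to \<open>Q = M\<close>.\<close>
  have gen: "\<exists>t\<in>lspan F us. r - t \<in> Q" if Q: "cr_ideal Q" "A \<subseteq> Q" "set ys \<subseteq> Q" for Q r
  proof -
    have ZQ: "Z \<subseteq> Q" using Z_A Q(2) by blast
    define P where "P = {m. \<exists>q\<in>Q. (m, q) \<in> \<Phi>}"
    have "cr_ideal P"
      unfolding cr_ideal_def
    proof (intro conjI ballI allI)
      show "0 \<in> P" unfolding P_def using pair_zero[OF pair_\<Phi>] ideal_zero[OF Q(1)] by blast
    next
      fix m n assume "m \<in> P" "n \<in> P"
      then obtain q q' where "q \<in> Q" "(m, q) \<in> \<Phi>" "q' \<in> Q" "(n, q') \<in> \<Phi>" unfolding P_def by blast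
      then show "m + n \<in> P" unfolding P_def using pair_add[OF pair_\<Phi>] ideal_add[OF Q(1)] by blast
    next
      fix c m assume "m \<in> P"
      then obtain q where q: "q \<in> Q" "(m, q) \<in> \<Phi>" unfolding P_def by blast
      have "(c * m, y c * q) \<in> \<Phi>" by (rule pair_mult[OF pair_\<Phi> y q(2)])
      then show "c * m \<in> P" unfolding P_def using ideal_mult_left[OF Q(1) q(1)] by blast
    qed
    moreover have "Z \<subseteq> P" unfolding P_def using Z_A A_\<Phi> ideal_zero[OF ideal_A] ideal_zero[OF Q(1)] by blast
    moreover have "set xs \<subseteq> P" unfolding P_def using y Q(3) unfolding ys_def by auto
    ultimately have MP: "M \<subseteq> P" by (rule prime_superset_M)
    have "\<exists>f\<in>F. b - f \<in> Q" if b: "b \<in> snd ` \<Phi>" for b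
    proof -
      obtain s where s: "(s, b) \<in> \<Phi>" using b by force
      obtain c where c: "c \<in> K" "s - c \<in> M" using residue by blast
      obtain f where f: "f \<in> F" "(c, f) \<in> \<Phi>" using K_F c(1) by blast
      obtain q where q: "q \<in> Q" "(s - c, q) \<in> \<Phi>" using c(2) MP unfolding P_def by blast
      have "(b - f) - q \<in> A"
        using \<Phi>_unique[OF pair_diff[OF pair_\<Phi> s f(2)] q(2)] ideal_zero[OF ideal_A] by simp
      then have "b - f \<in> Q" using Q(2) q(1) ideal_mem_cong[OF Q(1)] by blast
      then show ?thesis using f(1) by blast
    qed
    note cong = lspan_cong[OF Q(1) ZQ this]
    obtain t where t: "t \<in> lspan (snd ` \<Phi>) us" "r - t \<in> A" using us by blast
    then obtain t' where "t' \<in> lspan F us" "t - t' \<in> Q" using cong by blast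
    then show ?thesis using t(2) Q(2) ideal_diff_trans[OF Q(1)] by blast
  qed
  \<comment> \<open>Modulo such a prime the ring is finite over the field \<open>F\<close>. An
    element of \<open>M\<close> outside \<open>Q\<close> would have a nonzero element of
    \<open>F\<close>, thus a unit, among its multiples modulo \<open>Q\<close>.\<close>
  have "M \<subseteq> Q" if Q: "cr_prime Q" "Z \<subseteq> Q" "A \<union> set ys \<subseteq> Q" for Q
  proof
    fix z assume z: "z \<in> M"
    show "z \<in> Q"
    proof (rule ccontr)
      assume "z \<notin> Q"
      then obtain a h where a: "a \<in> F" "a \<notin> Q" "a + z * h \<in> Q"
        using integral_relation[OF F(1) Q(1,2) _ gen[OF prime_ideal[OF Q(1)]]] Q(3) by blast
      have "(a + z * h) - z * h \<in> M"
        using a(3) prime_subset_M[OF Q(1,2)] z by (intro ideal_diff[OF ideal_M _ ideal_mult_right[OF ideal_M]]) auto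
      then have "a \<in> Z" using a(1) F_M by auto
      then show False using a(2) Q(2) by blast
    qed
  qed
  then have "mprim (A \<union> set ys)" unfolding mprim_def by blast
  then obtain ys' where ys': "list_all2 (\<lambda>y y'. y' - y \<in> A) ys ys'" "mprim (set ys')"
    using mprim_in_cosets[OF ideal_A ys_M] unfolding ys_def by auto
  have xy: "list_all2 (\<lambda>x y'. (x, y') \<in> \<Phi> \<and> y' \<in> M) xs ys'"
    unfolding list_all2_conv_all_nth
  proof (intro conjI allI impI)
    show len: "length xs = length ys'" using list_all2_lengthD[OF ys'(1)] unfolding ys_def by simp
    fix i assume i: "i < length xs"
    have "ys' ! i - y (xs ! i) \<in> A" using list_all2_nthD[OF ys'(1), of i] i unfolding ys_def by simp
    then have "y (xs ! i) - ys' ! i \<in> A" using ideal_diff_commute[OF ideal_A] by blast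
    then show *: "(xs ! i, ys' ! i) \<in> \<Phi>" using \<Phi>_cong[OF y, of "xs ! i" "xs ! i"] ideal_zero[OF ideal_A] by simp
    show "ys' ! i \<in> M" using \<Phi>_local[OF *] xs_M nth_mem[OF i] by blast
  qed
  then have ys'_M: "set ys' \<subseteq> M" by (auto simp: list_all2_conv_all_nth in_set_conv_nth)
  obtain H where H: "lift H" "fst ` H = PS K xs" "snd ` H = PS F ys'"
    using lift_exists[OF H0, of "[]" xs ys'] xy by auto
  \<comment> \<open>Finiteness of the lift: its image is \<open>PS F ys'\<close>, where
    \<open>ys'\<close> generates an \<open>M\<close>-primary ideal, and modulo \<open>M\<close> the
    ring is spanned over \<open>F\<close> by \<open>us\<close>.\<close>
  obtain vs where "\<forall>r. \<exists>t\<in>lspan (PS F ys') vs. r - t \<in> Z"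
    using lspan_PS_generates_mprim[OF ideal_Z subset_refl ys'_M mprim_mono[OF ys'(2)] gen[OF ideal_M A_M ys_M]] by auto
  then show ?thesis using H PS_eq_UNIV by (intro exI[of _ H] exI[of _ vs]) simp
qed

end

theorem (in complete_noetherian_mod) finite_lift:
  assumes xs: "set xs \<subseteq> M" "M \<subseteq> adjoins Z xs" and dim: "\<exists>P. pchain (length xs) P \<and> Z \<subseteq> P"
    and residue_char: "\<And>n. 0 < n \<Longrightarrow> of_nat n \<in> M \<Longrightarrow> Factorial_Ring.prime p \<and> p \<le> n"
    and equal_char: "Factorial_Ring.prime p \<Longrightarrow> of_nat p \<in> Z"
    and A: "cr_ideal A" "Z \<subseteq> A" "A \<subseteq> M"
    and \<Phi>: "pair_subring \<Phi>" "\<And>s. \<exists>t. (s, t) \<in> \<Phi>" "\<And>s t. s \<in> A \<Longrightarrow> (s, t) \<in> \<Phi> \<longleftrightarrow> t \<in> A"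
      "\<exists>us. \<forall>r. \<exists>t\<in>lspan (snd ` \<Phi>) us. r - t \<in> A"
  shows "\<exists>H vs. pair_subring H \<and> H \<subseteq> \<Phi> \<and> (\<forall>s t. (s, t) \<in> H \<longrightarrow> s \<in> Z \<longrightarrow> t \<in> Z)
    \<and> fst ` H = UNIV \<and> (\<forall>r. \<exists>t\<in>lspan (snd ` H) vs. r - t \<in> Z)"
proof -
  \<comment> \<open>For the whole ring and \<open>M\<close>, the construction that later handles the
    preimage of phi(K) yields the coefficient field \<open>K\<close>.\<close>
  have "field_ext UNIV M"
    unfolding field_ext_def using ideal_M Z_subset_M inverse_mod by (auto simp: cr_subring_def)
  then obtain K where K: "cr_subring K" "Z \<subseteq> K" "K \<inter> M \<subseteq> Z" "\<And>r. \<exists>c\<in>K. r - c \<in> M"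
    using coefficient_field_exists[OF _ residue_char equal_char, of UNIV M] by auto
  interpret lifting_problem Z M K xs A \<Phi> p
    by unfold_locales (fact K xs dim residue_char equal_char A \<Phi>)+
  show ?thesis using finite_lift_exists unfolding lift_def by auto
qed

section \<open>Commutative rings as quotients of a type-class ring\<close>

text \<open>The product of \<open>\<int>\<close> and of all commutative rings with carrier in \<open>'a\<close>: a type of class
  \<open>comm_ring_1\<close> that projects onto each of them. The factor \<open>\<int>\<close> only serves to make it nonzero.\<close>

typedef ('a, 'b) ring_section = "{s :: int \<times> (('a, 'b) ring_scheme \<Rightarrow> 'a).
    \<forall>R. (cring R \<longrightarrow> snd s R \<in> carrier R) \<and> (\<not> cring R \<longrightarrow> snd s R = undefined)}"
proof -
  have "(0, \<lambda>R. if cring R then \<zero>\<^bsub>R\<^esub> else undefined) \<in>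
      {s :: int \<times> (('a, 'b) ring_scheme \<Rightarrow> 'a).
        \<forall>R. (cring R \<longrightarrow> snd s R \<in> carrier R) \<and> (\<not> cring R \<longrightarrow> snd s R = undefined)}"
    by (simp add: cring.cring_simprules)
  then show ?thesis by blast
qed

setup_lifting type_definition_ring_section

instantiation ring_section :: (type, type) comm_ring_1
begin

lift_definition zero_ring_section :: "('a, 'b) ring_section" is "(0, \<lambda>R. if cring R then \<zero>\<^bsub>R\<^esub> else undefined)"
  by (simp add: cring.cring_simprules)

lift_definition one_ring_section :: "('a, 'b) ring_section" is "(1, \<lambda>R. if cring R then \<one>\<^bsub>R\<^esub> else undefined)"
  by (simp add: cring.cring_simprules)

lift_definition plus_ring_section :: "('a, 'b) ring_section \<Rightarrow> ('a, 'b) ring_section \<Rightarrow> ('a, 'b) ring_section" is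
  "\<lambda>s t. (fst s + fst t, \<lambda>R. if cring R then snd s R \<oplus>\<^bsub>R\<^esub> snd t R else undefined)"
  by (simp add: cring.cring_simprules)

lift_definition times_ring_section :: "('a, 'b) ring_section \<Rightarrow> ('a, 'b) ring_section \<Rightarrow> ('a, 'b) ring_section" is
  "\<lambda>s t. (fst s * fst t, \<lambda>R. if cring R then snd s R \<otimes>\<^bsub>R\<^esub> snd t R else undefined)"
  by (simp add: cring.cring_simprules)

lift_definition uminus_ring_section :: "('a, 'b) ring_section \<Rightarrow> ('a, 'b) ring_section" is
  "\<lambda>s. (- fst s, \<lambda>R. if cring R then \<ominus>\<^bsub>R\<^esub> snd s R else undefined)"
  by (simp add: cring.cring_simprules)

lift_definition minus_ring_section :: "('a, 'b) ring_section \<Rightarrow> ('a, 'b) ring_section \<Rightarrow> ('a, 'b) ring_section" is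
  "\<lambda>s t. (fst s - fst t, \<lambda>R. if cring R then snd s R \<ominus>\<^bsub>R\<^esub> snd t R else undefined)"
  by (simp add: cring.cring_simprules)

instance
proof
  fix a b c :: "('a, 'b) ring_section"
  show "a * b * c = a * (b * c)"
    by transfer (simp add: prod_eq_iff fun_eq_iff cring.cring_simprules)
  show "a * b = b * a"
    by transfer (simp add: prod_eq_iff fun_eq_iff cring.cring_simprules)
  show "1 * a = a"
    by transfer (simp add: prod_eq_iff fun_eq_iff cring.cring_simprules)
  show "a + b + c = a + (b + c)"
    by transfer (simp add: prod_eq_iff fun_eq_iff cring.cring_simprules)
  show "a + b = b + a"
    by transfer (simp add: prod_eq_iff fun_eq_iff cring.cring_simprules)
  show "0 + a = a"
    by transfer (simp add: prod_eq_iff fun_eq_iff cring.cring_simprules)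
  show "- a + a = 0"
    by transfer (simp add: prod_eq_iff fun_eq_iff cring.cring_simprules)
  show "a - b = a + - b"
    by transfer (simp add: prod_eq_iff fun_eq_iff a_minus_def)
  show "(a + b) * c = a * c + b * c"
    by transfer (simp add: prod_eq_iff fun_eq_iff cring.cring_simprules distrib_right)
  show "(0 :: ('a, 'b) ring_section) \<noteq> 1"
    by transfer simp
qed

end

section \<open>Evaluation at one ring, and ideals along it\<close>

lift_definition ev :: "('a, 'b) ring_scheme \<Rightarrow> ('a, 'b) ring_section \<Rightarrow> 'a" is "\<lambda>R s. snd s R" .

context cring
begin

lemma ev_closed [simp]: "ev R s \<in> carrier R"
  using is_cring by transfer simp

lemma ev_zero [simp]: "ev R 0 = \<zero>"
  and ev_one [simp]: "ev R 1 = \<one>"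
  and ev_add [simp]: "ev R (s + t) = ev R s \<oplus> ev R t"
  and ev_mult [simp]: "ev R (s * t) = ev R s \<otimes> ev R t"
  and ev_uminus [simp]: "ev R (- s) = \<ominus> ev R s"
  and ev_diff [simp]: "ev R (s - t) = ev R s \<ominus> ev R t"
  using is_cring by (transfer; simp)+

lemma ev_surj: assumes "x \<in> carrier R" shows "\<exists>s. ev R s = x"
proof -
  have "\<exists>s \<in> {s :: int \<times> (('a, 'b) ring_scheme \<Rightarrow> 'a). \<forall>S. (cring S \<longrightarrow> snd s S \<in> carrier S) \<and> (\<not> cring S \<longrightarrow> snd s S = undefined)}. snd s R = x"
    by (rule bexI[of _ "(0, \<lambda>S. if S = R then x else if cring S then \<zero>\<^bsub>S\<^esub> else undefined)"])
      (use assms is_cring in \<open>auto simp: cring.cring_simprules\<close>)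
  then show ?thesis by transfer blast
qed

definition ker_ev :: "('a, 'b) ring_section set" where "ker_ev = {s. ev R s = \<zero>}"

lemma diff_in_ker_ev: "s - t \<in> ker_ev \<longleftrightarrow> ev R s = ev R t"
  unfolding ker_ev_def by (simp add: r_right_minus_eq)

lemma ideal_vimage_ev:
  assumes "ideal I R" shows "cr_ideal {s. ev R s \<in> I}"
proof -
  interpret I: ideal I R by fact
  show ?thesis unfolding cr_ideal_def by (simp add: I.I_l_closed)
qed

lemma ker_ev_subset_vimage:
  assumes "ideal I R" shows "ker_ev \<subseteq> {s. ev R s \<in> I}"
  unfolding ker_ev_def using additive_subgroup.zero_closed[OF ideal.axioms(1)[OF assms]] by auto

lemma prime_vimage_ev:
  assumes "primeideal I R" shows "cr_prime {s. ev R s \<in> I}"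
proof -
  interpret I: primeideal I R by fact
  show ?thesis
    unfolding cr_prime_def
    using ideal_vimage_ev[OF I.is_ideal] I.I_prime I.one_imp_carrier I.I_notcarr by auto
qed

lemma ideal_ker_ev: "cr_ideal ker_ev"
  using ideal_vimage_ev[OF zeroideal] unfolding ker_ev_def by simp

lemma ideal_image_ev:
  assumes J: "cr_ideal J" shows "ideal (ev R ` J) R"
proof (rule idealI[OF ring_axioms])
  show "subgroup (ev R ` J) (add_monoid R)"
  proof (rule group.subgroupI[OF a_group])
    show "ev R ` J \<subseteq> carrier (add_monoid R)" by auto
    show "ev R ` J \<noteq> {}" using ideal_zero[OF J] by blast
    fix a assume "a \<in> ev R ` J"
    then obtain s where s: "s \<in> J" "a = ev R s" by blast
    have "\<ominus> a = ev R (- s)" using s(2) by simp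
    then have "\<ominus> a \<in> ev R ` J" using ideal_uminus[OF J s(1)] by blast
    then show "inv\<^bsub>add_monoid R\<^esub> a \<in> ev R ` J" by (simp add: a_inv_def)
    fix b assume "b \<in> ev R ` J"
    then obtain t where "t \<in> J" "b = ev R t" by blast
    then show "a \<otimes>\<^bsub>add_monoid R\<^esub> b \<in> ev R ` J" using s ideal_add[OF J s(1)] by (metis (no_types) ev_add image_eqI monoid.select_convs(1))
  qed
next
  fix a x assume "a \<in> ev R ` J" "x \<in> carrier R"
  then obtain s t where st: "s \<in> J" "a = ev R s" "x = ev R t" using ev_surj by blast
  show "x \<otimes> a \<in> ev R ` J" unfolding st using ideal_mult_left[OF J st(1), of t] by (metis ev_mult image_eqI)
  show "a \<otimes> x \<in> ev R ` J" unfolding st using ideal_mult_right[OF J st(1), of t] by (metis ev_mult image_eqI)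
qed

lemma ev_in_image:
  assumes "cr_ideal J" "ker_ev \<subseteq> J" shows "ev R s \<in> ev R ` J \<longleftrightarrow> s \<in> J"
proof
  assume "ev R s \<in> ev R ` J"
  then obtain t where "t \<in> J" "ev R s = ev R t" by blast
  then show "s \<in> J" using ideal_mem_cong[OF assms(1)] assms(2) diff_in_ker_ev by blast
qed simp

lemma ev_of_nat: "ev R (of_nat n) = [n] \<cdot> \<one>"
  by (induction n) (simp_all add: add.nat_pow_Suc a_comm)

end

section \<open>Noetherian, local and complete rings under evaluation\<close>

lemma (in noetherian_ring) maximal_ideal_ring_section:
  assumes R: "cring R" and ne: "\<J> \<noteq> {}" and sub: "\<J> \<subseteq> {J. cr_ideal J \<and> cring.ker_ev R \<subseteq> J}"
  shows "\<exists>J\<in>\<J>. \<forall>J'\<in>\<J>. J \<subseteq> J' \<longrightarrow> J' = J"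
proof (rule subset_Zorn_nonempty[OF ne])
  interpret R: cring R by fact
  fix \<C> assume C: "\<C> \<noteq> {}" "subset.chain \<J> \<C>"
  have J: "cr_ideal J" "R.ker_ev \<subseteq> J" if "J \<in> \<C>" for J
    using C(2) sub that unfolding subset.chain_def by auto
  have "subset.chain {I. ideal I R} ((\<lambda>J. ev R ` J) ` \<C>)"
    unfolding subset_chain_def
  proof (intro conjI ballI)
    show "(\<lambda>J. ev R ` J) ` \<C> \<subseteq> {I. ideal I R}" using J R.ideal_image_ev by blast
    fix I I' assume "I \<in> (\<lambda>J. ev R ` J) ` \<C>" "I' \<in> (\<lambda>J. ev R ` J) ` \<C>"
    then obtain J J' where JJ: "J \<in> \<C>" "J' \<in> \<C>" "I = ev R ` J" "I' = ev R ` J'" by blast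
    then have "J \<subseteq> J' \<or> J' \<subseteq> J" using C(2) unfolding subset_chain_def by blast
    then show "I \<subseteq> I' \<or> I' \<subseteq> I" using JJ by blast
  qed
  then have "\<Union>((\<lambda>J. ev R ` J) ` \<C>) \<in> (\<lambda>J. ev R ` J) ` \<C>"
    using C(1) by (intro ideal_chain_is_trivial) auto
  then obtain J where "J \<in> \<C>" and U: "\<Union>((\<lambda>J. ev R ` J) ` \<C>) = ev R ` J" by blast
  have "\<Union>\<C> \<subseteq> J"
  proof
    fix s assume "s \<in> \<Union>\<C>"
    then have "ev R s \<in> ev R ` J" using U by blast
    then show "s \<in> J" using R.ev_in_image J[OF \<open>J \<in> \<C>\<close>] by blast
  qed
  then have "\<Union>\<C> = J" using \<open>J \<in> \<C>\<close> by blast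
  then show "\<Union>\<C> \<in> \<J>" using \<open>J \<in> \<C>\<close> C(2) unfolding subset.chain_def by blast
qed

text \<open>Inverses come from uniqueness of the maximal ideal. If \<open>x\<close> had none, some
  ideal would be maximal among the proper ones containing \<open>x\<close>; its image is a maximal
  ideal of \<open>R\<close>, hence \<open>\<mm>\<close>, and contains \<open>ev R x\<close>.\<close>

lemma local_noetherian_ring_section:
  assumes "local_ring R \<mm>" "noetherian_ring R"
  shows "local_noetherian_mod (cring.ker_ev R) {s. ev R s \<in> \<mm>}"
proof -
  interpret R: local_ring R \<mm> by fact
  interpret m: maximalideal \<mm> R by (rule R.maximal)
  let ?M = "{s. ev R s \<in> \<mm>}"
  note max = noetherian_ring.maximal_ideal_ring_section[OF assms(2) R.is_cring]
  show ?thesis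
  proof
    show "cr_ideal R.ker_ev" by (rule R.ideal_ker_ev)
    show "cr_ideal ?M" by (rule R.ideal_vimage_ev[OF m.is_ideal])
    show "R.ker_ev \<subseteq> ?M" by (rule R.ker_ev_subset_vimage[OF m.is_ideal])
    show "1 \<notin> ?M" using m.one_imp_carrier m.I_notcarr by auto
  next
    fix \<J> :: "('a, 'b) ring_section set set"
    assume "\<J> \<noteq> {}" "\<J> \<subseteq> {J. cr_ideal J \<and> R.ker_ev \<subseteq> J}"
    then show "\<exists>J\<in>\<J>. \<forall>J'\<in>\<J>. J \<subseteq> J' \<longrightarrow> J' = J" by (rule max)
  next
    fix x :: "('a, 'b) ring_section" assume x: "x \<notin> ?M"
    show "\<exists>y. x * y - 1 \<in> R.ker_ev"
    proof (rule ccontr)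
      assume no: "\<nexists>y. x * y - 1 \<in> R.ker_ev"
      let ?F = "{J. cr_ideal J \<and> R.ker_ev \<subseteq> J \<and> x \<in> J \<and> 1 \<notin> J}"
      have "1 \<notin> adjoin R.ker_ev x"
      proof
        assume "1 \<in> adjoin R.ker_ev x"
        then obtain j r where "j \<in> R.ker_ev" "1 = j + x * r" unfolding adjoin_def by blast
        then have "x * r - 1 = - j" by (simp add: algebra_simps)
        then have "x * r - 1 \<in> R.ker_ev" using ideal_uminus[OF R.ideal_ker_ev \<open>j \<in> R.ker_ev\<close>] by simp
        with no show False by blast
      qed
      then have "adjoin R.ker_ev x \<in> ?F"
        using adjoin_ideal[OF R.ideal_ker_ev] adjoin_superset[of R.ker_ev x] adjoin_self[OF R.ideal_ker_ev] by blast
      then have "\<exists>J\<in>?F. \<forall>J'\<in>?F. J \<subseteq> J' \<longrightarrow> J' = J" by (intro max) auto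
      then obtain J where J: "J \<in> ?F" and mx: "\<forall>J'\<in>?F. J \<subseteq> J' \<longrightarrow> J' = J" by (rule bexE)
      then have Ji: "cr_ideal J" "R.ker_ev \<subseteq> J" by auto
      have "maximalideal (ev R ` J) R"
      proof (rule maximalidealI)
        show "ideal (ev R ` J) R" by (rule R.ideal_image_ev[OF Ji(1)])
        have "\<one>\<^bsub>R\<^esub> \<notin> ev R ` J" using R.ev_in_image[OF Ji, of 1] J by simp
        then show "carrier R \<noteq> ev R ` J" by blast
        fix I assume I: "ideal I R" "ev R ` J \<subseteq> I" "I \<subseteq> carrier R"
        let ?I = "{s. ev R s \<in> I}"
        show "I = ev R ` J \<or> I = carrier R"
        proof (cases "1 \<in> ?I")
          case True
          then show ?thesis using ideal.one_imp_carrier[OF I(1)] by simp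
        next
          case False
          have JI: "J \<subseteq> ?I" using I(2) by blast
          have "x \<in> ?I" using JI J by blast
          then have "?I \<in> ?F"
            using R.ideal_vimage_ev[OF I(1)] R.ker_ev_subset_vimage[OF I(1)] False by simp
          then have "?I = J" using bspec[OF mx] JI by simp
          then have "I \<subseteq> ev R ` J" using R.ev_surj I(3) by blast
          then show ?thesis using I(2) by blast
        qed
      qed
      then have "ev R ` J = \<mm>" by (rule R.unique_maximal)
      then show False using J x by blast
    qed
  qed
qed

lemma complete_noetherian_ring_section:
  assumes "complete_local_ring R \<mm>" "noetherian_ring R"
  shows "complete_noetherian_mod (cring.ker_ev R) {s. ev R s \<in> \<mm>}"
proof -
  interpret R: complete_local_ring R \<mm> by fact
  interpret m: maximalideal \<mm> R by (rule R.maximal)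
  let ?M = "{s. ev R s \<in> \<mm>}"
  interpret T: local_noetherian_mod R.ker_ev ?M
    by (rule local_noetherian_ring_section[OF R.local_ring_axioms assms(2)])
  define mp where "mp n = \<mm> [^]\<^bsub>ideals_set R\<^esub> n" for n :: nat
  have mp: "mp 0 = carrier R" "mp (Suc n) = mp n \<cdot>\<^bsub>R\<^esub> \<mm>" for n
    unfolding mp_def by (simp_all add: nat_pow_def ideals_set_def)
  have mp_ideal: "ideal (mp n) R" for n
    by (induction n) (simp_all add: mp R.oneideal R.ideal_prod_is_ideal m.is_ideal)
  have pw_mp: "T.pw n \<subseteq> {s. ev R s \<in> mp n}" for n
  proof (induction n)
    case 0
    then show ?case by (simp add: mp)
  next
    case (Suc n)
    show ?case
      unfolding T.pw.simps
    proof (rule ideal_gen_least[OF R.ideal_vimage_ev[OF mp_ideal]])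
      show "{a * b |a b. a \<in> T.pw n \<and> b \<in> ?M} \<union> R.ker_ev \<subseteq> {s. ev R s \<in> mp (Suc n)}"
        using subsetD[OF Suc] R.ker_ev_subset_vimage[OF mp_ideal[of "Suc n"]]
        by (auto simp: mp intro!: ideal_prod.prod)
    qed
  qed
  have mp_pw: "ev R s \<in> mp n \<Longrightarrow> s \<in> T.pw n" for n s
  proof (induction n arbitrary: s)
    case 0
    then show ?case by simp
  next
    case (Suc n)
    have "x \<in> mp n \<cdot>\<^bsub>R\<^esub> \<mm> \<Longrightarrow> ev R s = x \<Longrightarrow> s \<in> T.pw (Suc n)" for x s
    proof (induction x arbitrary: s rule: ideal_prod.induct)
      case (prod i j)
      then obtain si sj where ij: "ev R si = i" "ev R sj = j"
        using R.ev_surj ideal.Icarr[OF mp_ideal] m.Icarr by meson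
      have "si * sj \<in> T.pw (Suc n)" using Suc.IH prod ij by (intro T.pw_Suc_mult) auto
      moreover have "s - si * sj \<in> R.ker_ev" using prod ij by (simp add: R.diff_in_ker_ev)
      ultimately show ?case using ideal_mem_cong[OF T.pw_ideal] T.Z_subset_pw by blast
    next
      case (sum x y)
      have "x \<in> carrier R" "y \<in> carrier R"
        using sum.hyps R.ideal_prod_in_carrier[OF mp_ideal m.is_ideal] by auto
      then obtain sx sy where xy: "ev R sx = x" "ev R sy = y" using R.ev_surj by meson
      have "sx + sy \<in> T.pw (Suc n)" using sum.IH xy by (intro ideal_add[OF T.pw_ideal]) auto
      moreover have "s - (sx + sy) \<in> R.ker_ev" using sum.prems xy by (simp add: R.diff_in_ker_ev)
      ultimately show ?case using ideal_mem_cong[OF T.pw_ideal] T.Z_subset_pw by blast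
    qed
    then show ?case using Suc.prems unfolding mp by blast
  qed
  show ?thesis
  proof
    fix x assume "\<And>n. x \<in> T.pw n"
    then have "ev R x \<in> (\<Inter>n. mp n)" using pw_mp by blast
    then show "x \<in> R.ker_ev" using R.separated unfolding mp_def R.ker_ev_def by auto
  next
    fix x assume x: "\<And>n. x (Suc n) - x n \<in> T.pw n"
    have diff: "x j - x i \<in> T.pw k" if "k \<le> i" "i \<le> j" for i j k
      using \<open>i \<le> j\<close>
    proof (induction j rule: dec_induct)
      case base
      then show ?case using ideal_zero[OF T.pw_ideal] by simp
    next
      case (step j)
      have "x (Suc j) - x j \<in> T.pw k" using x[of j] T.pw_antimono[of k j] that step by auto
      then show ?case using step ideal_diff_trans[OF T.pw_ideal] by blast
    qed
    have "\<exists>l\<in>carrier R. \<forall>k. \<exists>N. \<forall>i\<ge>N. ev R (x i) \<ominus>\<^bsub>R\<^esub> l \<in> mp k"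
      unfolding mp_def
    proof (rule R.complete)
      fix k
      have "ev R (x i) \<ominus>\<^bsub>R\<^esub> ev R (x j) \<in> mp k" if "i \<ge> k" "j \<ge> k" for i j
      proof -
        have "x i - x j \<in> T.pw k"
          using diff[of k j i] diff[of k i j] that ideal_diff_commute[OF T.pw_ideal] by (cases "i \<le> j") auto
        then show ?thesis using pw_mp by fastforce
      qed
      then show "\<exists>N. \<forall>i\<ge>N. \<forall>j\<ge>N. ev R (x i) \<ominus>\<^bsub>R\<^esub> ev R (x j) \<in> \<mm> [^]\<^bsub>ideals_set R\<^esub> k"
        unfolding mp_def by blast
    qed simp
    then obtain l where l: "l \<in> carrier R" "\<And>k. \<exists>N. \<forall>i\<ge>N. ev R (x i) \<ominus>\<^bsub>R\<^esub> l \<in> mp k" by blast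
    obtain t where t: "ev R t = l" using R.ev_surj l(1) by blast
    \<comment> \<open>The limit in \<open>R\<close> comes without a rate. The rate of the sequence
      itself is used instead: \<open>x n\<close> is close to a term beyond \<open>N\<close>, and
      that term is close to the limit.\<close>
    have "x n - t \<in> T.pw n" for n
    proof -
      obtain N where N: "\<And>i. i \<ge> N \<Longrightarrow> ev R (x i) \<ominus>\<^bsub>R\<^esub> l \<in> mp n" using l(2) by blast
      have "x (max n N) - t \<in> T.pw n" by (rule mp_pw) (use N t in auto)
      moreover have "x n - x (max n N) \<in> T.pw n"
        using diff[of n n "max n N"] ideal_diff_commute[OF T.pw_ideal] by auto
      ultimately show ?thesis using ideal_diff_trans[OF T.pw_ideal] by blast
    qed
    then show "\<exists>l. \<forall>n. x n - l \<in> T.pw n" by blast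
  qed
qed

lemma (in cring) pchain_vimage_ev:
  assumes "\<forall>i\<le>n. primeideal (P i) R" "\<forall>i<n. P i \<subset> P (Suc i)"
  shows "pchain n {s. ev R s \<in> P 0}"
  using assms
proof (induction n arbitrary: P)
  case 0
  then show ?case using prime_vimage_ev by simp
next
  case (Suc n)
  have "pchain n {s. ev R s \<in> P (Suc 0)}"
    using Suc.IH[of "\<lambda>i. P (Suc i)"] Suc.prems by simp
  moreover have sub: "P 0 \<subset> P (Suc 0)" using Suc.prems by blast
  then obtain x where x: "x \<in> P (Suc 0)" "x \<notin> P 0" by blast
  have "primeideal (P (Suc 0)) R" using Suc.prems(1) by simp
  then have "x \<in> carrier R" using x(1) ideal.Icarr primeideal.axioms(1) by metis
  then obtain s where "ev R s = x" using ev_surj by blast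
  then have "{s. ev R s \<in> P 0} \<subset> {s. ev R s \<in> P (Suc 0)}" using sub x by blast
  moreover have "cr_prime {s. ev R s \<in> P 0}" using Suc.prems prime_vimage_ev by blast
  ultimately show ?case by auto
qed

text \<open>A finite supremum of a nonempty set of naturals is a maximum. The prime \<open>M\<close>
  provides a chain of length 0; without one, dimension 0 could be the supremum of the empty
  set.\<close>

lemma krull_dim_attained:
  assumes d: "krull_dim R = enat d" and M: "primeideal M R"
  shows "\<exists>P. (\<forall>i\<le>d. primeideal (P i) R) \<and> (\<forall>i<d. P i \<subset> P (Suc i))"
proof -
  let ?D = "{enat n | n (P :: nat \<Rightarrow> 'a set).
     (\<forall>i\<le>n. primeideal (P i) R) \<and> (\<forall>i<n. P i \<subset> P (Suc i))}"
  have "enat 0 \<in> ?D" using M by (auto intro!: exI[of _ 0] exI[of _ "\<lambda>_. M"])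
  then have ne: "?D \<noteq> {}" by blast
  have S: "Sup ?D = enat d" using d unfolding krull_dim_def .
  then have "finite ?D" using ne unfolding Sup_enat_def by (auto split: if_splits)
  then have "Max ?D \<in> ?D" using ne by (rule Max_in)
  moreover have "Sup ?D = Max ?D" unfolding Sup_enat_def if_not_P[OF ne] if_P[OF \<open>finite ?D\<close>] ..
  ultimately have "Sup ?D \<in> ?D" by simp
  then show ?thesis using S by auto
qed

section \<open>Cosets and equal characteristic\<close>

lemma zero_FactRing: "\<zero>\<^bsub>R Quot I\<^esub> = I"
  by (simp add: FactRing_def)

lemma (in ideal) coset_eq_iff:
  assumes "x \<in> carrier R" "y \<in> carrier R" shows "I +> x = I +> y \<longleftrightarrow> x \<ominus> y \<in> I"
  using quotient_eq_iff_same_a_r_cos[OF is_ideal assms] by blast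

lemma (in ideal) coset_zero: "I +> \<zero> = I"
  using a_rcos_zero[OF is_ideal] additive_subgroup.zero_closed[OF is_additive_subgroup] by blast

lemma (in ideal) coset_eq_ideal_iff:
  assumes "x \<in> carrier R" shows "I +> x = I \<longleftrightarrow> x \<in> I"
  using coset_eq_iff[OF assms zero_closed] assms coset_zero by (simp add: a_minus_def)

lemma (in cring) quot_add_pow_one:
  fixes n :: nat
  assumes "ideal I R" shows "[n] \<cdot>\<^bsub>R Quot I\<^esub> \<one>\<^bsub>R Quot I\<^esub> = I +> ([n] \<cdot> \<one>)"
proof -
  interpret I: ideal I R by fact
  interpret Q: cring "R Quot I" by (rule I.quotient_is_cring[OF is_cring])
  note h = I.rcos_ring_hom
  show ?thesis
  proof (induction n)
    case 0
    show ?case using I.coset_zero zero_FactRing[of R I] by simp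
  next
    case (Suc n)
    then show ?case
      using ring_hom_add[OF h, of "[n] \<cdot> \<one>" \<one>] ring_hom_one[OF h]
      by (simp add: add.nat_pow_Suc Q.add.nat_pow_Suc)
  qed
qed

text \<open>The number \<open>p\<close> asked for by the construction of coefficient fields is the
  characteristic. As that of the residue field it is the least positive integer in
  \<open>\<mm>\<close>, if there is one, and is then prime because \<open>\<mm>\<close> is; as that
  of \<open>R\<close> it vanishes in \<open>R\<close>.\<close>

lemma equicharacteristic_section:
  assumes "equicharacteristic_local_ring R \<mm>"
  shows "\<And>n. 0 < n \<Longrightarrow> ev R (of_nat n) \<in> \<mm> \<Longrightarrow> Factorial_Ring.prime (ring_char R) \<and> ring_char R \<le> n"
    and "Factorial_Ring.prime (ring_char R) \<Longrightarrow> ev R (of_nat (ring_char R)) = \<zero>\<^bsub>R\<^esub>"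
proof -
  interpret R: equicharacteristic_local_ring R \<mm> by fact
  interpret m: maximalideal \<mm> R by (rule R.maximal)
  interpret m: primeideal \<mm> R by (rule R.maximalideal_prime[OF R.maximal])
  let ?p = "ring_char R"
  have Q: "[n] \<cdot>\<^bsub>R Quot \<mm>\<^esub> \<one>\<^bsub>R Quot \<mm>\<^esub> = \<zero>\<^bsub>R Quot \<mm>\<^esub> \<longleftrightarrow> ev R (of_nat n) \<in> \<mm>" for n :: nat
    unfolding R.quot_add_pow_one[OF m.is_ideal] R.ev_of_nat
    using m.coset_eq_ideal_iff by (simp add: zero_FactRing)
  have p_m: "?p = (if \<exists>n. 0 < n \<and> ev R (of_nat n) \<in> \<mm> then LEAST n. 0 < n \<and> ev R (of_nat n) \<in> \<mm> else 0)"
    by (subst R.equicharacteristic) (simp only: ring_char_def Q)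
  have p_R: "ev R (of_nat ?p) = \<zero>\<^bsub>R\<^esub>" if "0 < ?p"
  proof -
    have ex: "\<exists>n::nat. 0 < n \<and> [n] \<cdot>\<^bsub>R\<^esub> \<one>\<^bsub>R\<^esub> = \<zero>\<^bsub>R\<^esub>"
      using that unfolding ring_char_def by (auto split: if_splits)
    then have "?p = (LEAST n. 0 < n \<and> [n] \<cdot>\<^bsub>R\<^esub> \<one>\<^bsub>R\<^esub> = \<zero>\<^bsub>R\<^esub>)" unfolding ring_char_def by simp
    then show ?thesis using LeastI_ex[OF ex] by (simp add: R.ev_of_nat)
  qed
  show "Factorial_Ring.prime ?p \<Longrightarrow> ev R (of_nat ?p) = \<zero>\<^bsub>R\<^esub>"
    by (rule p_R) (rule prime_gt_0_nat)
  fix n :: nat assume n: "0 < n" "ev R (of_nat n) \<in> \<mm>"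
  have ex: "\<exists>n. 0 < n \<and> ev R (of_nat n) \<in> \<mm>" using n by blast
  then have p: "?p = (LEAST n. 0 < n \<and> ev R (of_nat n) \<in> \<mm>)" using p_m by simp
  have "0 < ?p \<and> ev R (of_nat ?p) \<in> \<mm>" unfolding p by (rule LeastI_ex[OF ex])
  then have pm: "0 < ?p" "ev R (of_nat ?p) \<in> \<mm>" by auto
  have least: "?p \<le> k" if "0 < k" "ev R (of_nat k) \<in> \<mm>" for k
    unfolding p by (rule Least_le) (use that in blast)
  have "?p \<noteq> 1" using pm(2) m.one_imp_carrier m.I_notcarr by auto
  then have "1 < ?p" using pm(1) by linarith
  moreover have "a = 1 \<or> a = ?p" if a: "a dvd ?p" for a
  proof -
    obtain b where b: "?p = a * b" using a ..
    then have ab: "0 < a" "0 < b" using pm(1) by auto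
    have "ev R (of_nat a) \<otimes>\<^bsub>R\<^esub> ev R (of_nat b) \<in> \<mm>" using pm(2) unfolding b by simp
    then have "ev R (of_nat a) \<in> \<mm> \<or> ev R (of_nat b) \<in> \<mm>" by (rule m.I_prime[OF R.ev_closed R.ev_closed])
    then have "?p \<le> a \<or> ?p \<le> b" using least ab by blast
    then show ?thesis using b ab by (auto simp: dvd_imp_le)
  qed
  ultimately show "Factorial_Ring.prime ?p \<and> ?p \<le> n" using least n by (auto simp: prime_nat_iff)
qed

theorem theorem2p1:
  fixes R :: "('a, 'b) ring_scheme" and \<mm> \<aa> :: "'a set" and \<phi> :: "'a set \<Rightarrow> 'a set"
  assumes "regular_local_ring R \<mm>"
    and "equicharacteristic_local_ring R \<mm>"
    and "complete_local_ring R \<mm>"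
    and "ideal \<aa> R" and "\<aa> \<noteq> carrier R"
    and "finite_self_map (R Quot \<aa>) \<phi>"
  shows "\<exists>\<psi>. finite_self_map R \<psi> \<and>
    (\<forall>x \<in> carrier R. \<aa> +>\<^bsub>R\<^esub> \<psi> x = \<phi> (\<aa> +>\<^bsub>R\<^esub> x))"
proof -
  interpret R: regular_local_ring R \<mm> by fact
  interpret m: maximalideal \<mm> R by (rule R.maximal)
  interpret a: ideal \<aa> R by fact
  let ?Q = "R Quot \<aa>" and ?M = "{s. ev R s \<in> \<mm>}" and ?A = "{s. ev R s \<in> \<aa>}"
  interpret T: complete_noetherian_mod R.ker_ev ?M
    by (rule complete_noetherian_ring_section[OF assms(3) R.noetherian_ring_axioms])
  interpret Q: cring ?Q by (rule a.quotient_is_cring[OF R.is_cring])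
  interpret pi: ring_hom_cring R ?Q "(+>\<^bsub>R\<^esub>) \<aa>" by (rule a.rcos_ring_hom_cring[OF R.is_cring])
  interpret phi: ring_hom_cring ?Q ?Q \<phi>
    using assms(6) unfolding finite_self_map_def
    by (intro ring_hom_cringI ring_hom_ringI2 Q.ring_axioms Q.is_cring) auto
  have coset: "\<exists>s. \<aa> +>\<^bsub>R\<^esub> ev R s = b" if "b \<in> carrier ?Q" for b
    using that R.ev_surj unfolding FactRing_simps by auto
  define \<Phi> where "\<Phi> = {(s, t). \<aa> +>\<^bsub>R\<^esub> ev R t = \<phi> (\<aa> +>\<^bsub>R\<^esub> ev R s)}"
  have total: "\<exists>t. (s, t) \<in> \<Phi>" for s
    using coset[of "\<phi> (\<aa> +>\<^bsub>R\<^esub> ev R s)"] unfolding \<Phi>_def by auto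

  obtain E where E: "E \<subseteq> carrier R" "finite E" "enat (card E) = krull_dim R" "\<mm> = Idl\<^bsub>R\<^esub> E"
    using R.regular by blast
  obtain es where es: "set es = E" "distinct es" using finite_distinct_list[OF E(2)] by blast
  have "\<exists>f. \<forall>x\<in>carrier R. ev R (f x) = x" using R.ev_surj by (intro bchoice) blast
  then obtain f where f: "\<And>x. x \<in> carrier R \<Longrightarrow> ev R (f x) = x" by blast
  define xs where "xs = map f es"
  have E_m: "E \<subseteq> \<mm>" unfolding E(4) by (rule R.genideal_self[OF E(1)])
  have xs_M: "set xs \<subseteq> ?M" unfolding xs_def using es(1) E(1) E_m f by auto
  have M_gen: "?M \<subseteq> adjoins R.ker_ev xs"
  proof
    fix s assume s: "s \<in> ?M"
    have J: "cr_ideal (adjoins R.ker_ev xs)" "R.ker_ev \<subseteq> adjoins R.ker_ev xs"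
      using adjoins_ideal[OF R.ideal_ker_ev] adjoins_superset by auto
    have "E \<subseteq> ev R ` adjoins R.ker_ev xs"
    proof
      fix x assume x: "x \<in> E"
      then have "f x \<in> adjoins R.ker_ev xs"
        using adjoins_self[OF R.ideal_ker_ev, of xs] es(1) unfolding xs_def by auto
      then show "x \<in> ev R ` adjoins R.ker_ev xs" using f[of x] E(1) x by force
    qed
    then have "\<mm> \<subseteq> ev R ` adjoins R.ker_ev xs"
      unfolding E(4) by (rule R.genideal_minimal[OF R.ideal_image_ev[OF J(1)]])
    then show "s \<in> adjoins R.ker_ev xs" using s R.ev_in_image[OF J] by blast
  qed
  have len: "length xs = card E" unfolding xs_def using es distinct_card by fastforce
  obtain P where P: "\<forall>i\<le>card E. primeideal (P i) R" "\<forall>i<card E. P i \<subset> P (Suc i)"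
    using krull_dim_attained[OF E(3)[symmetric] R.maximalideal_prime[OF R.maximal]] by blast
  then have "ideal (P 0) R" by (blast intro: primeideal.axioms(1))
  then have dim: "\<exists>P. pchain (length xs) P \<and> R.ker_ev \<subseteq> P"
    using R.pchain_vimage_ev[OF P] R.ker_ev_subset_vimage[of "P 0"] len
    by (intro exI[of _ "{s. ev R s \<in> P 0}"]) simp

  have A_M: "?A \<subseteq> ?M"
    using T.proper_ideal_subset_M[OF R.ideal_vimage_ev[OF assms(4)] R.ker_ev_subset_vimage[OF assms(4)]]
      a.one_imp_carrier assms(5) by auto
  have pair: "pair_subring \<Phi>"
    unfolding pair_subring_def \<Phi>_def by (simp add: a_minus_def)
  have A_\<Phi>: "(s, t) \<in> \<Phi> \<longleftrightarrow> t \<in> ?A" if "s \<in> ?A" for s t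
  proof -
    have zero: "\<zero>\<^bsub>?Q\<^esub> = \<aa>" by (rule zero_FactRing)
    have "\<aa> +>\<^bsub>R\<^esub> ev R s = \<zero>\<^bsub>?Q\<^esub>"
      unfolding zero using that a.coset_eq_ideal_iff[OF R.ev_closed] by blast
    then have "\<phi> (\<aa> +>\<^bsub>R\<^esub> ev R s) = \<zero>\<^bsub>?Q\<^esub>" by (metis phi.hom_zero)
    then have "(s, t) \<in> \<Phi> \<longleftrightarrow> \<aa> +>\<^bsub>R\<^esub> ev R t = \<aa>" unfolding \<Phi>_def zero by simp
    also have "\<dots> \<longleftrightarrow> t \<in> ?A" using a.coset_eq_ideal_iff[OF R.ev_closed] by blast
    finally show ?thesis .
  qed
  have fin: "\<exists>us. \<forall>r. \<exists>t\<in>T.lspan (snd ` \<Phi>) us. r - t \<in> ?A"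
  proof -
    obtain B where B: "B \<subseteq> carrier ?Q" "finite B"
      "\<forall>x \<in> carrier ?Q. \<exists>c \<in> B \<rightarrow> carrier ?Q. x = (\<Oplus>\<^bsub>?Q\<^esub>b\<in>B. \<phi> (c b) \<otimes>\<^bsub>?Q\<^esub> b)"
      using assms(6) unfolding finite_self_map_def by blast
    obtain bs where bs: "set bs = B" "distinct bs" using finite_distinct_list[OF B(2)] by blast
    have "\<exists>g. \<forall>b\<in>carrier ?Q. \<aa> +>\<^bsub>R\<^esub> ev R (g b) = b" using coset by (intro bchoice) blast
    then obtain g where g: "\<And>b. b \<in> carrier ?Q \<Longrightarrow> \<aa> +>\<^bsub>R\<^esub> ev R (g b) = b" by blast
    have span: "\<exists>t\<in>T.lspan (snd ` \<Phi>) (map g bs). \<aa> +>\<^bsub>R\<^esub> ev R t = (\<Oplus>\<^bsub>?Q\<^esub>b\<in>set bs. \<phi> (c b) \<otimes>\<^bsub>?Q\<^esub> b)"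
      if "distinct bs" "set bs \<subseteq> carrier ?Q" "c \<in> set bs \<rightarrow> carrier ?Q" for bs c
      using that
    proof (induction bs)
      case Nil
      then show ?case using ideal_zero[OF R.ideal_ker_ev] by (intro bexI[of _ 0]) auto
    next
      case (Cons b bs)
      obtain t where t: "t \<in> T.lspan (snd ` \<Phi>) (map g bs)"
        "\<aa> +>\<^bsub>R\<^esub> ev R t = (\<Oplus>\<^bsub>?Q\<^esub>b\<in>set bs. \<phi> (c b) \<otimes>\<^bsub>?Q\<^esub> b)"
        using Cons by auto
      have b: "b \<in> carrier ?Q" "c b \<in> carrier ?Q" using Cons.prems by auto
      obtain s where s: "\<aa> +>\<^bsub>R\<^esub> ev R s = c b" using coset[OF b(2)] by blast
      obtain h where h: "(s, h) \<in> \<Phi>" using total by blast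
      then have "h \<in> snd ` \<Phi>" by force
      then have "h * g b + t \<in> T.lspan (snd ` \<Phi>) (map g (b # bs))" using t(1) by auto
      moreover have "(\<lambda>b. \<phi> (c b) \<otimes>\<^bsub>?Q\<^esub> b) \<in> set bs \<rightarrow> carrier ?Q" using Cons.prems by auto
      then have "(\<Oplus>\<^bsub>?Q\<^esub>b\<in>set (b # bs). \<phi> (c b) \<otimes>\<^bsub>?Q\<^esub> b) = \<phi> (c b) \<otimes>\<^bsub>?Q\<^esub> b \<oplus>\<^bsub>?Q\<^esub> (\<Oplus>\<^bsub>?Q\<^esub>b\<in>set bs. \<phi> (c b) \<otimes>\<^bsub>?Q\<^esub> b)"
        using Cons.prems(1) b by (simp add: Q.finsum_insert)
      then have "\<aa> +>\<^bsub>R\<^esub> ev R (h * g b + t) = (\<Oplus>\<^bsub>?Q\<^esub>b\<in>set (b # bs). \<phi> (c b) \<otimes>\<^bsub>?Q\<^esub> b)"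
        using t(2) g[OF b(1)] h s unfolding \<Phi>_def by simp
      ultimately show ?case by blast
    qed
    have "\<exists>t\<in>T.lspan (snd ` \<Phi>) (map g bs). r - t \<in> ?A" for r
    proof -
      have "\<aa> +>\<^bsub>R\<^esub> ev R r \<in> carrier ?Q" by simp
      then obtain c where c: "c \<in> B \<rightarrow> carrier ?Q" "\<aa> +>\<^bsub>R\<^esub> ev R r = (\<Oplus>\<^bsub>?Q\<^esub>b\<in>B. \<phi> (c b) \<otimes>\<^bsub>?Q\<^esub> b)"
        using B(3) by blast
      obtain t where t: "t \<in> T.lspan (snd ` \<Phi>) (map g bs)"
        "\<aa> +>\<^bsub>R\<^esub> ev R t = (\<Oplus>\<^bsub>?Q\<^esub>b\<in>B. \<phi> (c b) \<otimes>\<^bsub>?Q\<^esub> b)"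
        using span[OF bs(2), unfolded bs(1), OF B(1) c(1)] by (rule bexE)
      have "\<aa> +>\<^bsub>R\<^esub> ev R r = \<aa> +>\<^bsub>R\<^esub> ev R t" using c(2) t(2) by (rule trans[OF _ sym])
      then have "ev R (r - t) \<in> \<aa>" unfolding R.ev_diff a.coset_eq_iff[OF R.ev_closed R.ev_closed] .
      then show ?thesis using t(1) by blast
    qed
    then show ?thesis by blast
  qed

  note char = equicharacteristic_section[OF assms(2)]
  obtain H vs where H: "pair_subring H" "H \<subseteq> \<Phi>" "\<And>s t. (s, t) \<in> H \<Longrightarrow> s \<in> R.ker_ev \<Longrightarrow> t \<in> R.ker_ev"
    "fst ` H = UNIV" "\<And>r. \<exists>t\<in>T.lspan (snd ` H) vs. r - t \<in> R.ker_ev"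
  proof -
    have "0 < n \<Longrightarrow> of_nat n \<in> ?M \<Longrightarrow> Factorial_Ring.prime (ring_char R) \<and> ring_char R \<le> n" for n
      using char(1)[of n] by blast
    moreover have "Factorial_Ring.prime (ring_char R) \<Longrightarrow> of_nat (ring_char R) \<in> R.ker_ev"
      unfolding R.ker_ev_def using char(2) by blast
    ultimately have "\<exists>H vs. pair_subring H \<and> H \<subseteq> \<Phi> \<and> (\<forall>s t. (s, t) \<in> H \<longrightarrow> s \<in> R.ker_ev \<longrightarrow> t \<in> R.ker_ev)
      \<and> fst ` H = UNIV \<and> (\<forall>r. \<exists>t\<in>T.lspan (snd ` H) vs. r - t \<in> R.ker_ev)"
      by (rule T.finite_lift[OF xs_M M_gen dim _ _ R.ideal_vimage_ev[OF assms(4)]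
        R.ker_ev_subset_vimage[OF assms(4)] A_M pair total A_\<Phi> fin])
    then obtain H vs where "pair_subring H" "H \<subseteq> \<Phi>" "\<forall>s t. (s, t) \<in> H \<longrightarrow> s \<in> R.ker_ev \<longrightarrow> t \<in> R.ker_ev"
      "fst ` H = UNIV" "\<forall>r. \<exists>t\<in>T.lspan (snd ` H) vs. r - t \<in> R.ker_ev"
      by (elim exE conjE)
    then show ?thesis by (intro that[of H vs]) simp_all
  qed

  define \<psi> where "\<psi> x = (SOME y. \<exists>s t. (s, t) \<in> H \<and> ev R s = x \<and> ev R t = y)" for x
  have \<psi>: "\<psi> (ev R s) = ev R t" if st: "(s, t) \<in> H" for s t
    unfolding \<psi>_def
  proof (rule some_equality)
    show "\<exists>s' t'. (s', t') \<in> H \<and> ev R s' = ev R s \<and> ev R t' = ev R t" using st by blast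
    fix y assume "\<exists>s' t'. (s', t') \<in> H \<and> ev R s' = ev R s \<and> ev R t' = y"
    then obtain s' t' where *: "(s', t') \<in> H" "ev R s' = ev R s" "ev R t' = y" by blast
    then have "t' - t \<in> R.ker_ev" using H(3)[OF pair_diff[OF H(1) *(1) st]] R.diff_in_ker_ev by blast
    then show "y = ev R t" using * R.diff_in_ker_ev by blast
  qed
  have lift: "\<exists>s t. (s, t) \<in> H \<and> ev R s = x" if "x \<in> carrier R" for x
    using R.ev_surj[OF that] H(4) by (metis UNIV_I imageE prod.collapse)
  have \<psi>_hom: "\<psi> \<in> ring_hom R R"
  proof (rule ring_hom_memI)
    fix x y assume "x \<in> carrier R" "y \<in> carrier R"
    then obtain s t s' t' where st: "(s, t) \<in> H" "ev R s = x" "(s', t') \<in> H" "ev R s' = y"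
      using lift by meson
    show "\<psi> x \<in> carrier R" using \<psi>[OF st(1)] st(2) by auto
    show "\<psi> (x \<otimes>\<^bsub>R\<^esub> y) = \<psi> x \<otimes>\<^bsub>R\<^esub> \<psi> y"
      using \<psi>[OF pair_mult[OF H(1) st(1,3)]] \<psi>[OF st(1)] \<psi>[OF st(3)] st by simp
    show "\<psi> (x \<oplus>\<^bsub>R\<^esub> y) = \<psi> x \<oplus>\<^bsub>R\<^esub> \<psi> y"
      using \<psi>[OF pair_add[OF H(1) st(1,3)]] \<psi>[OF st(1)] \<psi>[OF st(3)] st by simp
  next
    show "\<psi> \<one>\<^bsub>R\<^esub> = \<one>\<^bsub>R\<^esub>" using \<psi>[OF pair_one[OF H(1)]] by simp
  qed
  have \<psi>_closed: "\<psi> x \<in> carrier R" if "x \<in> carrier R" for x using ring_hom_closed[OF \<psi>_hom that] .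
  have comb: "\<exists>c\<in>ev R ` set vs \<rightarrow> carrier R. ev R t = (\<Oplus>\<^bsub>R\<^esub>b\<in>ev R ` set vs. \<psi> (c b) \<otimes>\<^bsub>R\<^esub> b)"
    if "t \<in> T.lspan (snd ` H) vs" for t vs
    using that
  proof (induction vs arbitrary: t)
    case Nil
    then have "t \<in> R.ker_ev" by simp
    then have "ev R t = \<zero>\<^bsub>R\<^esub>" unfolding R.ker_ev_def by blast
    then show ?case by simp
  next
    case (Cons v vs)
    then obtain h s where hs: "h \<in> snd ` H" "s \<in> T.lspan (snd ` H) vs" "t = h * v + s" by auto
    obtain h' where h': "(h', h) \<in> H" using hs(1) by force
    let ?B = "ev R ` set vs" and ?b = "ev R v"
    obtain c where c: "c \<in> ?B \<rightarrow> carrier R" "ev R s = (\<Oplus>\<^bsub>R\<^esub>b\<in>?B. \<psi> (c b) \<otimes>\<^bsub>R\<^esub> b)"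
      using Cons.IH[OF hs(2)] by blast
    define B0 where "B0 = ?B - {?b}"
    \<comment> \<open>The sum runs over the set of images, and \<open>ev R v\<close> may coincide
      with the image of another generator. The new coefficient is therefore added to the one already
      there, or to zero.\<close>
    define d where "d = (if ?b \<in> ?B then c ?b else \<zero>\<^bsub>R\<^esub>)"
    define c' where "c' = c(?b := d \<oplus>\<^bsub>R\<^esub> ev R h')"
    have d: "d \<in> carrier R" using c(1) unfolding d_def by auto
    have B0: "finite B0" "?b \<notin> B0" "ev R ` set (v # vs) = insert ?b B0" unfolding B0_def by auto
    have cB0: "(\<lambda>b. \<psi> (c b) \<otimes>\<^bsub>R\<^esub> b) \<in> B0 \<rightarrow> carrier R"
    proof (rule Pi_I)
      fix b assume "b \<in> B0"
      then have "b \<in> ?B" unfolding B0_def by blast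
      then have "c b \<in> carrier R" "b \<in> carrier R" using funcset_mem[OF c(1)] by auto
      then show "\<psi> (c b) \<otimes>\<^bsub>R\<^esub> b \<in> carrier R" by (intro R.m_closed \<psi>_closed)
    qed
    have \<psi>0: "\<psi> \<zero>\<^bsub>R\<^esub> = \<zero>\<^bsub>R\<^esub>" using \<psi>[OF pair_zero[OF H(1)]] by simp
    have s: "ev R s = \<psi> d \<otimes>\<^bsub>R\<^esub> ?b \<oplus>\<^bsub>R\<^esub> (\<Oplus>\<^bsub>R\<^esub>b\<in>B0. \<psi> (c b) \<otimes>\<^bsub>R\<^esub> b)"
    proof (cases "?b \<in> ?B")
      case True
      then have "?B = insert ?b B0" unfolding B0_def by blast
      then show ?thesis
        unfolding c(2) using R.finsum_insert[OF B0(1,2) cB0] d \<psi>_closed True unfolding d_def by simp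
    next
      case False
      then have "B0 = ?B" unfolding B0_def by blast
      then show ?thesis using c(2) False cB0 unfolding d_def by (simp add: \<psi>0)
    qed
    have c'_eq: "(\<Oplus>\<^bsub>R\<^esub>b\<in>B0. \<psi> (c' b) \<otimes>\<^bsub>R\<^esub> b) = (\<Oplus>\<^bsub>R\<^esub>b\<in>B0. \<psi> (c b) \<otimes>\<^bsub>R\<^esub> b)"
      using B0(2) cB0 by (intro R.finsum_cong') (auto simp: c'_def)
    have "(\<lambda>b. \<psi> (c' b) \<otimes>\<^bsub>R\<^esub> b) \<in> B0 \<rightarrow> carrier R"
      using cB0 B0(2) by (auto simp: c'_def Pi_iff)
    then have "(\<Oplus>\<^bsub>R\<^esub>b\<in>insert ?b B0. \<psi> (c' b) \<otimes>\<^bsub>R\<^esub> b)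
        = \<psi> (d \<oplus>\<^bsub>R\<^esub> ev R h') \<otimes>\<^bsub>R\<^esub> ?b \<oplus>\<^bsub>R\<^esub> (\<Oplus>\<^bsub>R\<^esub>b\<in>B0. \<psi> (c b) \<otimes>\<^bsub>R\<^esub> b)"
      using R.finsum_insert[OF B0(1,2), of "\<lambda>b. \<psi> (c' b) \<otimes>\<^bsub>R\<^esub> b"] c'_eq d \<psi>_closed
      by (simp add: c'_def)
    also have "\<psi> (d \<oplus>\<^bsub>R\<^esub> ev R h') = \<psi> d \<oplus>\<^bsub>R\<^esub> ev R h"
      using ring_hom_add[OF \<psi>_hom d, of "ev R h'"] \<psi>[OF h'] by simp
    finally have "ev R t = (\<Oplus>\<^bsub>R\<^esub>b\<in>insert ?b B0. \<psi> (c' b) \<otimes>\<^bsub>R\<^esub> b)"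
      using s d \<psi>_closed R.finsum_closed[OF cB0] unfolding hs(3) by (simp add: R.l_distr R.a_ac)
    moreover have "c' \<in> insert ?b B0 \<rightarrow> carrier R" using c(1) d unfolding c'_def B0_def by auto
    ultimately show ?case unfolding B0(3) by blast
  qed
  have "finite_self_map R \<psi>"
    unfolding finite_self_map_def
  proof (intro conjI \<psi>_hom exI[of _ "ev R ` set vs"] ballI)
    show "ev R ` set vs \<subseteq> carrier R" "finite (ev R ` set vs)" by auto
    fix x assume "x \<in> carrier R"
    then obtain r where r: "ev R r = x" using R.ev_surj by blast
    obtain t where "t \<in> T.lspan (snd ` H) vs" "r - t \<in> R.ker_ev" using H(5) by blast
    then show "\<exists>c\<in>ev R ` set vs \<rightarrow> carrier R. x = (\<Oplus>\<^bsub>R\<^esub>b\<in>ev R ` set vs. \<psi> (c b) \<otimes>\<^bsub>R\<^esub> b)"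
      using comb[of t vs] R.diff_in_ker_ev r by auto
  qed
  moreover have "\<aa> +>\<^bsub>R\<^esub> \<psi> x = \<phi> (\<aa> +>\<^bsub>R\<^esub> x)" if x: "x \<in> carrier R" for x
  proof -
    obtain s t where st: "(s, t) \<in> H" "ev R s = x" using lift[OF x] by blast
    then have "(s, t) \<in> \<Phi>" using H(2) by blast
    then show ?thesis using \<psi>[OF st(1)] st(2) unfolding \<Phi>_def by simp
  qed
  ultimately show ?thesis by blast
qed

end
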